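(* Let $0<\alpha,\beta<\infty$, let $\varphi:D\to D$ be an analytic self-map of $D$, let $g\in H(D)$, and suppose that the operator $U_gC_\varphi:\mathcal{Z}^\alpha\to\mathcal{Z}^\beta$, $(U_gC_\varphi f)(z)=\int_0^{z} f(\varphi(\xi))g'(\xi)\,d\xi$, is bounded. (i) If $0<\alpha<1$, then $\|U_gC_\varphi\|_{e,\mathcal{Z}^\alpha\to\mathcal{Z}^\beta}=0$. (ii) If $\alpha=1$, then $$\|U_gC_\varphi\|_{e,\mathcal{Z}^1\to\mathcal{Z}^\beta}\asymp\limsup_{n\to\infty}(\log n)\|g'\varphi'\varphi^n\|_{v_\beta}.$$ (iii) If $1<\alpha<2$, then $$\|U_gC_\varphi\|_{e,\mathcal{Z}^\alpha\to\mathcal{Z}^\beta}\asymp\limsup_{n\to\infty}(n+1)^{\alpha-1}\|g'\varphi'\varphi^n\|_{v_\beta}.$$ (iv) If $\alpha=2$, then $$\|U_gC_\varphi\|_{e,\mathcal{Z}^2\to\mathcal{Z}^\beta}\asymp\max\Big\{\limsup_{n\to\infty}(n+1)\|g'\varphi'\varphi^n\|_{v_\beta},\ \limsup_{n\to\infty}(\log n)\|g''\varphi^n\|_{v_\beta}\Big\}.$$ (v) If $\alpha>2$, then $$\|U_gC_\varphi\|_{e,\mathcal{Z}^\alpha\to\mathcal{Z}^\beta}\asymp\max\Big\{\limsup_{n\to\infty}(n+1)^{\alpha-1}\|g'\varphi'\varphi^n\|_{v_\beta},\ \limsup_{n\to\infty}(n+1)^{\alpha-2}\|g''\varphi^n\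|_{v_\beta}\Big\}.$$
   Context: $D=\{z\in\mathbb{C}:|z|<1\}$ and $H(D)$ is the set of analytic functions on $D$. For $0<\alpha<\infty$, the Zygmund type space $\mathcal{Z}^\alpha$ is the Banach space of $f\in H(D)$ with $\sup_{z\in D}(1-|z|^2)^\alpha|f''(z)|<\infty$, normed by $\|f\|_{\mathcal{Z}^\alpha}=|f(0)|+|f'(0)|+\sup_{z\in D}(1-|z|^2)^\alpha|f''(z)|$. For $0<\beta<\infty$, $v_\beta(z)=(1-|z|^2)^\beta$ and $\|h\|_{v_\beta}=\sup_{z\in D}v_\beta(z)|h(z)|$ for $h\in H(D)$. $\varphi^n$ denotes the $n$-th power (pointwise product) of $\varphi$. The essential norm of a bounded linear operator $T:X\to Y$ is $\|T\|_{e,X\to Y}=\inf\{\|T+K\|_{X\to Y}: K:X\to Y\text{ compact}\}$. $A\asymp B$ means that there are positive constants $C_1,C_2$ with $C_1A\le B\le C_2A$ (constants not depending on $g$ or $\varphi$). *)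

theory Defs
  imports "HOL-Complex_Analysis.Complex_Analysis"
begin

abbreviation unit_disc :: "complex set" where
  "unit_disc \<equiv> ball 0 1"

text \<open>
  An analytic function on the disc is represented by the total function that vanishes off the
  disc, so that equality in \<open>H_disc\<close> is equality on the disc and the Zygmund norm is definite.
\<close>

definition H_disc :: "(complex \<Rightarrow> complex) set" where
  "H_disc = {f. f holomorphic_on unit_disc \<and> (\<forall>z. z \<notin> unit_disc \<longrightarrow> f z = 0)}"

definition std_weight :: "real \<Rightarrow> complex \<Rightarrow> real" where
  "std_weight \<beta> z = (1 - (cmod z)\<^sup>2) powr \<beta>"

text \<open>Extended-real valued: the supremum is infinite for unbounded weighted functions.\<close>

definition weighted_norm :: "real \<Rightarrow> (complex \<Rightarrow> complex) \<Rightarrow> ereal" where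
  "weighted_norm \<beta> h = (SUP z\<in>unit_disc. ereal (std_weight \<beta> z * cmod (h z)))"

definition zygmund :: "real \<Rightarrow> (complex \<Rightarrow> complex) set" where
  "zygmund \<alpha> = {f \<in> H_disc.
     bdd_above ((\<lambda>z. std_weight \<alpha> z * cmod (deriv (deriv f) z)) ` unit_disc)}"

definition zyg_norm :: "real \<Rightarrow> (complex \<Rightarrow> complex) \<Rightarrow> real" where
  "zyg_norm \<alpha> f = cmod (f 0) + cmod (deriv f 0)
     + (SUP z\<in>unit_disc. std_weight \<alpha> z * cmod (deriv (deriv f) z))"

text \<open>
  The value 0 off \<open>zygmund \<alpha>\<close> is a dummy: \<open>Metric_space\<close> requires nonnegativity and symmetry
  there too.
\<close>

definition zyg_dist :: "real \<Rightarrow> (complex \<Rightarrow> complex) \<Rightarrow> (complex \<Rightarrow> complex) \<Rightarrow> real" where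
  "zyg_dist \<alpha> f h =
     (if f \<in> zygmund \<alpha> \<and> h \<in> zygmund \<alpha> then zyg_norm \<alpha> (\<lambda>z. f z - h z) else 0)"

lemma deriv2_diff:
  assumes "f \<in> H_disc" "h \<in> H_disc" "z \<in> unit_disc"
  shows "deriv (\<lambda>z. f z - h z) z = deriv f z - deriv h z"
    and "deriv (deriv (\<lambda>z. f z - h z)) z = deriv (deriv f) z - deriv (deriv h) z"
proof -
  have hol: "f holomorphic_on unit_disc" "h holomorphic_on unit_disc"
    using assms by (auto simp: H_disc_def)
  have diffble: "p field_differentiable at w"
    if "p holomorphic_on unit_disc" "w \<in> unit_disc" for p w
    using that holomorphic_on_imp_differentiable_at[of p unit_disc w] by simp
  have 1: "deriv (\<lambda>z. f z - h z) w = deriv f w - deriv h w" if "w \<in> unit_disc" for w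
    using diffble[OF hol(1) that] diffble[OF hol(2) that] by (rule deriv_diff)
  show "deriv (\<lambda>z. f z - h z) z = deriv f z - deriv h z"
    using 1 assms(3) by simp
  have "deriv (deriv (\<lambda>z. f z - h z)) z = deriv (\<lambda>w. deriv f w - deriv h w) z"
  proof (rule deriv_cong_ev)
    show "\<forall>\<^sub>F w in nhds z. deriv (\<lambda>z. f z - h z) w = deriv f w - deriv h w"
      using eventually_nhds_in_open[of unit_disc z] assms(3) 1
      by (auto elim: eventually_mono)
  qed simp
  also have "\<dots> = deriv (deriv f) z - deriv (deriv h) z"
    by (intro deriv_diff diffble holomorphic_deriv hol open_ball assms(3))
  finally show "deriv (deriv (\<lambda>z. f z - h z)) z = deriv (deriv f) z - deriv (deriv h) z" .
qed

lemma std_weight_pos: "z \<in> unit_disc \<Longrightarrow> std_weight \<alpha> z > 0"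
proof -
  assume "z \<in> unit_disc"
  then have "(cmod z)\<^sup>2 < 1"
    by (simp add: power_less_one_iff)
  then show ?thesis by (simp add: std_weight_def)
qed

lemma zygmund_diff:
  assumes "f \<in> zygmund \<alpha>" "h \<in> zygmund \<alpha>"
  shows "(\<lambda>z. f z - h z) \<in> zygmund \<alpha>"
proof -
  obtain A B where
    A: "\<And>z. z \<in> unit_disc \<Longrightarrow> std_weight \<alpha> z * cmod (deriv (deriv f) z) \<le> A" and
    B: "\<And>z. z \<in> unit_disc \<Longrightarrow> std_weight \<alpha> z * cmod (deriv (deriv h) z) \<le> B"
    using assms unfolding zygmund_def bdd_above_def by fastforce
  have H: "f \<in> H_disc" "h \<in> H_disc" using assms by (auto simp: zygmund_def)
  have "std_weight \<alpha> z * cmod (deriv (deriv (\<lambda>z. f z - h z)) z) \<le> A + B"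
    if z: "z \<in> unit_disc" for z
  proof -
    have "std_weight \<alpha> z * cmod (deriv (deriv f) z - deriv (deriv h) z)
        \<le> std_weight \<alpha> z * (cmod (deriv (deriv f) z) + cmod (deriv (deriv h) z))"
      using std_weight_pos[OF z, of \<alpha>] norm_triangle_ineq4
      by (intro mult_left_mono) auto
    then show ?thesis
      using A[OF z] B[OF z] deriv2_diff(2)[OF H z] by (simp add: distrib_left)
  qed
  then show ?thesis
    using H unfolding zygmund_def by (auto simp: H_disc_def intro!: bdd_aboveI2 holomorphic_intros)
qed

lemma zyg_norm_upper:
  assumes "f \<in> zygmund \<alpha>" "z \<in> unit_disc"
  shows "std_weight \<alpha> z * cmod (deriv (deriv f) z)
    \<le> (SUP z\<in>unit_disc. std_weight \<alpha> z * cmod (deriv (deriv f) z))"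
  using assms by (intro cSUP_upper) (auto simp: zygmund_def)

lemma Metric_space_zygmund: "Metric_space (zygmund \<alpha>) (zyg_dist \<alpha>)"
proof -
  define w where "w = std_weight \<alpha>"
  define S where "S f = (SUP z\<in>unit_disc. w z * cmod (deriv (deriv f) z))" for f
  have H: "f \<in> H_disc" if "f \<in> zygmund \<alpha>" for f
    using that by (auto simp: zygmund_def)
  have up: "w z * cmod (deriv (deriv f) z) \<le> S f" if "f \<in> zygmund \<alpha>" "z \<in> unit_disc" for f z
    unfolding S_def w_def using that by (rule zyg_norm_upper)
  have w: "w z > 0" if "z \<in> unit_disc" for z
    unfolding w_def using that by (rule std_weight_pos)
  have S0: "S f \<ge> 0" if "f \<in> zygmund \<alpha>" for f
  proof -
    have "0 \<le> w 0 * cmod (deriv (deriv f) 0)" using w[of 0] by simp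
    also have "\<dots> \<le> S f" using that by (intro up) auto
    finally show ?thesis .
  qed
  have dist: "zyg_dist \<alpha> f h = cmod (f 0 - h 0) + cmod (deriv f 0 - deriv h 0) + S (\<lambda>z. f z - h z)"
    if "f \<in> zygmund \<alpha>" "h \<in> zygmund \<alpha>" for f h
    using that deriv2_diff(1)[OF H H, of f h 0]
    by (simp add: zyg_dist_def zyg_norm_def S_def w_def)
  have S_le: "S (\<lambda>z. f z - h z) \<le> C"
    if "f \<in> zygmund \<alpha>" "h \<in> zygmund \<alpha>"
      "\<And>z. z \<in> unit_disc \<Longrightarrow> w z * cmod (deriv (deriv f) z - deriv (deriv h) z) \<le> C" for f h C
    unfolding S_def by (rule cSUP_least) (simp_all add: that H deriv2_diff(2))
  have up2: "w z * cmod (deriv (deriv f) z - deriv (deriv h) z) \<le> S (\<lambda>z. f z - h z)"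
    if "f \<in> zygmund \<alpha>" "h \<in> zygmund \<alpha>" "z \<in> unit_disc" for f h z
    using up[OF zygmund_diff[OF that(1,2)] that(3)] by (simp only: deriv2_diff(2)[OF H[OF that(1)] H[OF that(2)] that(3)])
  show ?thesis
  proof
    show "0 \<le> zyg_dist \<alpha> f h" for f h
    proof (cases "f \<in> zygmund \<alpha> \<and> h \<in> zygmund \<alpha>")
      case True
      then show ?thesis
        using dist[of f h] S0[OF zygmund_diff[of f \<alpha> h]] by simp
    qed (auto simp: zyg_dist_def)
  next
    have S_comm: "S (\<lambda>z. f z - h z) \<le> S (\<lambda>z. h z - f z)"
      if "f \<in> zygmund \<alpha>" "h \<in> zygmund \<alpha>" for f h
      by (rule S_le[OF that]) (subst norm_minus_commute, rule up2[OF that(2,1)])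
    show "zyg_dist \<alpha> f h = zyg_dist \<alpha> h f" for f h
    proof (cases "f \<in> zygmund \<alpha> \<and> h \<in> zygmund \<alpha>")
      case True
      then show ?thesis
        using dist[of f h] dist[of h f] S_comm[of f h] S_comm[of h f]
        by (simp add: norm_minus_commute)
    qed (auto simp: zyg_dist_def)
  next
    fix f h assume fh: "f \<in> zygmund \<alpha>" "h \<in> zygmund \<alpha>"
    show "zyg_dist \<alpha> f h = 0 \<longleftrightarrow> f = h"
    proof
      assume "f = h"
      have "S (\<lambda>z. f z - h z) \<le> 0"
        by (rule S_le[OF fh]) (simp add: \<open>f = h\<close>)
      then show "zyg_dist \<alpha> f h = 0"
        using S0[OF zygmund_diff[OF fh]] dist[OF fh] \<open>f = h\<close> by simp
    next
      assume "zyg_dist \<alpha> f h = 0"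
      then have z: "f 0 = h 0" "deriv f 0 = deriv h 0" "S (\<lambda>z. f z - h z) = 0"
        using dist[OF fh] S0[OF zygmund_diff[OF fh]]
          norm_ge_zero[of "f 0 - h 0"] norm_ge_zero[of "deriv f 0 - deriv h 0"]
        by (auto simp: add_nonneg_eq_0_iff)
      define p where "p = (\<lambda>z. f z - h z)"
      have p: "p holomorphic_on unit_disc"
        using H[OF fh(1)] H[OF fh(2)] by (auto simp: p_def H_disc_def intro!: holomorphic_intros)
      have p2: "deriv (deriv p) z = 0" if "z \<in> unit_disc" for z
      proof -
        have "w z * cmod (deriv (deriv f) z - deriv (deriv h) z) \<le> 0"
          using up2[OF fh that] z(3) by simp
        then have "deriv (deriv f) z - deriv (deriv h) z = 0"
          using w[OF that] by (simp add: mult_le_0_iff)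
        then show ?thesis
          using deriv2_diff(2)[OF H H that] fh by (simp add: p_def)
      qed
      have const: "q z = q 0" if "q holomorphic_on unit_disc" "z \<in> unit_disc"
        "\<And>z. z \<in> unit_disc \<Longrightarrow> deriv q z = 0" for q z
      proof (rule has_field_derivative_zero_constant[of unit_disc q, THEN exE])
        show "convex unit_disc" by simp
        show "(q has_field_derivative 0) (at x within unit_disc)" if "x \<in> unit_disc" for x
          using holomorphic_derivI[OF \<open>q holomorphic_on unit_disc\<close> open_ball that, of unit_disc]
            \<open>\<And>z. z \<in> unit_disc \<Longrightarrow> deriv q z = 0\<close>[OF that] by simp
        show "q z = q 0" if "\<forall>x\<in>unit_disc. q x = c" for c
          using that \<open>z \<in> unit_disc\<close> by simp
      qed
      have p1: "deriv p z = 0" if "z \<in> unit_disc" for z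
        using const[OF holomorphic_deriv[OF p open_ball] that p2]
          deriv2_diff(1)[OF H[OF fh(1)] H[OF fh(2)], of 0] z(2) by (simp add: p_def)
      have "p z = 0" if "z \<in> unit_disc" for z
        using const[OF p that p1] z(1) by (simp add: p_def)
      moreover have "p z = 0" if "z \<notin> unit_disc" for z
        using H[OF fh(1)] H[OF fh(2)] that by (simp add: p_def H_disc_def)
      ultimately show "f = h"
        by (auto simp: p_def fun_eq_iff)
    qed
  next
    fix f h k assume fhk: "f \<in> zygmund \<alpha>" "h \<in> zygmund \<alpha>" "k \<in> zygmund \<alpha>"
    have "S (\<lambda>z. f z - k z) \<le> S (\<lambda>z. f z - h z) + S (\<lambda>z. h z - k z)"
    proof (rule S_le[OF fhk(1,3)])
      fix z :: complex assume z: "z \<in> unit_disc"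
      have "w z * cmod (deriv (deriv f) z - deriv (deriv k) z)
          \<le> w z * (cmod (deriv (deriv f) z - deriv (deriv h) z)
                 + cmod (deriv (deriv h) z - deriv (deriv k) z))"
        using w[OF z] by (intro mult_left_mono) (simp_all add: dist_triangle flip: dist_norm)
      then show "w z * cmod (deriv (deriv f) z - deriv (deriv k) z)
          \<le> S (\<lambda>z. f z - h z) + S (\<lambda>z. h z - k z)"
        using up2[OF fhk(1,2) z] up2[OF fhk(2,3) z] by (simp add: distrib_left)
    qed
    moreover have "cmod (f 0 - k 0) \<le> cmod (f 0 - h 0) + cmod (h 0 - k 0)"
      "cmod (deriv f 0 - deriv k 0) \<le> cmod (deriv f 0 - deriv h 0) + cmod (deriv h 0 - deriv k 0)"
      using dist_triangle by (simp_all add: dist_norm[symmetric])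
    ultimately show "zyg_dist \<alpha> f k \<le> zyg_dist \<alpha> f h + zyg_dist \<alpha> h k"
      using dist fhk by simp
  qed
qed

abbreviation zyg_topology :: "real \<Rightarrow> (complex \<Rightarrow> complex) topology" where
  "zyg_topology \<alpha> \<equiv> Metric_space.mtopology (zygmund \<alpha>) (zyg_dist \<alpha>)"

definition zyg_unit_ball :: "real \<Rightarrow> (complex \<Rightarrow> complex) set" where
  "zyg_unit_ball \<alpha> = {f \<in> zygmund \<alpha>. zyg_norm \<alpha> f \<le> 1}"

type_synonym operator = "(complex \<Rightarrow> complex) \<Rightarrow> (complex \<Rightarrow> complex)"

definition linear_op :: "real \<Rightarrow> real \<Rightarrow> operator \<Rightarrow> bool" where
  "linear_op \<alpha> \<beta> T \<longleftrightarrow>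
     T \<in> zygmund \<alpha> \<rightarrow> zygmund \<beta> \<and>
     (\<forall>f\<in>zygmund \<alpha>. \<forall>h\<in>zygmund \<alpha>. T (\<lambda>z. f z + h z) = (\<lambda>z. T f z + T h z)) \<and>
     (\<forall>c. \<forall>f\<in>zygmund \<alpha>. T (\<lambda>z. c * f z) = (\<lambda>z. c * T f z))"

definition bounded_op :: "real \<Rightarrow> real \<Rightarrow> operator \<Rightarrow> bool" where
  "bounded_op \<alpha> \<beta> T \<longleftrightarrow>
     linear_op \<alpha> \<beta> T \<and> (\<exists>C. \<forall>f\<in>zygmund \<alpha>. zyg_norm \<beta> (T f) \<le> C * zyg_norm \<alpha> f)"

definition compact_op :: "real \<Rightarrow> real \<Rightarrow> operator \<Rightarrow> bool" where
  "compact_op \<alpha> \<beta> K \<longleftrightarrow>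
     linear_op \<alpha> \<beta> K \<and>
     compactin (zyg_topology \<beta>) (zyg_topology \<beta> closure_of (K ` zyg_unit_ball \<alpha>))"

definition op_norm :: "real \<Rightarrow> real \<Rightarrow> operator \<Rightarrow> ereal" where
  "op_norm \<alpha> \<beta> T = (SUP f\<in>zyg_unit_ball \<alpha>. ereal (zyg_norm \<beta> (T f)))"

definition ess_norm :: "real \<Rightarrow> real \<Rightarrow> operator \<Rightarrow> ereal" where
  "ess_norm \<alpha> \<beta> T = (INF K\<in>{K. compact_op \<alpha> \<beta> K}. op_norm \<alpha> \<beta> (\<lambda>f z. T f z + K f z))"

definition UC :: "(complex \<Rightarrow> complex) \<Rightarrow> (complex \<Rightarrow> complex) \<Rightarrow> operator" where
  "UC g \<phi> f z = (if z \<in> unit_disc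
     then contour_integral (linepath 0 z) (\<lambda>\<xi>. f (\<phi> \<xi>) * deriv g \<xi>) else 0)"

text \<open>The constants are uniform over the index set \<open>S\<close>.\<close>

definition comparable_on :: "'a set \<Rightarrow> ('a \<Rightarrow> ereal) \<Rightarrow> ('a \<Rightarrow> ereal) \<Rightarrow> bool" where
  "comparable_on S A B \<longleftrightarrow>
     (\<exists>C1>0. \<exists>C2>0. \<forall>x\<in>S. ereal C1 * A x \<le> B x \<and> B x \<le> ereal C2 * A x)"

end

theory Submission
  imports Defs "HOL-Real_Asymp.Real_Asymp"
begin

text \<open>
  Put \<open>u = g' \<phi>'\<close> and \<open>v = g''\<close>. Since \<open>T f = UC g \<phi> f\<close> has second derivative
  \<open>f'(\<phi>) u + f(\<phi>) v\<close>, the size of \<open>T f\<close> is governed by how fast \<open>f'\<close> and \<open>f\<close> can grow at the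
  points of the unit circle that \<open>\<phi>\<close> approaches. On the unit ball of \<open>Z\<^sup>\<alpha>\<close> one has, near
  the circle and up to constants, \<open>|f'(z)| \<le> w(\<alpha> - 1, |z|)\<close> for \<open>\<alpha> \<ge> 1\<close> and \<open>|f(z)| \<le> w(\<alpha> - 2, |z|)\<close> for \<open>\<alpha> \<ge> 2\<close>, where
  \<open>w(\<gamma>, x) = (1 - x) powr (- \<gamma>)\<close> for \<open>\<gamma> > 0\<close> and \<open>w(0, x) = ln (1 / (1 - x))\<close>; below the
  respective threshold \<open>f'\<close> or \<open>f\<close> is uniformly Hoelder continuous up to the circle. The essential norm turns out to
  be comparable to the upper limits of \<open>v\<^sub>\<beta> |u| w(\<alpha> - 1, |\<phi>|)\<close> and, for \<open>\<alpha> \<ge> 2\<close>, of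
  \<open>v\<^sub>\<beta> |v| w(\<alpha> - 2, |\<phi>|)\<close> as \<open>|\<phi>(z)| \<rightarrow> 1\<close>; the predicate \<open>bdry_le\<close> expresses bounds on them.

  \<^bold>\<open>Powers of the symbol.\<close> The sequence \<open>a\<^sub>n = (n + 1) powr \<gamma>\<close> (\<open>ln n\<close> if \<open>\<gamma> = 0\<close>) satisfies \<open>a\<^sub>n x\<^sup>n \<le> C w(\<gamma>, x)\<close>, and
  the bound is attained up to a constant at \<open>n\<close> close to \<open>1 / (1 - x)\<close>. Hence the upper limit of
  \<open>a\<^sub>n\<close> times the weighted norm of \<open>h \<phi>\<^sup>n\<close> is comparable to the boundary quantity of \<open>h\<close>
  (\<open>bdry_le_of_limsup\<close>, \<open>limsup_le_of_bdry_le\<close>).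

  \<^bold>\<open>Upper estimate.\<close> For \<open>f\<^sub>r(z) = f(r z)\<close> with \<open>r < 1\<close> the operator \<open>f \<mapsto> T f\<^sub>r\<close> is compact, by Montel's
  theorem and the Cauchy estimates. As \<open>r \<rightarrow> 1\<close>, both \<open>f - f\<^sub>r\<close> and its derivative tend to \<open>0\<close> on
  smaller discs, uniformly over the unit ball, so in \<open>T f - T f\<^sub>r\<close> only the points with \<open>|\<phi>(z)|\<close>
  close to \<open>1\<close> survive (\<open>ess_norm_le\<close>), and there the growth or Hoelder estimates apply.

  \<^bold>\<open>Lower estimate.\<close> Let \<open>K\<close> be compact and \<open>f\<^sub>k\<close> a sequence of norm at most \<open>B\<close>. Along a subsequence
  \<open>K f\<^sub>k\<close> converges, so \<open>T (f\<^sub>j - f\<^sub>i)\<close> has norm at most \<open>2 B\<close> times that of \<open>T + K\<close> plus something small.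
  Apply this to \<open>f\<^sub>k = F (\<phi> (z\<^sub>k))\<close> with \<open>|\<phi>(z\<^sub>k)| \<rightarrow> 1\<close>, where \<open>F a\<close> has, up to a constant, the largest possible
  derivative (or value) at \<open>a\<close>, and evaluate the second derivative at \<open>z\<^sub>j\<close>: for \<open>j\<close> far beyond \<open>i\<close>
  the contribution of \<open>f\<^sub>i\<close> is negligible (\<open>test_family_bound\<close>, \<open>fixed_function_small\<close>). The test
  functions are combinations of the kernels \<open>(1 - |a|\<^sup>2)\<^sup>j / (1 - cnj a z)\<^sup>s\<close> or, when the relevant
  exponent \<open>\<gamma>\<close> is \<open>0\<close>, are built from \<open>ln (1 - cnj a z)\<close>.
\<close>

section \<open>The Zygmund spaces\<close>

lemma deriv_cong_disc:
  assumes "\<And>w. w \<in> unit_disc \<Longrightarrow> f w = h w" "z \<in> unit_disc"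
  shows "deriv f z = deriv h z"
proof (rule deriv_cong_ev)
  show "\<forall>\<^sub>F w in nhds z. f w = h w"
    using eventually_nhds_in_open[of unit_disc z] assms by (auto elim: eventually_mono)
qed simp

lemma H_disc_derivs:
  assumes "f holomorphic_on unit_disc" "z \<in> unit_disc"
  shows "(f has_field_derivative deriv f z) (at z)"
    and "(deriv f has_field_derivative deriv (deriv f) z) (at z)"
  using holomorphic_derivI[OF assms(1) open_ball assms(2)]
    holomorphic_derivI[OF holomorphic_deriv[OF assms(1) open_ball] open_ball assms(2)] by auto

lemma derivs_on_disc:
  assumes "\<And>z. z \<in> unit_disc \<Longrightarrow> (f has_field_derivative f1 z) (at z)"
    "\<And>z. z \<in> unit_disc \<Longrightarrow> (f1 has_field_derivative f2 z) (at z)" "z \<in> unit_disc"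
  shows "deriv f z = f1 z" "deriv (deriv f) z = f2 z"
proof -
  have *: "deriv f z = f1 z" if "z \<in> unit_disc" for z
    using assms(1)[OF that] by (rule DERIV_imp_deriv)
  then show "deriv f z = f1 z" using assms(3) .
  have "deriv (deriv f) z = deriv f1 z" by (rule deriv_cong_disc) (use * assms in auto)
  then show "deriv (deriv f) z = f2 z" using assms(2)[OF assms(3)] by (simp add: DERIV_imp_deriv)
qed

text \<open>Membership and norm are always verified from explicit first and second derivatives, which
  avoids computing with iterated \<open>deriv\<close>.\<close>

lemma zygmundI:
  assumes "\<And>z. z \<in> unit_disc \<Longrightarrow> (f has_field_derivative f1 z) (at z)"
    "\<And>z. z \<in> unit_disc \<Longrightarrow> (f1 has_field_derivative f2 z) (at z)"
    "\<And>z. z \<notin> unit_disc \<Longrightarrow> f z = 0"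
    "\<And>z. z \<in> unit_disc \<Longrightarrow> std_weight \<alpha> z * cmod (f2 z) \<le> B"
  shows "f \<in> zygmund \<alpha>" "zyg_norm \<alpha> f \<le> cmod (f 0) + cmod (f1 0) + B"
proof -
  note d = derivs_on_disc[of f f1 f2, OF assms(1,2)]
  have "f holomorphic_on unit_disc"
    using assms(1) holomorphic_on_open[OF open_ball] by blast
  moreover have b: "std_weight \<alpha> z * cmod (deriv (deriv f) z) \<le> B" if "z \<in> unit_disc" for z
    using assms(4)[OF that] d(2)[OF _ _ that] by simp
  ultimately show "f \<in> zygmund \<alpha>"
    using assms(3) by (auto simp: zygmund_def H_disc_def intro!: bdd_aboveI2)
  have "(SUP z\<in>unit_disc. std_weight \<alpha> z * cmod (deriv (deriv f) z)) \<le> B"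
    by (rule cSUP_least) (use b in auto)
  then show "zyg_norm \<alpha> f \<le> cmod (f 0) + cmod (f1 0) + B"
    using d(1)[of 0] by (simp add: zyg_norm_def)
qed

lemma zygmund_hol: "f \<in> zygmund \<alpha> \<Longrightarrow> f holomorphic_on unit_disc"
  and zygmund_off: "f \<in> zygmund \<alpha> \<Longrightarrow> z \<notin> unit_disc \<Longrightarrow> f z = 0"
  by (auto simp: zygmund_def H_disc_def)

lemma zyg_norm_bounds:
  assumes "f \<in> zygmund \<alpha>"
  shows "cmod (f 0) \<le> zyg_norm \<alpha> f" "cmod (deriv f 0) \<le> zyg_norm \<alpha> f" "0 \<le> zyg_norm \<alpha> f"
    "z \<in> unit_disc \<Longrightarrow> cmod (f 0) + cmod (deriv f 0)
       + std_weight \<alpha> z * cmod (deriv (deriv f) z) \<le> zyg_norm \<alpha> f"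
    "z \<in> unit_disc \<Longrightarrow> std_weight \<alpha> z * cmod (deriv (deriv f) z) \<le> zyg_norm \<alpha> f"
proof -
  have *: "cmod (f 0) + cmod (deriv f 0)
       + std_weight \<alpha> z * cmod (deriv (deriv f) z) \<le> zyg_norm \<alpha> f" if "z \<in> unit_disc" for z
    using zyg_norm_upper[OF assms that] by (simp add: zyg_norm_def)
  have w: "0 \<le> std_weight \<alpha> 0 * cmod (deriv (deriv f) 0)" 
    by (simp add: std_weight_def)
  show "z \<in> unit_disc \<Longrightarrow> cmod (f 0) + cmod (deriv f 0)
       + std_weight \<alpha> z * cmod (deriv (deriv f) z) \<le> zyg_norm \<alpha> f" by fact
  show "z \<in> unit_disc \<Longrightarrow> std_weight \<alpha> z * cmod (deriv (deriv f) z) \<le> zyg_norm \<alpha> f"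
    using *[of z] norm_ge_zero[of "f 0"] norm_ge_zero[of "deriv f 0"] by linarith
  show "cmod (f 0) \<le> zyg_norm \<alpha> f" "cmod (deriv f 0) \<le> zyg_norm \<alpha> f" "0 \<le> zyg_norm \<alpha> f"
    using *[of 0, simplified] w norm_ge_zero[of "f 0"] norm_ge_zero[of "deriv f 0"] by linarith+
qed

lemma zygmund_lincomb:
  assumes "f \<in> zygmund \<alpha>" "h \<in> zygmund \<alpha>"
  shows "(\<lambda>z. a * f z + b * h z) \<in> zygmund \<alpha>"
    "zyg_norm \<alpha> (\<lambda>z. a * f z + b * h z) \<le> cmod a * zyg_norm \<alpha> f + cmod b * zyg_norm \<alpha> h"
proof -
  let ?k = "\<lambda>z. a * f z + b * h z" and ?k1 = "\<lambda>z. a * deriv f z + b * deriv h z"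
    and ?k2 = "\<lambda>z. a * deriv (deriv f) z + b * deriv (deriv h) z"
  define A where "A f = cmod (f 0) + cmod (deriv f 0)" for f :: "complex \<Rightarrow> complex"
  let ?B = "cmod a * (zyg_norm \<alpha> f - A f) + cmod b * (zyg_norm \<alpha> h - A h)"
  have 1: "(?k has_field_derivative ?k1 z) (at z)" "(?k1 has_field_derivative ?k2 z) (at z)"
    if "z \<in> unit_disc" for z
    using H_disc_derivs[OF zygmund_hol[OF assms(1)] that] H_disc_derivs[OF zygmund_hol[OF assms(2)] that]
    by (auto intro!: derivative_eq_intros)
  have 2: "std_weight \<alpha> z * cmod (?k2 z) \<le> ?B" if z: "z \<in> unit_disc" for z
  proof -
    have w: "0 < std_weight \<alpha> z" using z by (rule std_weight_pos)
    have "std_weight \<alpha> z * cmod (?k2 z) \<le> std_weight \<alpha> z * (cmod a * cmod (deriv (deriv f) z) + cmod b * cmod (deriv (deriv h) z))"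
      using w by (intro mult_left_mono) (auto intro: norm_triangle_le simp: norm_mult)
    also have "\<dots> = cmod a * (std_weight \<alpha> z * cmod (deriv (deriv f) z)) + cmod b * (std_weight \<alpha> z * cmod (deriv (deriv h) z))"
      by (simp add: algebra_simps)
    also have "\<dots> \<le> ?B"
      using zyg_norm_bounds(4)[OF assms(1) z] zyg_norm_bounds(4)[OF assms(2) z]
      by (intro add_mono mult_left_mono) (auto simp: A_def)
    finally show ?thesis .
  qed
  have 3: "?k z = 0" if "z \<notin> unit_disc" for z
    using zygmund_off[OF assms(1) that] zygmund_off[OF assms(2) that] by simp
  show "?k \<in> zygmund \<alpha>" by (rule zygmundI[OF 1 3 2])
  have "zyg_norm \<alpha> ?k \<le> cmod (?k 0) + cmod (?k1 0) + ?B" by (rule zygmundI(2)[OF 1 3 2])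
  also have "\<dots> \<le> (cmod a * cmod (f 0) + cmod b * cmod (h 0)) + (cmod a * cmod (deriv f 0) + cmod b * cmod (deriv h 0)) + ?B"
    by (intro add_mono order_refl) (auto intro: norm_triangle_le simp: norm_mult)
  also have "\<dots> = cmod a * zyg_norm \<alpha> f + cmod b * zyg_norm \<alpha> h"
    by (simp add: A_def algebra_simps)
  finally show "zyg_norm \<alpha> ?k \<le> cmod a * zyg_norm \<alpha> f + cmod b * zyg_norm \<alpha> h" .
qed

lemma zyg_norm_diff: "f \<in> zygmund \<alpha> \<Longrightarrow> h \<in> zygmund \<alpha> \<Longrightarrow>
    zyg_norm \<alpha> (\<lambda>z. f z - h z) \<le> zyg_norm \<alpha> f + zyg_norm \<alpha> h"
  using zygmund_lincomb(2)[of f \<alpha> h 1 "-1"] by simp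

lemma zygmund_add: "f \<in> zygmund \<alpha> \<Longrightarrow> h \<in> zygmund \<alpha> \<Longrightarrow> (\<lambda>z. f z + h z) \<in> zygmund \<alpha>"
  using zygmund_lincomb(1)[of f \<alpha> h 1 1] by simp

lemma zygmund_scale: "f \<in> zygmund \<alpha> \<Longrightarrow> (\<lambda>z. c * f z) \<in> zygmund \<alpha>"
  using zygmund_lincomb(1)[of f \<alpha> f c 0] by simp

lemma zyg_norm_scale: "f \<in> zygmund \<alpha> \<Longrightarrow> zyg_norm \<alpha> (\<lambda>z. c * f z) \<le> cmod c * zyg_norm \<alpha> f"
  using zygmund_lincomb(2)[of f \<alpha> f c 0] by simp

lemma zygmund_zero: "(\<lambda>z. 0) \<in> zygmund \<alpha>" "zyg_norm \<alpha> (\<lambda>z. 0) \<le> 0"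
proof -
  show "(\<lambda>z. 0) \<in> zygmund \<alpha>" "zyg_norm \<alpha> (\<lambda>z. 0) \<le> 0"
    using zygmundI[of "\<lambda>z. 0" "\<lambda>z. 0" "\<lambda>z. 0" \<alpha> 0] by auto
qed

section \<open>The operator\<close>

text \<open>The disc is convex, so the integrand has a primitive there and the segment integrals in \<open>UC\<close>
  are increments of it; the second derivative then is a matter of the product and chain rules.\<close>

lemma UC_primitive:
  assumes g: "g holomorphic_on unit_disc" and p: "\<phi> holomorphic_on unit_disc"
    "\<phi> ` unit_disc \<subseteq> unit_disc" and f: "f holomorphic_on unit_disc"
  shows "z \<in> unit_disc \<Longrightarrow> (UC g \<phi> f has_field_derivative f (\<phi> z) * deriv g z) (at z)"
    "UC g \<phi> f 0 = 0" "z \<notin> unit_disc \<Longrightarrow> UC g \<phi> f z = 0"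
    "z \<in> unit_disc \<Longrightarrow> ((\<lambda>z. f (\<phi> z) * deriv g z) has_field_derivative
       deriv f (\<phi> z) * (deriv g z * deriv \<phi> z) + f (\<phi> z) * deriv (deriv g) z) (at z)"
proof -
  have "(f \<circ> \<phi>) holomorphic_on unit_disc"
    using p f by (intro holomorphic_on_compose_gen[of _ _ _ unit_disc]) auto
  then have hol: "(\<lambda>z. f (\<phi> z) * deriv g z) holomorphic_on unit_disc"
    using g by (auto intro!: holomorphic_intros simp: o_def)
  obtain P where P: "\<And>x. x \<in> unit_disc \<Longrightarrow> (P has_field_derivative f (\<phi> x) * deriv g x) (at x within unit_disc)"
    using holomorphic_convex_primitive'[OF convex_ball open_ball hol] by auto
  have eq: "UC g \<phi> f z = P z - P 0" if z: "z \<in> unit_disc" for z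
  proof -
    have "((\<lambda>\<xi>. f (\<phi> \<xi>) * deriv g \<xi>) has_contour_integral P (pathfinish (linepath 0 z)) - P (pathstart (linepath 0 z))) (linepath 0 z)"
    proof (rule contour_integral_primitive[OF P])
      have "closed_segment 0 z \<subseteq> unit_disc"
        using z by (intro closed_segment_subset) auto
      then show "path_image (linepath 0 z) \<subseteq> unit_disc" by simp
    qed auto
    then show ?thesis using z by (simp add: UC_def contour_integral_unique)
  qed
  show "(UC g \<phi> f has_field_derivative f (\<phi> z) * deriv g z) (at z)" if z: "z \<in> unit_disc"
  proof (rule has_field_derivative_transform_within_open[of "\<lambda>z. P z - P 0" _ _ unit_disc])
    show "((\<lambda>z. P z - P 0) has_field_derivative f (\<phi> z) * deriv g z) (at z)"
      using P[OF z] at_within_open[OF z open_ball] by (auto intro!: derivative_eq_intros)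
  qed (use eq z in auto)
  show "UC g \<phi> f 0 = 0" using eq[of 0] by simp
  show "z \<notin> unit_disc \<Longrightarrow> UC g \<phi> f z = 0" by (simp add: UC_def)
  show "((\<lambda>z. f (\<phi> z) * deriv g z) has_field_derivative
       deriv f (\<phi> z) * (deriv g z * deriv \<phi> z) + f (\<phi> z) * deriv (deriv g) z) (at z)" if z: "z \<in> unit_disc"
  proof -
    have "\<phi> z \<in> unit_disc" using p z by blast
    note d = H_disc_derivs(1)[OF f this] H_disc_derivs(1)[OF p(1) z] H_disc_derivs(2)[OF g z]
    show ?thesis
      using DERIV_mult[OF DERIV_chain2[OF d(1,2)] d(3)] by (simp add: algebra_simps)
  qed
qed

locale bounded_UC =
  fixes \<alpha> \<beta> :: real and g \<phi> :: "complex \<Rightarrow> complex"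
  assumes alpha_pos: "0 < \<alpha>"
    and g_hol: "g holomorphic_on unit_disc" and phi_hol: "\<phi> holomorphic_on unit_disc"
    and phi_self: "\<phi> ` unit_disc \<subseteq> unit_disc"
    and bounded: "bounded_op \<alpha> \<beta> (UC g \<phi>)"
begin

abbreviation "T \<equiv> UC g \<phi>"

definition "u z = deriv g z * deriv \<phi> z"

definition "v = deriv (deriv g)"

abbreviation "wu z \<equiv> std_weight \<beta> z * cmod (u z)"

abbreviation "wv z \<equiv> std_weight \<beta> z * cmod (v z)"

lemma phi_in: "cmod z < 1 \<Longrightarrow> cmod (\<phi> z) < 1"
  using phi_self by (auto simp: image_subset_iff)

lemma T_linear: "linear_op \<alpha> \<beta> T"
  using bounded by (simp add: bounded_op_def)

lemma T_in: "f \<in> zygmund \<alpha> \<Longrightarrow> T f \<in> zygmund \<beta>"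
  using T_linear by (auto simp: linear_op_def)

lemma T_diff:
  assumes "f \<in> zygmund \<alpha>" "h \<in> zygmund \<alpha>"
  shows "T (\<lambda>z. f z - h z) = (\<lambda>z. T f z - T h z)"
proof -
  have "T (\<lambda>z. f z + (- 1) * h z) = (\<lambda>z. T f z + T (\<lambda>z. (- 1) * h z) z)"
    using T_linear assms(1) zygmund_scale[OF assms(2), of "-1"] unfolding linear_op_def by metis
  moreover have "T (\<lambda>z. (- 1) * h z) = (\<lambda>z. (- 1) * T h z)"
    using T_linear assms(2) unfolding linear_op_def by metis
  ultimately show ?thesis by simp
qed

lemma T_deriv2:
  assumes "f holomorphic_on unit_disc" "z \<in> unit_disc"
  shows "deriv (deriv (T f)) z = deriv f (\<phi> z) * u z + f (\<phi> z) * v z"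
  using derivs_on_disc(2)[OF UC_primitive(1,4)[OF g_hol phi_hol phi_self assms(1)] assms(2)]
  by (simp add: u_def v_def)

text \<open>\<open>T f\<close> vanishes at \<open>0\<close>, so apart from the second derivative only
  \<open>(T f)'(0) = f(\<phi>(0)) g'(0)\<close> enters the norm.\<close>

lemma T_norm_le:
  assumes f: "f \<in> zygmund \<alpha>"
    and B: "\<And>z. z \<in> unit_disc \<Longrightarrow>
      std_weight \<beta> z * cmod (deriv f (\<phi> z) * u z + f (\<phi> z) * v z) \<le> B"
  shows "zyg_norm \<beta> (T f) \<le> cmod (f (\<phi> 0)) * cmod (deriv g 0) + B"
proof -
  note h = zygmund_hol[OF f]
  show ?thesis
    using zygmundI(2)[OF UC_primitive(1,4,3)[OF g_hol phi_hol phi_self h], of \<beta> B]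
      B UC_primitive(2)[OF g_hol phi_hol phi_self h]
    by (simp add: u_def v_def norm_mult)
qed

lemma T_norm_ge:
  assumes f: "f \<in> zygmund \<alpha>" and z: "z \<in> unit_disc"
  shows "std_weight \<beta> z * cmod (deriv f (\<phi> z) * u z + f (\<phi> z) * v z) \<le> zyg_norm \<beta> (T f)"
  using zyg_norm_bounds(5)[OF T_in[OF f] z] T_deriv2[OF zygmund_hol[OF f] z] by simp

lemma T_bound: obtains C where "0 < C" "\<And>f. f \<in> zygmund \<alpha> \<Longrightarrow> zyg_norm \<beta> (T f) \<le> C * zyg_norm \<alpha> f"
proof -
  obtain C where C: "\<And>f. f \<in> zygmund \<alpha> \<Longrightarrow> zyg_norm \<beta> (T f) \<le> C * zyg_norm \<alpha> f"
    using bounded by (auto simp: bounded_op_def)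
  show thesis
  proof (rule that[of "max C 1"])
    show "zyg_norm \<beta> (T f) \<le> max C 1 * zyg_norm \<alpha> f" if "f \<in> zygmund \<alpha>" for f
      using C[OF that] mult_right_mono[of C "max C 1" "zyg_norm \<alpha> f"] zyg_norm_bounds(3)[OF that]
      by (simp add: mult.commute)
  qed simp
qed

text \<open>Boundedness of \<open>T\<close> at the function \<open>1\<close> bounds \<open>v\<close>; at the function \<open>z\<close> it bounds \<open>u + \<phi> v\<close>, and
  hence \<open>u\<close>.\<close>

lemma coeff_bounded:
  obtains M where "0 < M" "\<And>z. z \<in> unit_disc \<Longrightarrow> wu z \<le> M"
    "\<And>z. z \<in> unit_disc \<Longrightarrow> wv z \<le> M"
proof -
  let ?one = "\<lambda>z. if z \<in> unit_disc then 1 else 0 :: complex"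
  let ?id = "\<lambda>z. if z \<in> unit_disc then z else 0 :: complex"
  have d1: "(?one has_field_derivative 0) (at z)" and did: "(?id has_field_derivative 1) (at z)"
    if "z \<in> unit_disc" for z
    using has_field_derivative_transform_within_open[OF DERIV_const open_ball that, of 1 ?one]
      has_field_derivative_transform_within_open[OF DERIV_ident open_ball that, of ?id] by auto
  have one: "?one \<in> zygmund \<alpha>" "?id \<in> zygmund \<alpha>"
    using zygmundI(1)[of ?one "\<lambda>_. 0" "\<lambda>_. 0" \<alpha> 0] zygmundI(1)[of ?id "\<lambda>_. 1" "\<lambda>_. 0" \<alpha> 0] d1 did
    by auto
  define M1 where "M1 = zyg_norm \<beta> (T ?one)"
  define M2 where "M2 = zyg_norm \<beta> (T ?id)"
  have v: "wv z \<le> M1" if z: "z \<in> unit_disc" for z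
    using T_norm_ge[OF one(1) z] phi_in[of z] z DERIV_imp_deriv[OF d1, of "\<phi> z"]
    by (simp add: M1_def)
  have u: "wu z \<le> M1 + M2" if z: "z \<in> unit_disc" for z
  proof -
    have w: "0 < std_weight \<beta> z" using z by (rule std_weight_pos)
    have "cmod (u z) \<le> cmod (u z + \<phi> z * v z) + cmod (\<phi> z * v z)"
      by (metis add_diff_cancel_right' norm_triangle_ineq4)
    also have "\<dots> \<le> cmod (u z + \<phi> z * v z) + cmod (v z)"
      using phi_in[of z] z by (auto simp: norm_mult mult_left_le_one_le)
    finally have "wu z \<le> std_weight \<beta> z * (cmod (u z + \<phi> z * v z) + cmod (v z))"
      using w by (intro mult_left_mono) auto
    moreover have "std_weight \<beta> z * cmod (u z + \<phi> z * v z) \<le> M2"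
      using T_norm_ge[OF one(2) z] phi_in[of z] z DERIV_imp_deriv[OF did, of "\<phi> z"]
      by (simp add: M2_def)
    ultimately show ?thesis using v[OF z] by (simp add: distrib_left)
  qed
  have "0 \<le> M1" "0 \<le> M2" 
    unfolding M1_def M2_def by (rule zyg_norm_bounds(3)[OF T_in[OF one(1)]], rule zyg_norm_bounds(3)[OF T_in[OF one(2)]])
  then show thesis using u v by (intro that[of "M1 + M2 + 1"]) fastforce+
qed

end

section \<open>Weighted suprema along powers of the symbol\<close>

text \<open>The infimum of the admissible \<open>P\<close> is the upper limit of the weighted
  function over \<open>|\<phi>(z)| \<rightarrow> 1\<close>. If \<open>\<phi>\<close> stays away from the circle, the condition is void and every \<open>P\<close>
  is admissible.\<close>

definition bdry_le :: "(complex \<Rightarrow> complex) \<Rightarrow> (complex \<Rightarrow> complex) \<Rightarrow> (real \<Rightarrow> real) \<Rightarrow> real \<Rightarrow> real \<Rightarrow> bool" where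
  "bdry_le h \<phi> w \<beta> P \<longleftrightarrow> (\<exists>s<1. \<forall>z\<in>unit_disc. s < cmod (\<phi> z) \<longrightarrow>
     std_weight \<beta> z * cmod (h z) * w (cmod (\<phi> z)) \<le> P)"

text \<open>This is what makes the two upper limits, over \<open>n\<close> and over \<open>|\<phi>(z)| \<rightarrow> 1\<close>, comparable with
  constant \<open>C\<close>: \<open>C w\<close> dominates every \<open>a n * x ^ n\<close>, it is matched by some large \<open>n\<close> when \<open>x\<close> is close
  to \<open>1\<close>, and points at a positive distance from \<open>1\<close> contribute nothing in the limit. Domination is
  asked only for \<open>x \<ge> 1/2\<close> because the logarithmic weight vanishes at \<open>0\<close>.\<close>

definition weight_pair :: "(nat \<Rightarrow> real) \<Rightarrow> (real \<Rightarrow> real) \<Rightarrow> real \<Rightarrow> bool" where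
  "weight_pair a w C \<longleftrightarrow> 0 < C \<and> (\<forall>n. 0 \<le> a n) \<and>
     (\<forall>s. 0 \<le> s \<and> s < 1 \<longrightarrow> (\<lambda>n. a n * s ^ n) \<longlonglongrightarrow> 0) \<and>
     (\<forall>n\<ge>1. \<forall>x. 1/2 \<le> x \<and> x < 1 \<longrightarrow> a n * x ^ n \<le> C * w x) \<and>
     (\<forall>N. \<exists>s<1. \<forall>x. s < x \<and> x < 1 \<longrightarrow> (\<exists>n\<ge>N. w x \<le> C * (a n * x ^ n)))"

text \<open>At \<open>n\<close> about \<open>1 / (1 - x)\<close> the power \<open>x ^ n\<close> is of order one, since \<open>- ln x\<close> is comparable to
  \<open>1 - x\<close> away from \<open>0\<close>.\<close>

lemma x_pow_ge:
  fixes x :: real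
  assumes "1/2 \<le> x" "x < 1"
  defines "n \<equiv> nat \<lceil>1 / (1 - x)\<rceil>"
  shows "exp (-4) \<le> x ^ n" "1 / (1 - x) \<le> real n"
proof -
  show n: "1 / (1 - x) \<le> real n" unfolding n_def by linarith
  have n2: "real n \<le> 1 / (1 - x) + 1"
    using assms(1,2) unfolding n_def by (simp add: of_nat_nat)
  have "ln (1 / x) \<le> 1 / x - 1" using assms by (intro ln_le_minus_one) auto
  also have "1 / x - 1 = (1 - x) / x" using assms by (simp add: field_simps)
  also have "\<dots> \<le> (1 - x) / (1/2)" using assms by (intro divide_left_mono) auto
  finally have l: "- ln x \<le> 2 * (1 - x)" using assms by (simp add: ln_div)
  have "real n * (- ln x) \<le> (1 / (1 - x) + 1) * (2 * (1 - x))"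
    using n2 l assms by (intro mult_mono) auto
  also have "\<dots> = 2 + 2 * (1 - x)" using assms by (simp add: field_simps)
  also have "\<dots> \<le> 4" using assms by simp
  finally have "-4 \<le> ln (x ^ n)" using assms by (simp add: ln_realpow)
  then show "exp (-4) \<le> x ^ n" using assms by (simp add: ln_ge_iff)
qed

lemma index_eventually_large:
  "\<exists>s<1. \<forall>x::real. s < x \<and> x < 1 \<longrightarrow> 1/2 \<le> x \<and> real N \<le> 1 / (1 - x)"
proof (intro exI[of _ "max (1/2) (1 - 1 / (real N + 1))"] conjI allI impI)
  fix x :: real assume x: "max (1/2) (1 - 1 / (real N + 1)) < x \<and> x < 1"
  then have "1 - x < 1 / (real N + 1)" by simp
  then have "real N + 1 < 1 / (1 - x)" using x by (simp add: field_simps)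
  then show "real N \<le> 1 / (1 - x)" by simp
qed auto

lemma pow_le_exp:
  fixes x :: real
  assumes "0 \<le> x" "x \<le> 1"
  shows "x ^ n \<le> exp (- (real n * (1 - x)))"
proof -
  have "x \<le> exp (- (1 - x))" using exp_ge_add_one_self[of "- (1 - x)"] by simp
  then have "x ^ n \<le> exp (- (1 - x)) ^ n" using assms by (intro power_mono) auto
  also have "\<dots> = exp (real n * - (1 - x))" by (rule exp_of_nat_mult[symmetric])
  finally show ?thesis by (simp add: algebra_simps)
qed

text \<open>With \<open>t = (n + 1) (1 - x)\<close> the quotient of \<open>a n * x ^ n\<close> by the weight is at most a constant times
  \<open>t powr \<gamma> * exp (- t)\<close>, which is bounded.\<close>

lemma weight_pair_power:
  fixes \<gamma> :: real
  assumes "0 < \<gamma>"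
  shows "weight_pair (\<lambda>n. (real n + 1) powr \<gamma>) (\<lambda>x. (1 - x) powr (- \<gamma>)) (max (\<gamma> powr \<gamma> * exp 1) (exp 4))"
proof -
  have powr_exp: "t powr \<gamma> \<le> (\<gamma> powr \<gamma>) * exp t" if "0 < t" for t
  proof -
    have "ln (t / \<gamma>) \<le> t / \<gamma> - 1" using that assms by (intro ln_le_minus_one) auto
    then have "\<gamma> * ln t \<le> \<gamma> * ln \<gamma> + t"
      using that assms by (simp add: ln_div field_simps)
    then have "exp (\<gamma> * ln t) \<le> exp (\<gamma> * ln \<gamma> + t)" by simp
    then show ?thesis using that assms by (simp add: powr_def exp_add)
  qed
  define C where "C = max (\<gamma> powr \<gamma> * exp 1) (exp 4)"
  have "0 < C" by (simp add: C_def less_max_iff_disj)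
  show ?thesis
    unfolding weight_pair_def C_def[symmetric]
  proof (intro conjI allI impI)
    fix s :: real assume s: "0 \<le> s \<and> s < 1"
    show "(\<lambda>n. (real n + 1) powr \<gamma> * s ^ n) \<longlonglongrightarrow> 0"
    proof (cases "s = 0")
      case True then show ?thesis
        by (auto intro!: tendsto_eventually eventually_sequentiallyI[of 1])
    next
      case False
      with s have "0 < s" "s < 1" by auto
      then show ?thesis by real_asymp
    qed
  next
    fix n :: nat and x :: real assume x: "1/2 \<le> x \<and> x < 1"
    define t where "t = (real n + 1) * (1 - x)"
    have t: "0 < t" using x by (simp add: t_def)
    have "(real n + 1) powr \<gamma> * x ^ n = t powr \<gamma> * (1 - x) powr (- \<gamma>) * x ^ n"
      using x by (simp add: t_def powr_mult powr_minus)
    also have "\<dots> \<le> (\<gamma> powr \<gamma> * exp t) * (1 - x) powr (- \<gamma>) * exp (- (real n * (1 - x)))"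
      using x powr_exp[OF t] by (intro mult_mono pow_le_exp) auto
    also have "\<dots> = (\<gamma> powr \<gamma> * exp (1 - x)) * (1 - x) powr (- \<gamma>)"
    proof -
      have "t + - (real n * (1 - x)) = 1 - x" by (simp add: t_def algebra_simps)
      then have "exp (1 - x) = exp t * exp (- (real n * (1 - x)))" by (metis exp_add)
      then show ?thesis by (simp only: mult_ac)
    qed
    also have "\<dots> \<le> C * (1 - x) powr (- \<gamma>)"
    proof (intro mult_right_mono)
      have "\<gamma> powr \<gamma> * exp (1 - x) \<le> \<gamma> powr \<gamma> * exp 1"
        using x by (intro mult_left_mono) auto
      then show "\<gamma> powr \<gamma> * exp (1 - x) \<le> C" by (simp add: C_def le_max_iff_disj)
    qed simp
    finally show "(real n + 1) powr \<gamma> * x ^ n \<le> C * (1 - x) powr (- \<gamma>)" .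
  next
    fix N :: nat
    obtain s where s: "s < 1" "\<And>x::real. s < x \<and> x < 1 \<Longrightarrow> 1/2 \<le> x \<and> real N \<le> 1 / (1 - x)"
      using index_eventually_large[of N] by blast
    have "\<exists>n\<ge>N. (1 - x) powr (- \<gamma>) \<le> C * ((real n + 1) powr \<gamma> * x ^ n)" if "s < x \<and> x < 1" for x
    proof -
      define n where "n = nat \<lceil>1 / (1 - x)\<rceil>"
      have x: "1/2 \<le> x" "x < 1" using s(2)[OF that] that by auto
      note n = x_pow_ge[OF x, folded n_def]
      have "(1 - x) powr (- \<gamma>) * 1 \<le> (real n + 1) powr \<gamma> * (C * x ^ n)"
      proof (intro mult_mono)
        have "(1 - x) powr (- \<gamma>) = (1 / (1 - x)) powr \<gamma>"
          using x by (simp add: powr_minus powr_divide inverse_eq_divide)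
        also have "\<dots> \<le> (real n + 1) powr \<gamma>"
          using n(2) x assms by (intro powr_mono2) auto
        finally show "(1 - x) powr (- \<gamma>) \<le> (real n + 1) powr \<gamma>" .
        have "1 = exp 4 * exp (-4::real)" by (simp flip: exp_add)
        also have "\<dots> \<le> C * x ^ n" using n(1) x \<open>0 < C\<close> by (intro mult_mono) (auto simp: C_def)
        finally show "1 \<le> C * x ^ n" .
      qed auto
      moreover have "N \<le> n" using n(2) s(2)[OF that] by linarith
      ultimately show ?thesis by (auto simp: mult_ac)
    qed
    then show "\<exists>s<1. \<forall>x. s < x \<and> x < 1 \<longrightarrow> (\<exists>n\<ge>N. (1 - x) powr (- \<gamma>) \<le> C * ((real n + 1) powr \<gamma> * x ^ n))"
      using s(1) by blast
  qed (use \<open>0 < C\<close> in auto)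
qed

text \<open>With \<open>t = n (1 - x)\<close> one has \<open>ln n = ln t + ln (1 / (1 - x))\<close>, and the term with \<open>ln t \<le> t\<close> is
  absorbed by \<open>x ^ n \<le> exp (- t)\<close>.\<close>

lemma weight_pair_log: "weight_pair (\<lambda>n. ln (real n)) (\<lambda>x. ln (1 / (1 - x))) (exp 4)"
  unfolding weight_pair_def
proof (intro conjI allI impI)
  (* ln 0 = 0 makes the first term harmless *)
  show "0 \<le> ln (real n)" for n by (cases "n = 0") auto
next
  fix s :: real assume s: "0 \<le> s \<and> s < 1"
  show "(\<lambda>n. ln (real n) * s ^ n) \<longlonglongrightarrow> 0"
  proof (cases "s = 0")
    case True then show ?thesis
      by (auto intro!: tendsto_eventually eventually_sequentiallyI[of 1])
  next
    case False
    with s have "0 < s" "s < 1" by auto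
    then show ?thesis by real_asymp
  qed
next
  have ln2: "1/2 \<le> ln (2::real)" using ln2_ge_two_thirds by simp
  have C3: "3 \<le> exp (4::real)" using exp_ge_add_one_self[of "4::real"] by simp
    fix n :: nat and x :: real assume n: "1 \<le> n" and x: "1/2 \<le> x \<and> x < 1"
    define t where "t = real n * (1 - x)"
    have t: "0 < t" using x n by (simp add: t_def)
    have L: "1/2 \<le> ln (1 / (1 - x))"
    proof -
      have "ln 2 \<le> ln (1 / (1 - x))" using x by (subst ln_le_cancel_iff) (auto simp: field_simps)
      then show ?thesis using ln2 by simp
    qed
    have "ln (real n) = ln t + ln (1 / (1 - x))"
      using x n by (simp add: t_def ln_mult ln_div)
    also have "\<dots> \<le> t + ln (1 / (1 - x))" using ln_le_minus_one[OF t] by simp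
    finally have "ln (real n) * x ^ n \<le> t * x ^ n + ln (1 / (1 - x)) * x ^ n"
      using x by (simp add: distrib_right[symmetric] mult_right_mono)
    also have "\<dots> \<le> t * exp (- t) + ln (1 / (1 - x)) * 1"
      using x t L pow_le_exp[of x n] by (intro add_mono mult_left_mono) (auto simp: t_def power_le_one)
    also have "t * exp (- t) \<le> 1"
    proof -
      have "t \<le> exp t" using exp_ge_add_one_self[of t] by linarith
      then show ?thesis by (simp add: exp_minus field_simps)
    qed
    also have "1 + ln (1 / (1 - x)) * 1 \<le> 3 * ln (1 / (1 - x))" using L by simp
    also have "\<dots> \<le> exp 4 * ln (1 / (1 - x))" using C3 L by (intro mult_right_mono) auto
    finally show "ln (real n) * x ^ n \<le> exp 4 * ln (1 / (1 - x))" by simp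
  next
    fix N :: nat
    obtain s where s: "s < 1" "\<And>x::real. s < x \<and> x < 1 \<Longrightarrow> 1/2 \<le> x \<and> real N \<le> 1 / (1 - x)"
      using index_eventually_large[of N] by blast
    have "\<exists>n\<ge>N. ln (1 / (1 - x)) \<le> exp 4 * (ln (real n) * x ^ n)" if "s < x \<and> x < 1" for x
    proof -
      define n where "n = nat \<lceil>1 / (1 - x)\<rceil>"
      have x: "1/2 \<le> x" "x < 1" using s(2)[OF that] that by auto
      note n = x_pow_ge[OF x, folded n_def]
      have "ln (1 / (1 - x)) * 1 \<le> ln (real n) * (exp 4 * x ^ n)"
      proof (intro mult_mono)
        have p: "0 < 1 / (1 - x)" "1 \<le> 1 / (1 - x)" using x by auto
        then show "ln (1 / (1 - x)) \<le> ln (real n)" using n(2) by (subst ln_le_cancel_iff) linarith+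
        show "0 \<le> ln (real n)" using p n(2) by (intro ln_ge_zero) linarith
        have "1 = exp 4 * exp (-4::real)" by (simp flip: exp_add)
        also have "\<dots> \<le> exp 4 * x ^ n" using n(1) x by (intro mult_left_mono) auto
        finally show "1 \<le> exp 4 * x ^ n" .
      qed auto
      moreover have "N \<le> n" using n(2) s(2)[OF that] by linarith
      ultimately show ?thesis by (auto simp: mult_ac)
    qed
    then show "\<exists>s<1. \<forall>x. s < x \<and> x < 1 \<longrightarrow> (\<exists>n\<ge>N. ln (1 / (1 - x)) \<le> exp 4 * (ln (real n) * x ^ n))"
      using s(1) by blast
qed auto

lemma weighted_norm_le_iff:
  "weighted_norm \<beta> h \<le> ereal P \<longleftrightarrow> (\<forall>z\<in>unit_disc. std_weight \<beta> z * cmod (h z) \<le> P)"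
  by (auto simp: weighted_norm_def SUP_le_iff)

lemma weighted_norm_upper:
  "z \<in> unit_disc \<Longrightarrow> ereal (std_weight \<beta> z * cmod (h z)) \<le> weighted_norm \<beta> h"
  unfolding weighted_norm_def by (rule SUP_upper)

lemma weighted_norm_nonneg: "0 \<le> weighted_norm \<beta> h"
proof -
  have "0 \<le> ereal (std_weight \<beta> 0 * cmod (h 0))" by (simp add: std_weight_def)
  also have "\<dots> \<le> weighted_norm \<beta> h" by (rule weighted_norm_upper) simp
  finally show ?thesis .
qed

text \<open>Each \<open>z\<close> with \<open>|\<phi>(z)|\<close> close to \<open>1\<close> is tested with the exponent \<open>n\<close> that matches \<open>x = |\<phi>(z)|\<close>.\<close>

lemma bdry_le_of_limsup:
  assumes "weight_pair a w C" and phi: "\<phi> ` unit_disc \<subseteq> unit_disc"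
    and l: "limsup (\<lambda>n. ereal (a n) * weighted_norm \<beta> (\<lambda>z. h z * \<phi> z ^ n)) < ereal L"
  shows "bdry_le h \<phi> w \<beta> (C * L)"
proof -
  have C: "0 < C" and a0: "\<And>n. 0 \<le> a n"
    "\<And>N. \<exists>s<1. \<forall>x. s < x \<and> x < 1 \<longrightarrow> (\<exists>n\<ge>N. w x \<le> C * (a n * x ^ n))"
    using assms(1) by (auto simp: weight_pair_def)
  have "\<forall>\<^sub>F n in sequentially. ereal (a n) * weighted_norm \<beta> (\<lambda>z. h z * \<phi> z ^ n) < ereal L"
    using l by (rule Limsup_lessD)
  then obtain N where N: "\<And>n. N \<le> n \<Longrightarrow> ereal (a n) * weighted_norm \<beta> (\<lambda>z. h z * \<phi> z ^ n) < ereal L"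
    by (auto simp: eventually_sequentially)
  obtain s where s: "s < 1" "\<And>x. s < x \<and> x < 1 \<Longrightarrow> \<exists>n\<ge>N. w x \<le> C * (a n * x ^ n)"
    using a0(2)[of N] by blast
  have "std_weight \<beta> z * cmod (h z) * w (cmod (\<phi> z)) \<le> C * L" if z: "z \<in> unit_disc" and sz: "s < cmod (\<phi> z)" for z
  proof -
    have "cmod (\<phi> z) < 1" using phi z by (auto simp: image_subset_iff)
    then obtain n where n: "N \<le> n" "w (cmod (\<phi> z)) \<le> C * (a n * cmod (\<phi> z) ^ n)"
      using s(2) sz by blast
    have "ereal (a n) * ereal (std_weight \<beta> z * cmod (h z * \<phi> z ^ n)) \<le> ereal (a n) * weighted_norm \<beta> (\<lambda>z. h z * \<phi> z ^ n)"
      using a0(1) weighted_norm_upper[OF z] by (intro ereal_mult_left_mono) auto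
    also have "\<dots> < ereal L" by (rule N[OF n(1)])
    finally have "a n * (std_weight \<beta> z * cmod (h z * \<phi> z ^ n)) \<le> L" by simp
    then have 1: "C * (a n * (std_weight \<beta> z * cmod (h z * \<phi> z ^ n))) \<le> C * L" using C by simp
    have "std_weight \<beta> z * cmod (h z) * w (cmod (\<phi> z)) \<le> std_weight \<beta> z * cmod (h z) * (C * (a n * cmod (\<phi> z) ^ n))"
      using n(2) less_imp_le[OF std_weight_pos[OF z]] by (intro mult_left_mono) auto
    also have "\<dots> = C * (a n * (std_weight \<beta> z * cmod (h z * \<phi> z ^ n)))"
      by (simp add: norm_mult norm_power)
    finally show ?thesis using 1 by simp
  qed
  then show ?thesis unfolding bdry_le_def using s(1) by blast
qed

text \<open>Points with \<open>|\<phi>(z)| \<le> s\<close> contribute at most \<open>a n * s ^ n * M\<close>, which tends to \<open>0\<close>; the others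
  are controlled by the boundary bound.\<close>

lemma limsup_le_of_bdry_le:
  assumes "weight_pair a w C" and phi: "\<phi> ` unit_disc \<subseteq> unit_disc"
    and M: "\<And>z. z \<in> unit_disc \<Longrightarrow> std_weight \<beta> z * cmod (h z) \<le> M"
    and P: "0 < P" and b: "bdry_le h \<phi> w \<beta> P"
  shows "limsup (\<lambda>n. ereal (a n) * weighted_norm \<beta> (\<lambda>z. h z * \<phi> z ^ n)) \<le> ereal (C * P)"
proof -
  have C: "0 < C" and a0: "\<And>n. 0 \<le> a n"
    "\<And>s. 0 \<le> s \<Longrightarrow> s < 1 \<Longrightarrow> (\<lambda>n. a n * s ^ n) \<longlonglongrightarrow> 0"
    "\<And>n x. 1 \<le> n \<Longrightarrow> 1/2 \<le> x \<Longrightarrow> x < 1 \<Longrightarrow> a n * x ^ n \<le> C * w x"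
    using assms(1) by (auto simp: weight_pair_def)
  show ?thesis
  proof (rule Limsup_bounded)
    obtain s0 where s0: "s0 < 1" "\<And>z. z \<in> unit_disc \<Longrightarrow> s0 < cmod (\<phi> z) \<Longrightarrow>
        std_weight \<beta> z * cmod (h z) * w (cmod (\<phi> z)) \<le> P" using b by (auto simp: bdry_le_def)
    define s where "s = max s0 (1/2)"
    have s: "0 \<le> s" "s < 1" "1/2 \<le> s" "s0 \<le> s" using s0(1) by (auto simp: s_def)
    have "0 \<le> std_weight \<beta> 0 * cmod (h 0)" by (simp add: std_weight_def)
    with M[of 0] have M0: "0 \<le> M" by simp
    have "(\<lambda>n. a n * s ^ n * M) \<longlonglongrightarrow> 0 * M" using a0(2)[OF s(1,2)] by (intro tendsto_intros)
    then have "\<forall>\<^sub>F n in sequentially. a n * s ^ n * M < C * P"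
      using C P by (intro order_tendstoD(2)) auto
    then show "\<forall>\<^sub>F n in sequentially. ereal (a n) * weighted_norm \<beta> (\<lambda>z. h z * \<phi> z ^ n) \<le> ereal (C * P)"
      using eventually_ge_at_top[of 1]
    proof eventually_elim
      case (elim n)
      have bd: "a n * (std_weight \<beta> z * cmod (h z * \<phi> z ^ n)) \<le> C * P" if z: "z \<in> unit_disc" for z
      proof -
        have W: "0 \<le> std_weight \<beta> z * cmod (h z)" using less_imp_le[OF std_weight_pos[OF z]] by simp
        have eq: "a n * (std_weight \<beta> z * cmod (h z * \<phi> z ^ n)) = (std_weight \<beta> z * cmod (h z)) * (a n * cmod (\<phi> z) ^ n)"
          by (simp add: norm_mult norm_power)
        show ?thesis
        proof (cases "cmod (\<phi> z) \<le> s")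
          case True
          have "(std_weight \<beta> z * cmod (h z)) * (a n * cmod (\<phi> z) ^ n) \<le> M * (a n * s ^ n)"
            using M[OF z] True a0(1)[of n] W M0 by (intro mult_mono power_mono) auto
          then show ?thesis using elim(1) unfolding eq by (simp add: mult_ac)
        next
          case False
          have p1: "cmod (\<phi> z) < 1" using phi z by (auto simp: image_subset_iff)
          have "(std_weight \<beta> z * cmod (h z)) * (a n * cmod (\<phi> z) ^ n) \<le> (std_weight \<beta> z * cmod (h z)) * (C * w (cmod (\<phi> z)))"
            using W a0(3)[OF elim(2) _ p1] False s by (intro mult_left_mono) auto
          also have "\<dots> = C * (std_weight \<beta> z * cmod (h z) * w (cmod (\<phi> z)))" by simp
          also have "\<dots> \<le> C * P" using s0(2)[OF z] False s C by (intro mult_left_mono) auto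
          finally show ?thesis unfolding eq .
        qed
      qed
      show ?case
      proof (cases "a n = 0")
        case True
        have "0 * weighted_norm \<beta> (\<lambda>z. h z * \<phi> z ^ n) \<le> ereal (C * P)" using C P by simp
        then show ?thesis unfolding True by (subst zero_ereal_def[symmetric])
      next
        case False
        then have an: "0 < a n" using a0(1)[of n] by simp
        have "weighted_norm \<beta> (\<lambda>z. h z * \<phi> z ^ n) \<le> ereal (C * P / a n)"
          unfolding weighted_norm_le_iff using bd an by (auto simp: field_simps)
        then have "ereal (a n) * weighted_norm \<beta> (\<lambda>z. h z * \<phi> z ^ n) \<le> ereal (a n) * ereal (C * P / a n)"
          using an by (intro ereal_mult_left_mono) auto
        then show ?thesis using an by simp
      qed
    qed
  qed
qed

section \<open>Growth of functions with controlled derivative\<close>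

text \<open>Integrating the derivative along the ray from \<open>r w\<close> to \<open>w\<close>; the integral of the majorant \<open>m\<close> is
  expressed by a primitive \<open>V\<close>.\<close>

lemma radial_bound:
  fixes h :: "complex \<Rightarrow> complex" and V m :: "real \<Rightarrow> real"
  assumes h: "h holomorphic_on unit_disc"
    and m: "\<And>z. z \<in> unit_disc \<Longrightarrow> cmod (deriv h z) \<le> m (cmod z)"
    and V: "\<And>x. 0 \<le> x \<Longrightarrow> x < 1 \<Longrightarrow> (V has_real_derivative m x) (at x)"
    and r: "0 \<le> r" "r \<le> 1" and w: "w \<in> unit_disc"
  shows "cmod (h w - h (of_real r * w)) \<le> V (cmod w) - V (r * cmod w)"
proof (cases "w = 0 \<or> r = 1")
  case False
  define e where "e = sgn w"
  have e: "cmod e = 1" "of_real (cmod w) * e = w"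
    using False by (auto simp: e_def norm_sgn) (simp add: sgn_eq)
  have b: "cmod w < 1" "0 < cmod w" using w False by auto
  have lt: "r * cmod w < cmod w" using False r b by auto
  have d: "((\<lambda>t. h (of_real t * e)) has_vector_derivative deriv h (of_real t * e) * e) (at t)"
    if "0 \<le> t" "t < 1" for t
  proof -
    have "of_real t * e \<in> unit_disc" using that e by (simp add: norm_mult)
    note D = H_disc_derivs(1)[OF h this]
    have "((\<lambda>t. of_real t * e) has_vector_derivative e) (at t)"
      by (auto intro!: derivative_eq_intros)
    from field_vector_diff_chain_at[OF this D] show ?thesis by (simp add: o_def mult.commute)
  qed
  have "norm ((\<lambda>t. h (of_real t * e)) (cmod w) - (\<lambda>t. h (of_real t * e)) (r * cmod w)) \<le> V (cmod w) - V (r * cmod w)"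
  proof (rule differentiable_bound_general[OF lt])
    have ge: "0 \<le> t" "t < 1" if "t \<in> {r * cmod w..cmod w}" for t
      using that b r by (auto intro: order_trans[of 0 "r * cmod w"])
    show "continuous_on {r * cmod w..cmod w} (\<lambda>t. h (of_real t * e))"
      using d ge by (intro continuous_at_imp_continuous_on ballI has_vector_derivative_continuous) blast
    show "continuous_on {r * cmod w..cmod w} V"
      using V ge by (intro continuous_at_imp_continuous_on ballI DERIV_isCont) blast
    fix x assume x: "r * cmod w < x" "x < cmod w"
    then have x1: "0 \<le> x" "x < 1" using ge[of x] by auto
    show "((\<lambda>t. h (of_real t * e)) has_vector_derivative deriv h (of_real x * e) * e) (at x)"
      using d[OF x1] .
    show "(V has_vector_derivative m x) (at x)"
      using V[OF x1] by (simp add: has_real_derivative_iff_has_vector_derivative)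
    show "norm (deriv h (of_real x * e) * e) \<le> m x"
      using m[of "of_real x * e"] x1 e by (simp add: norm_mult)
  qed
  moreover have "of_real (r * cmod w) * e = of_real r * w" using e(2) by (simp add: mult.assoc)
  ultimately show ?thesis using e(2) by (simp add: mult.assoc)
qed auto

text \<open>One computation serves two purposes: for \<open>p > 1\<close> and \<open>r = 0\<close> it gives growth, for \<open>p < 1\<close> and
  \<open>r\<close> close to \<open>1\<close> it gives Hoelder continuity.\<close>

lemma radial_bound_power:
  assumes h: "h holomorphic_on unit_disc" and p: "p \<noteq> 1"
    and m: "\<And>z. z \<in> unit_disc \<Longrightarrow> cmod (deriv h z) \<le> C * (1 - cmod z) powr (- p)"
    and r: "0 \<le> r" "r \<le> 1" and w: "w \<in> unit_disc"
  shows "cmod (h w - h (of_real r * w)) \<le>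
    C / (p - 1) * ((1 - cmod w) powr (1 - p) - (1 - r * cmod w) powr (1 - p))"
proof -
  have "cmod (h w - h (of_real r * w)) \<le> C / (p - 1) * (1 - cmod w) powr (1 - p) - C / (p - 1) * (1 - r * cmod w) powr (1 - p)"
  proof (rule radial_bound[OF h _ _ r w, of "\<lambda>x. C * (1 - x) powr (- p)"])
    fix x :: real assume x: "0 \<le> x" "x < 1"
    show "((\<lambda>x. C / (p - 1) * (1 - x) powr (1 - p)) has_real_derivative C * (1 - x) powr (- p)) (at x)"
    proof -
      have "((\<lambda>x. (1 - x) powr (1 - p)) has_real_derivative (p - 1) * (1 - x) powr (- p)) (at x)"
        using x by (auto intro!: derivative_eq_intros simp: algebra_simps)
      from DERIV_cmult[OF this, of "C / (p - 1)"] show ?thesis using p by simp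
    qed
  qed (use m in auto)
  then show ?thesis by (simp add: right_diff_distrib)
qed

lemma growth_power:
  assumes h: "h holomorphic_on unit_disc" and p: "1 < p" and C: "0 \<le> C"
    and m: "\<And>z. z \<in> unit_disc \<Longrightarrow> cmod (deriv h z) \<le> C * (1 - cmod z) powr (- p)"
    and w: "w \<in> unit_disc"
  shows "cmod (h w) \<le> (cmod (h 0) + C / (p - 1)) * (1 - cmod w) powr (1 - p)"
proof -
  have "cmod (h w - h 0) \<le> C / (p - 1) * ((1 - cmod w) powr (1 - p) - 1)"
    using radial_bound_power[OF h _ m _ _ w, of 0] p by simp
  also have "\<dots> \<le> C / (p - 1) * (1 - cmod w) powr (1 - p)" using p C by (intro mult_left_mono) auto
  finally have 1: "cmod (h w - h 0) \<le> C / (p - 1) * (1 - cmod w) powr (1 - p)" .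
  have "(1 - cmod w) powr 0 \<le> (1 - cmod w) powr (1 - p)"
    using w p by (intro powr_mono') auto
  then have "cmod (h 0) * 1 \<le> cmod (h 0) * (1 - cmod w) powr (1 - p)"
    using w by (intro mult_left_mono) auto
  moreover have "cmod (h w) \<le> cmod (h 0) + cmod (h w - h 0)"
    using norm_triangle_ineq[of "h 0" "h w - h 0"] by simp
  ultimately show ?thesis using 1 by (simp add: algebra_simps)
qed

lemma growth_log:
  assumes h: "h holomorphic_on unit_disc"
    and m: "\<And>z. z \<in> unit_disc \<Longrightarrow> cmod (deriv h z) \<le> C * (1 - cmod z) powr (- 1)"
    and w: "w \<in> unit_disc"
  shows "cmod (h w) \<le> cmod (h 0) + C * ln (1 / (1 - cmod w))"
proof -
  have "cmod (h w - h (of_real 0 * w)) \<le> - C * ln (1 - cmod w) - (- C * ln (1 - 0 * cmod w))"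
  proof (rule radial_bound[OF h _ _ _ _ w, of "\<lambda>x. C * (1 - x) powr (- 1)"])
    fix x :: real assume x: "0 \<le> x" "x < 1"
    show "((\<lambda>x. - C * ln (1 - x)) has_real_derivative C * (1 - x) powr (- 1)) (at x)"
      using x by (auto intro!: derivative_eq_intros simp: field_simps powr_minus)
  qed (use m in auto)
  moreover have "cmod (h w) \<le> cmod (h 0) + cmod (h w - h 0)"
    using norm_triangle_ineq[of "h 0" "h w - h 0"] by simp
  ultimately show ?thesis using w by (simp add: ln_div)
qed

text \<open>After division by \<open>(a + b) powr q\<close> this is \<open>t \<le> t powr q\<close> on the unit interval.\<close>

lemma powr_subadditive:
  fixes a b q :: real
  assumes "0 \<le> a" "0 \<le> b" "0 < q" "q \<le> 1"
  shows "(a + b) powr q \<le> a powr q + b powr q"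
proof (cases "a + b = 0")
  case False
  then have s: "0 < a + b" using assms by simp
  have frac: "t \<le> t powr q" if "0 \<le> t" "t \<le> 1" for t :: real
    using that assms powr_mono'[of q 1 t] by (cases "t = 0") auto
  have "1 = a / (a + b) + b / (a + b)" using s by (simp flip: add_divide_distrib)
  also have "\<dots> \<le> (a / (a + b)) powr q + (b / (a + b)) powr q"
    using assms s by (intro add_mono frac) (auto simp: field_simps)
  also have "\<dots> = (a powr q + b powr q) / (a + b) powr q"
    using assms s by (simp add: powr_divide add_divide_distrib)
  finally show ?thesis using s by (simp add: field_simps)
qed (use assms in auto)

lemma growth_holder:
  assumes h: "h holomorphic_on unit_disc" and p: "0 \<le> p" "p < 1" and C: "0 \<le> C"
    and m: "\<And>z. z \<in> unit_disc \<Longrightarrow> cmod (deriv h z) \<le> C * (1 - cmod z) powr (- p)"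
    and r: "0 \<le> r" "r \<le> 1" and w: "w \<in> unit_disc"
  shows "cmod (h w - h (of_real r * w)) \<le> C / (1 - p) * (1 - r) powr (1 - p)"
proof -
  let ?q = "1 - p"
  have "(1 - r * cmod w) powr ?q = ((1 - cmod w) + (1 - r) * cmod w) powr ?q"
    by (simp add: algebra_simps)
  also have "\<dots> \<le> (1 - cmod w) powr ?q + ((1 - r) * cmod w) powr ?q"
    using w r p by (intro powr_subadditive) auto
  also have "((1 - r) * cmod w) powr ?q \<le> (1 - r) powr ?q"
    using w r p by (intro powr_mono2) (auto intro: mult_right_le_one_le)
  finally have 1: "(1 - r * cmod w) powr ?q - (1 - cmod w) powr ?q \<le> (1 - r) powr ?q" by simp
  have "cmod (h w - h (of_real r * w)) \<le> C / (p - 1) * ((1 - cmod w) powr ?q - (1 - r * cmod w) powr ?q)"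
    using radial_bound_power[OF h _ m r w] p by simp
  also have "\<dots> = C / ?q * ((1 - r * cmod w) powr ?q - (1 - cmod w) powr ?q)"
    using p by (simp add: field_simps)
  also have "\<dots> \<le> C / ?q * (1 - r) powr ?q" using 1 p C by (intro mult_left_mono) auto
  finally show ?thesis .
qed

lemma zyg_deriv2_le:
  assumes "0 < \<alpha>" "f \<in> zyg_unit_ball \<alpha>" "z \<in> unit_disc"
  shows "cmod (deriv (deriv f) z) \<le> (1 - cmod z) powr (- \<alpha>)"
proof -
  have f: "f \<in> zygmund \<alpha>" "zyg_norm \<alpha> f \<le> 1" using assms by (auto simp: zyg_unit_ball_def)
  have "(1 - cmod z) powr \<alpha> \<le> std_weight \<alpha> z"
    unfolding std_weight_def using assms
    by (intro powr_mono2) (auto simp: power2_eq_square mult_left_le_one_le)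
  then have "(1 - cmod z) powr \<alpha> * cmod (deriv (deriv f) z) \<le> std_weight \<alpha> z * cmod (deriv (deriv f) z)"
    by (intro mult_right_mono) auto
  also have "\<dots> \<le> 1" using zyg_norm_bounds(5)[OF f(1) assms(3)] f(2) by simp
  finally show ?thesis using assms(3) by (simp add: powr_minus field_simps)
qed

lemma zyg_deriv_le:
  assumes \<alpha>: "1 < \<alpha>" and f: "f \<in> zyg_unit_ball \<alpha>" and z: "z \<in> unit_disc"
  shows "cmod (deriv f z) \<le> (1 + 1 / (\<alpha> - 1)) * (1 - cmod z) powr (1 - \<alpha>)"
proof -
  have f': "f \<in> zygmund \<alpha>" "zyg_norm \<alpha> f \<le> 1" using f by (auto simp: zyg_unit_ball_def)
  have "cmod (deriv f z) \<le> (cmod (deriv f 0) + 1 / (\<alpha> - 1)) * (1 - cmod z) powr (1 - \<alpha>)"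
    using zyg_deriv2_le[OF _ f] \<alpha> z holomorphic_deriv[OF zygmund_hol[OF f'(1)] open_ball]
    by (intro growth_power) auto
  also have "\<dots> \<le> (1 + 1 / (\<alpha> - 1)) * (1 - cmod z) powr (1 - \<alpha>)"
    using zyg_norm_bounds(2)[OF f'(1)] f'(2) by (intro mult_right_mono) auto
  finally show ?thesis .
qed

text \<open>For \<open>\<alpha> < 2\<close> the derivative is at most of order \<open>(1 - |z|) powr (- p)\<close> for some \<open>p < 1\<close>, which is
  integrable along radii. Raising the exponent \<open>\<alpha>\<close> to one in \<open>(1, 2)\<close> weakens the bound on \<open>f''\<close> but
  treats all cases, including the logarithmic one, alike.\<close>

lemma zyg_value_holder:
  assumes \<alpha>: "0 < \<alpha>" "\<alpha> < 2"
  obtains C q where "0 < q" "\<And>f r w. f \<in> zyg_unit_ball \<alpha> \<Longrightarrow> 0 \<le> r \<Longrightarrow> r \<le> 1 \<Longrightarrow> w \<in> unit_disc \<Longrightarrow>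
    cmod (f w - f (of_real r * w)) \<le> C * (1 - r) powr q"
proof -
  define a where "a = max \<alpha> (3/2)"
  have a: "1 < a" "a < 2" "\<alpha> \<le> a" using \<alpha> by (auto simp: a_def)
  let ?C = "1 + 1 / (a - 1)"
  have "cmod (f w - f (of_real r * w)) \<le> ?C / (1 - (a - 1)) * (1 - r) powr (1 - (a - 1))"
    if f: "f \<in> zyg_unit_ball \<alpha>" and r: "0 \<le> r" "r \<le> 1" and w: "w \<in> unit_disc" for f r w
  proof (rule growth_holder)
    have f': "f \<in> zygmund \<alpha>" "zyg_norm \<alpha> f \<le> 1" using f by (auto simp: zyg_unit_ball_def)
    show "f holomorphic_on unit_disc" using zygmund_hol[OF f'(1)] .
    have 2: "cmod (deriv (deriv f) z) \<le> 1 * (1 - cmod z) powr (- a)" if "z \<in> unit_disc" for z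
      using zyg_deriv2_le[OF \<alpha>(1) f that] powr_mono'[of "-a" "-\<alpha>" "1 - cmod z"] that a(3) by simp
    show "cmod (deriv f z) \<le> ?C * (1 - cmod z) powr (- (a - 1))" if z: "z \<in> unit_disc" for z
    proof -
      have "cmod (deriv f z) \<le> (cmod (deriv f 0) + 1 / (a - 1)) * (1 - cmod z) powr (1 - a)"
        using 2 a z holomorphic_deriv[OF zygmund_hol[OF f'(1)] open_ball]
        by (intro growth_power) auto
      also have "\<dots> \<le> ?C * (1 - cmod z) powr (1 - a)"
        using zyg_norm_bounds(2)[OF f'(1)] f'(2) by (intro mult_right_mono) auto
      finally show ?thesis by simp
    qed
  qed (use a r w in auto)
  then show thesis using a by (intro that[of "1 - (a - 1)" "?C / (1 - (a - 1))"]) auto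
qed

lemma zyg_deriv_holder:
  assumes \<alpha>: "0 < \<alpha>" "\<alpha> < 1" and f: "f \<in> zyg_unit_ball \<alpha>"
    and r: "0 \<le> r" "r \<le> 1" and w: "w \<in> unit_disc"
  shows "cmod (deriv f w - deriv f (of_real r * w)) \<le> 1 / (1 - \<alpha>) * (1 - r) powr (1 - \<alpha>)"
proof (rule growth_holder)
  have "f \<in> zygmund \<alpha>" using f by (auto simp: zyg_unit_ball_def)
  then show "deriv f holomorphic_on unit_disc" using holomorphic_deriv[OF zygmund_hol open_ball] by auto
qed (use assms zyg_deriv2_le[OF \<alpha>(1) f] in auto)

text \<open>On \<open>|z| \<le> s\<close> the second derivatives are at most \<open>G\<close>, for all members of the unit ball; two
  integrations give the rest.\<close>

lemma zyg_local_lipschitz: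
  assumes \<alpha>: "0 < \<alpha>" and f: "f \<in> zyg_unit_ball \<alpha>" and s: "0 \<le> s" "s < 1"
    and z: "cmod z \<le> s" "cmod w \<le> s"
  defines "G \<equiv> (1 - s) powr (- \<alpha>)"
  shows "cmod (deriv f z - deriv f w) \<le> G * cmod (z - w)" "cmod (deriv f z) \<le> 1 + G"
    "cmod (f z - f w) \<le> (1 + G) * cmod (z - w)"
proof -
  have f': "f \<in> zygmund \<alpha>" "zyg_norm \<alpha> f \<le> 1" using f by (auto simp: zyg_unit_ball_def)
  have sub: "x \<in> unit_disc" if "x \<in> cball 0 s" for x using that s by auto
  note d = H_disc_derivs[OF zygmund_hol[OF f'(1)] sub, THEN has_field_derivative_at_within]
  have "cmod (deriv (deriv f) x) \<le> G" if "x \<in> cball 0 s" for x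
  proof -
    have "cmod (deriv (deriv f) x) \<le> (1 - cmod x) powr (- \<alpha>)" using zyg_deriv2_le[OF \<alpha> f sub[OF that]] .
    also have "\<dots> \<le> G" unfolding G_def using that s \<alpha> by (intro powr_mono2') auto
    finally show ?thesis .
  qed
  then have lip: "cmod (deriv f z - deriv f w) \<le> G * cmod (z - w)" if "cmod z \<le> s" "cmod w \<le> s" for z w
    using that d(2) by (intro field_differentiable_bound[OF convex_cball[of 0 s]]) auto
  show "cmod (deriv f z - deriv f w) \<le> G * cmod (z - w)" using lip z by auto
  have b: "cmod (deriv f z) \<le> 1 + G" if "cmod z \<le> s" for z
  proof -
    have "cmod (deriv f z) \<le> cmod (deriv f 0) + cmod (deriv f z - deriv f 0)"
      using norm_triangle_ineq[of "deriv f 0" "deriv f z - deriv f 0"] by simp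
    also have "\<dots> \<le> 1 + G * cmod z"
      using zyg_norm_bounds(2)[OF f'(1)] f'(2) lip[of z 0] that s by auto
    also have "\<dots> \<le> 1 + G" using that s by (auto simp: G_def intro: mult_right_le_one_le)
    finally show ?thesis .
  qed
  show "cmod (deriv f z) \<le> 1 + G" using b z by auto
  show "cmod (f z - f w) \<le> (1 + G) * cmod (z - w)"
    using z d(1) b by (intro field_differentiable_bound[OF convex_cball[of 0 s]]) auto
qed

section \<open>Dilations and the upper estimate\<close>

text \<open>The dilate, again extended by zero: \<open>r z\<close> may lie in the disc when \<open>z\<close> does not.\<close>

definition dil :: "real \<Rightarrow> (complex \<Rightarrow> complex) \<Rightarrow> complex \<Rightarrow> complex" where
  "dil r f z = (if z \<in> unit_disc then f (of_real r * z) else 0)"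

lemma dil_derivs:
  assumes "f holomorphic_on unit_disc" "0 \<le> r" "r \<le> 1" "z \<in> unit_disc"
  shows "(dil r f has_field_derivative of_real r * deriv f (of_real r * z)) (at z)"
    "((\<lambda>z. of_real r * deriv f (of_real r * z)) has_field_derivative
      (of_real r)^2 * deriv (deriv f) (of_real r * z)) (at z)"
proof -
  have "cmod (of_real r * z) \<le> cmod z"
    using assms(2,3) by (auto simp: norm_mult intro: mult_left_le_one_le)
  then have rz: "of_real r * z \<in> unit_disc" using assms(4) by simp
  note d = H_disc_derivs[OF assms(1) rz]
  have l: "((\<lambda>z. of_real r * z) has_field_derivative of_real r) (at z)"
    by (auto intro!: derivative_eq_intros)
  have "((\<lambda>z. f (of_real r * z)) has_field_derivative of_real r * deriv f (of_real r * z)) (at z)"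
    using DERIV_chain2[OF d(1) l] by (simp add: mult.commute)
  then show "(dil r f has_field_derivative of_real r * deriv f (of_real r * z)) (at z)"
    by (rule has_field_derivative_transform_within_open[OF _ open_ball assms(4)]) (auto simp: dil_def)
  show "((\<lambda>z. of_real r * deriv f (of_real r * z)) has_field_derivative
      (of_real r)^2 * deriv (deriv f) (of_real r * z)) (at z)"
    using DERIV_cmult[OF DERIV_chain2[OF d(2) l], of "of_real r"] by (simp add: mult_ac power2_eq_square)
qed

text \<open>By the Cauchy estimates on circles of radius \<open>R - r\<close> the norm of a dilate only sees the size of
  \<open>f\<close> on a compact disc. Hence dilation turns locally uniform convergence into norm convergence.\<close>

lemma dil_norm_le:
  assumes \<alpha>: "0 < \<alpha>" and f: "f holomorphic_on unit_disc" and r: "0 \<le> r" "r < R" "R < 1"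
    and b: "\<And>z. cmod z \<le> R \<Longrightarrow> cmod (f z) \<le> \<epsilon>"
  shows "dil r f \<in> zygmund \<alpha>" "zyg_norm \<alpha> (dil r f) \<le> \<epsilon> * (1 + 1 / (R - r) + 2 / (R - r)^2)"
proof -
  have cauchy: "cmod ((deriv ^^ n) f z) \<le> fact n * \<epsilon> / (R - r) ^ n" if z: "cmod z \<le> r" for z n
  proof (rule Cauchy_inequality)
    have in_R: "cmod w \<le> R" if "w \<in> cball z (R - r)" for w
      using that z norm_triangle_ineq[of z "w - z"] by (simp add: dist_norm norm_minus_commute)
    then have sub: "cball z (R - r) \<subseteq> unit_disc" using r by (fastforce simp: subset_eq)
    then show "f holomorphic_on ball z (R - r)" using f ball_subset_cball holomorphic_on_subset by blast
    show "continuous_on (cball z (R - r)) f"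
      using holomorphic_on_imp_continuous_on[OF f] sub continuous_on_subset by blast
    show "norm (f x) \<le> \<epsilon>" if "norm (z - x) = R - r" for x
      using that by (intro b in_R) (simp add: dist_norm)
  qed (use r in auto)
  have \<epsilon>: "0 \<le> \<epsilon>" using b[of 0] r norm_ge_zero[of "f 0"] by (smt (verit) norm_zero)
  have d: "\<And>z. z \<in> unit_disc \<Longrightarrow> (dil r f has_field_derivative of_real r * deriv f (of_real r * z)) (at z)"
    "\<And>z. z \<in> unit_disc \<Longrightarrow> ((\<lambda>z. of_real r * deriv f (of_real r * z)) has_field_derivative
      (of_real r)^2 * deriv (deriv f) (of_real r * z)) (at z)"
    using dil_derivs[OF f] r by auto
  have 2: "std_weight \<alpha> z * cmod ((of_real r)^2 * deriv (deriv f) (of_real r * z)) \<le> 2 * \<epsilon> / (R - r)^2"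
    if z: "z \<in> unit_disc" for z
  proof -
    have "cmod (of_real r * z) \<le> r" using z r by (auto simp: norm_mult intro: mult_right_le_one_le)
    from cauchy[OF this, of 2] have c: "cmod (deriv (deriv f) (of_real r * z)) \<le> 2 * \<epsilon> / (R - r)^2"
      by (simp add: numeral_2_eq_2)
    have w: "std_weight \<alpha> z \<le> 1" "0 \<le> std_weight \<alpha> z"
      using z \<alpha> powr_mono2[of \<alpha> "1 - (cmod z)^2" 1] by (auto simp: std_weight_def power_le_one)
    have "cmod ((of_real r)^2 * deriv (deriv f) (of_real r * z)) \<le> 1 * (2 * \<epsilon> / (R - r)^2)"
      unfolding norm_mult using c r by (intro mult_mono) (auto simp: norm_power power_le_one)
    then have "std_weight \<alpha> z * cmod ((of_real r)^2 * deriv (deriv f) (of_real r * z)) \<le> 1 * (1 * (2 * \<epsilon> / (R - r)^2))"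
      using w by (intro mult_mono) auto
    then show ?thesis by simp
  qed
  have off: "dil r f z = 0" if "z \<notin> unit_disc" for z using that by (simp add: dil_def)
  show "dil r f \<in> zygmund \<alpha>" by (rule zygmundI(1)[OF d off 2])
  have "zyg_norm \<alpha> (dil r f) \<le> cmod (dil r f 0) + cmod (of_real r * deriv f (of_real r * 0)) + 2 * \<epsilon> / (R - r)^2"
    by (rule zygmundI(2)[OF d off 2])
  also have "\<dots> \<le> \<epsilon> + \<epsilon> / (R - r) + 2 * \<epsilon> / (R - r)^2"
  proof -
    have "cmod (deriv f 0) \<le> \<epsilon> / (R - r)" using cauchy[of 0 1] r by simp
    then have "cmod (of_real r * deriv f 0) \<le> 1 * (\<epsilon> / (R - r))"
      unfolding norm_mult using r by (intro mult_mono) auto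
    moreover have "cmod (dil r f 0) \<le> \<epsilon>" using b[of 0] r by (simp add: dil_def)
    ultimately show ?thesis by simp
  qed
  also have "\<dots> = \<epsilon> * (1 + 1 / (R - r) + 2 / (R - r)^2)" by (simp add: distrib_left)
  finally show "zyg_norm \<alpha> (dil r f) \<le> \<epsilon> * (1 + 1 / (R - r) + 2 / (R - r)^2)" .
qed

lemma dil_in_zygmund:
  assumes "0 < \<alpha>" "f holomorphic_on unit_disc" "0 \<le> r" "r < 1"
  shows "dil r f \<in> zygmund \<alpha>"
proof -
  let ?R = "(1 + r) / 2"
  have "continuous_on (cball 0 ?R) f"
    using assms by (intro continuous_on_subset[OF holomorphic_on_imp_continuous_on[OF assms(2)]]) auto
  then have "compact (f ` cball 0 ?R)" by (intro compact_continuous_image) auto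
  then have "bounded (f ` cball 0 ?R)" by (rule compact_imp_bounded)
  then obtain B where B: "\<forall>x \<in> f ` cball 0 ?R. cmod x \<le> B" unfolding bounded_iff ..
  then have "cmod (f z) \<le> B" if "cmod z \<le> ?R" for z using that by auto
  then show ?thesis using assms by (intro dil_norm_le(1)[of _ _ _ ?R B]) auto
qed

text \<open>Unlike in the characterization of compact sets by sequences, only sequences in \<open>S\<close> have to be
  considered. Convergent subsequences of injective sequences yield accumulation points, and the
  Bolzano-Weierstrass criterion applies.\<close>

lemma (in Metric_space) compact_closure_of_if_subsequences:
  assumes "S \<subseteq> M" and sub: "\<And>\<sigma> :: nat \<Rightarrow> 'a. range \<sigma> \<subseteq> S \<Longrightarrow>
    \<exists>l k. l \<in> M \<and> strict_mono k \<and> limitin mtopology (\<sigma> \<circ> k) l sequentially"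
  shows "compactin mtopology (mtopology closure_of S)"
  unfolding compact_closure_of_eq_Bolzano_Weierstrass
proof (intro allI impI)
  fix A assume A: "infinite A \<and> A \<subseteq> S \<and> A \<subseteq> M"
  then obtain \<sigma> :: "nat \<Rightarrow> 'a" where \<sigma>: "inj \<sigma>" "range \<sigma> \<subseteq> A"
    using infinite_countable_subset by blast
  obtain l k where l: "l \<in> M" "strict_mono k" "limitin mtopology (\<sigma> \<circ> k) l sequentially"
    using sub[of \<sigma>] \<sigma>(2) A by blast
  have "l \<in> mtopology derived_set_of A"
    unfolding in_derived_set_of
  proof (intro conjI allI impI)
    show "l \<in> topspace mtopology" using l by simp
    fix U assume U: "l \<in> U \<and> openin mtopology U"
    with l(3) obtain N where N: "\<And>n. N \<le> n \<Longrightarrow> \<sigma> (k n) \<in> U"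
      by (auto simp: limitin_sequentially)
    have "\<sigma> (k N) \<noteq> \<sigma> (k (Suc N))"
      using \<sigma>(1) l(2) by (auto simp: inj_eq strict_mono_eq)
    then obtain n where "N \<le> n" "\<sigma> (k n) \<noteq> l" by (metis le_SucI order_refl)
    then show "\<exists>y. y \<noteq> l \<and> y \<in> A \<and> y \<in> U" using N \<sigma>(2) by blast
  qed
  then show "mtopology derived_set_of A \<noteq> {}" by blast
qed

text \<open>The unit ball is a normal family because its members are uniformly Lipschitz on smaller discs.\<close>

lemma zyg_ball_montel:
  assumes \<alpha>: "0 < \<alpha>" and f: "\<And>n :: nat. f n \<in> zyg_unit_ball \<alpha>"
  shows "\<exists>F k. F holomorphic_on unit_disc \<and> strict_mono (k :: nat \<Rightarrow> nat) \<and>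
    (\<forall>s<1. uniform_limit (cball 0 s) (f \<circ> k) F sequentially)"
proof -
  let ?H = "zyg_unit_ball \<alpha>"
  have "\<exists>B. \<forall>h\<in>?H. \<forall>z\<in>K. norm (h z) \<le> B" if K: "compact K" "K \<subseteq> unit_disc" for K
  proof (cases "K = {}")
    case False
    have "continuous_on K (\<lambda>z. cmod z)" by (intro continuous_intros)
    then obtain z0 where z0: "z0 \<in> K" "\<And>z. z \<in> K \<Longrightarrow> cmod z \<le> cmod z0"
      using continuous_attains_sup[OF K(1) False] by blast
    define s where "s = cmod z0"
    have s: "0 \<le> s" "s < 1" using z0 K by (auto simp: s_def)
    define B where "B = 1 + (1 + (1 - s) powr (- \<alpha>)) * 1"
    have "cmod (h z) \<le> B" if h: "h \<in> ?H" and z: "z \<in> K" for h z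
    proof -
      have h': "h \<in> zygmund \<alpha>" "zyg_norm \<alpha> h \<le> 1" using h by (auto simp: zyg_unit_ball_def)
      have "cmod (h z) \<le> cmod (h 0) + cmod (h z - h 0)"
        using norm_triangle_ineq[of "h 0" "h z - h 0"] by simp
      also have "\<dots> \<le> 1 + (1 + (1 - s) powr (- \<alpha>)) * cmod (z - 0)"
        using zyg_local_lipschitz(3)[OF \<alpha> h s, of z 0] z0(2)[OF z] s zyg_norm_bounds(1)[OF h'(1)] h'(2)
        by (intro add_mono) (auto simp: s_def)
      also have "\<dots> \<le> B" unfolding B_def using z0(2)[OF z] s 
        by (intro add_mono mult_left_mono order_refl) (auto simp: s_def)
      finally show ?thesis .
    qed
    then show ?thesis by blast
  qed auto
  then have loc: "\<And>K. compact K \<Longrightarrow> K \<subseteq> unit_disc \<Longrightarrow> \<exists>B. \<forall>h\<in>?H. \<forall>z\<in>K. norm (h z) \<le> B" .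
  have hol: "\<And>h. h \<in> ?H \<Longrightarrow> h holomorphic_on unit_disc"
    using zygmund_hol by (auto simp: zyg_unit_ball_def)
  have sub: "range f \<subseteq> ?H" using f by auto
  show ?thesis
  proof (rule Montel[OF open_ball hol loc sub])
    fix F k assume F: "F holomorphic_on unit_disc" "strict_mono (k :: nat \<Rightarrow> nat)"
      "\<And>K. compact K \<Longrightarrow> K \<subseteq> unit_disc \<Longrightarrow> uniform_limit K (f \<circ> k) F sequentially"
    have "uniform_limit (cball 0 s) (f \<circ> k) F sequentially" if "s < 1" for s
      using that by (intro F(3)) auto
    with F(1,2) show ?thesis by blast
  qed
qed

context bounded_UC begin

text \<open>A sequence in the unit ball has a subsequence converging locally uniformly to some \<open>F\<close>; the
  dilates then converge in norm to the dilate of \<open>F\<close>, which lies in the space even if \<open>F\<close> itself does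
  not satisfy any bound near the circle, and \<open>T\<close> preserves this convergence.\<close>

lemma compact_T_dil:
  assumes r: "0 \<le> r" "r < 1"
  shows "compact_op \<alpha> \<beta> (\<lambda>f z. - T (dil r f) z)" (is "compact_op \<alpha> \<beta> ?K")
proof -
  interpret Z: Metric_space "zygmund \<beta>" "zyg_dist \<beta>" by (rule Metric_space_zygmund)
  have dil: "dil r f \<in> zygmund \<alpha>" if "f holomorphic_on unit_disc" for f
    using alpha_pos that r by (rule dil_in_zygmund)
  have K_in: "?K f \<in> zygmund \<beta>" if "f holomorphic_on unit_disc" for f
    using zygmund_scale[OF T_in[OF dil[OF that]], of "-1"] by simp
  have "linear_op \<alpha> \<beta> ?K"
    unfolding linear_op_def
  proof (intro conjI ballI allI)
    show "?K \<in> zygmund \<alpha> \<rightarrow> zygmund \<beta>" using K_in zygmund_hol by blast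
    show "?K (\<lambda>z. f z + h z) = (\<lambda>z. ?K f z + ?K h z)" if "f \<in> zygmund \<alpha>" "h \<in> zygmund \<alpha>" for f h
    proof -
      have "dil r (\<lambda>z. f z + h z) = (\<lambda>z. dil r f z + dil r h z)" by (auto simp: dil_def)
      moreover have "T (\<lambda>z. dil r f z + dil r h z) = (\<lambda>z. T (dil r f) z + T (dil r h) z)"
        using T_linear dil zygmund_hol that unfolding linear_op_def by metis
      ultimately show ?thesis by simp
    qed
    show "?K (\<lambda>z. c * f z) = (\<lambda>z. c * ?K f z)" if "f \<in> zygmund \<alpha>" for f c
    proof -
      have "dil r (\<lambda>z. c * f z) = (\<lambda>z. c * dil r f z)" by (auto simp: dil_def)
      moreover have "T (\<lambda>z. c * dil r f z) = (\<lambda>z. c * T (dil r f) z)"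
        using T_linear dil[OF zygmund_hol[OF that]] unfolding linear_op_def by metis
      ultimately show ?thesis by simp
    qed
  qed
  moreover have "compactin (zyg_topology \<beta>) (zyg_topology \<beta> closure_of (?K ` zyg_unit_ball \<alpha>))"
  proof (rule Z.compact_closure_of_if_subsequences)
    show "?K ` zyg_unit_ball \<alpha> \<subseteq> zygmund \<beta>"
      using K_in zygmund_hol by (auto simp: zyg_unit_ball_def)
    fix \<sigma> :: "nat \<Rightarrow> complex \<Rightarrow> complex" assume "range \<sigma> \<subseteq> ?K ` zyg_unit_ball \<alpha>"
    then have "\<forall>n. \<exists>f. f \<in> zyg_unit_ball \<alpha> \<and> \<sigma> n = ?K f" by blast
    then obtain f where f: "\<And>n. f n \<in> zyg_unit_ball \<alpha>" "\<And>n. \<sigma> n = ?K (f n)" by metis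
    obtain F k where F: "F holomorphic_on unit_disc" "strict_mono (k :: nat \<Rightarrow> nat)"
      "\<forall>s<1. uniform_limit (cball 0 s) (f \<circ> k) F sequentially"
      using zyg_ball_montel[of \<alpha> f, OF alpha_pos f(1)] by (elim exE conjE)
    obtain C where C: "0 < C" "\<And>f. f \<in> zygmund \<alpha> \<Longrightarrow> zyg_norm \<beta> (T f) \<le> C * zyg_norm \<alpha> f"
      using T_bound by blast
    define R where "R = (1 + r) / 2"
    have R: "r < R" "R < 1" using r by (auto simp: R_def)
    define c where "c = 1 + 1 / (R - r) + 2 / (R - r)^2"
    have c: "0 < c" unfolding c_def using R by (intro add_pos_nonneg) auto
    have fh: "f n holomorphic_on unit_disc" for n
      using f(1)[of n] zygmund_hol by (auto simp: zyg_unit_ball_def)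
    have "limitin (zyg_topology \<beta>) (\<sigma> \<circ> k) (?K F) sequentially"
      unfolding Z.limit_metric_sequentially
    proof (intro conjI allI impI)
      show "?K F \<in> zygmund \<beta>" using K_in[OF F(1)] .
      fix e :: real assume e: "0 < e"
      define d where "d = e / (2 * C * c)"
      have d: "0 < d" "C * (d * c) < e" using e C c by (auto simp: d_def)
      obtain N where N: "\<And>n z. N \<le> n \<Longrightarrow> cmod z \<le> R \<Longrightarrow> dist (f (k n) z) (F z) < d"
        using F(3)[rule_format, OF R(2)] d(1) unfolding uniform_limit_iff eventually_sequentially by force
      have "\<sigma> (k n) \<in> zygmund \<beta> \<and> zyg_dist \<beta> (\<sigma> (k n)) (?K F) < e" if n: "N \<le> n" for n
      proof
        let ?D = "\<lambda>z. F z - f (k n) z"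
        show 1: "\<sigma> (k n) \<in> zygmund \<beta>" using K_in[OF fh] f(2) by simp
        have Dh: "?D holomorphic_on unit_disc" using F(1) fh by (intro holomorphic_intros)
        have Dn: "dil r ?D \<in> zygmund \<alpha>" "zyg_norm \<alpha> (dil r ?D) \<le> d * c"
          using dil_norm_le[OF alpha_pos Dh r(1) R, of d] N[OF n]
          by (auto simp: dist_norm norm_minus_commute c_def less_imp_le)
        have "dil r ?D = (\<lambda>z. dil r F z - dil r (f (k n)) z)" by (auto simp: dil_def)
        then have "(\<lambda>z. \<sigma> (k n) z - ?K F z) = T (dil r ?D)"
          using T_diff[OF dil[OF F(1)] dil[OF fh[of "k n"]]] f(2) by simp
        then have "zyg_dist \<beta> (\<sigma> (k n)) (?K F) = zyg_norm \<beta> (T (dil r ?D))"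
          using 1 K_in[OF F(1)] by (simp add: zyg_dist_def)
        also have "\<dots> \<le> C * (d * c)"
          using order_trans[OF C(2)[OF Dn(1)] mult_left_mono[OF Dn(2), of C]] C(1) by simp
        finally show "zyg_dist \<beta> (\<sigma> (k n)) (?K F) < e" using d(2) by simp
      qed
      then show "\<exists>N. \<forall>n\<ge>N. (\<sigma> \<circ> k) n \<in> zygmund \<beta> \<and> zyg_dist \<beta> ((\<sigma> \<circ> k) n) (?K F) < e" by auto
    qed
    then show "\<exists>l k. l \<in> zygmund \<beta> \<and> strict_mono k \<and> limitin (zyg_topology \<beta>) (\<sigma> \<circ> k) l sequentially"
      using F(2) K_in[OF F(1)] by blast
  qed
  ultimately show ?thesis by (simp add: compact_op_def)
qed

text \<open>The quantities \<open>osc1\<close> and \<open>osc0\<close>, taken at \<open>\<phi>(z)\<close>, are the moduli of the coefficients of \<open>u\<close> and \<open>v\<close> in the second derivative of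
  \<open>T (f - dil r f)\<close>.\<close>

definition osc1 :: "real \<Rightarrow> (complex \<Rightarrow> complex) \<Rightarrow> complex \<Rightarrow> real" where
  "osc1 r f w = cmod (deriv f w - of_real r * deriv f (of_real r * w))"

definition osc0 :: "real \<Rightarrow> (complex \<Rightarrow> complex) \<Rightarrow> complex \<Rightarrow> real" where
  "osc0 r f w = cmod (f w - f (of_real r * w))"

text \<open>An asymptotic bound as \<open>r\<close> and \<open>|\<phi>(z)|\<close> tend to \<open>1\<close> together, uniform over the unit ball.\<close>

definition tail_le :: "(complex \<Rightarrow> complex) \<Rightarrow> (real \<Rightarrow> (complex \<Rightarrow> complex) \<Rightarrow> complex \<Rightarrow> real) \<Rightarrow> real \<Rightarrow> bool" where
  "tail_le h D E \<longleftrightarrow> (\<forall>\<epsilon>>0. \<exists>s<1. \<exists>r0<1. \<forall>r f z. 0 \<le> r \<and> r0 < r \<and> r < 1 \<and> f \<in> zyg_unit_ball \<alpha> \<and>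
     z \<in> unit_disc \<and> s < cmod (\<phi> z) \<longrightarrow> std_weight \<beta> z * cmod (h z) * D r f (\<phi> z) \<le> E + \<epsilon>)"

text \<open>The compact perturbation is \<open>f \<mapsto> - T (dil r f)\<close>. Where \<open>|\<phi>(z)| \<le> s\<close>, the local Lipschitz bounds make
  the oscillations of order \<open>1 - r\<close>, hence negligible once \<open>s\<close> is fixed and \<open>r\<close> is close to \<open>1\<close>.\<close>

lemma ess_norm_le:
  assumes u: "tail_le u osc1 E1" and v: "tail_le v osc0 E0" and E: "0 \<le> E1" "0 \<le> E0"
  shows "ess_norm \<alpha> \<beta> T \<le> ereal (E1 + E0)"
proof (rule ereal_le_epsilon2)
  fix e :: real assume "0 < e"
  define \<epsilon> where "\<epsilon> = e / 3"
  have \<epsilon>: "0 < \<epsilon>" "e = 3 * \<epsilon>" using \<open>0 < e\<close> by (auto simp: \<epsilon>_def)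
  obtain s1 r1 where 1: "s1 < 1" "r1 < 1" "\<And>r f z. 0 \<le> r \<Longrightarrow> r1 < r \<Longrightarrow> r < 1 \<Longrightarrow> f \<in> zyg_unit_ball \<alpha> \<Longrightarrow>
     z \<in> unit_disc \<Longrightarrow> s1 < cmod (\<phi> z) \<Longrightarrow> wu z * osc1 r f (\<phi> z) \<le> E1 + \<epsilon>"
    using u \<epsilon>(1) unfolding tail_le_def by metis
  obtain s0 r0 where 0: "s0 < 1" "r0 < 1" "\<And>r f z. 0 \<le> r \<Longrightarrow> r0 < r \<Longrightarrow> r < 1 \<Longrightarrow> f \<in> zyg_unit_ball \<alpha> \<Longrightarrow>
     z \<in> unit_disc \<Longrightarrow> s0 < cmod (\<phi> z) \<Longrightarrow> wv z * osc0 r f (\<phi> z) \<le> E0 + \<epsilon>"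
    using v \<epsilon>(1) unfolding tail_le_def by metis
  obtain M where M: "0 < M" "\<And>z. z \<in> unit_disc \<Longrightarrow> wu z \<le> M"
    "\<And>z. z \<in> unit_disc \<Longrightarrow> wv z \<le> M" using coeff_bounded by blast
  (* |phi 0| is included so that the value of T (f - dil r f)' at 0 is covered by the inner part *)
  define s where "s = max (max s0 s1) (cmod (\<phi> 0))"
  have s: "0 \<le> s" "s < 1" "s0 \<le> s" "s1 \<le> s" "cmod (\<phi> 0) \<le> s"
    using 0 1 phi_in[of 0] by (auto simp: s_def le_max_iff_disj)
  define G where "G = (1 - s) powr (- \<alpha>)"
  have G: "0 \<le> G" by (simp add: G_def)
  define B where "B = (M + cmod (deriv g 0)) * (1 + 2 * G)"
  have B: "0 < B" unfolding B_def using M(1) G by (intro mult_pos_pos add_pos_nonneg) auto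
  (* the last entry makes (1 + 2 G) (1 - r) times M, or times |g' 0|, at most epsilon *)
  define r where "r = Max {0, (1 + r0) / 2, (1 + r1) / 2, 1 - \<epsilon> / B}"
  have r: "0 \<le> r" "r0 < r" "r1 < r" "r < 1" "1 - \<epsilon> / B \<le> r"
    using 0 1 \<epsilon> B by (auto simp: r_def Max_gr_iff less_max_iff_disj)
  then have small: "B * (1 - r) \<le> \<epsilon>" using B by (simp add: field_simps)
  let ?K = "\<lambda>f z. - T (dil r f) z"
  have bound: "zyg_norm \<beta> (\<lambda>z. T f z + ?K f z) \<le> E1 + E0 + e" if f: "f \<in> zyg_unit_ball \<alpha>" for f
  proof -
    have f': "f \<in> zygmund \<alpha>" "zyg_norm \<alpha> f \<le> 1" using f by (auto simp: zyg_unit_ball_def)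
    have dilf: "dil r f \<in> zygmund \<alpha>" using dil_in_zygmund[OF alpha_pos zygmund_hol[OF f'(1)] r(1,4)] .
    define h where "h = (\<lambda>z. f z - dil r f z)"
    have h: "h \<in> zygmund \<alpha>" unfolding h_def by (rule zygmund_diff[OF f'(1) dilf])
    have h0: "cmod (h w) = osc0 r f w" if "w \<in> unit_disc" for w
      using that by (simp add: h_def osc0_def dil_def)
    have h1: "cmod (deriv h w) = osc1 r f w" if "w \<in> unit_disc" for w
    proof -
      have "deriv h w = deriv f w - deriv (dil r f) w"
        unfolding h_def using deriv2_diff(1)[of f "dil r f" w] f'(1) dilf that by (auto simp: zygmund_def)
      also have "deriv (dil r f) w = of_real r * deriv f (of_real r * w)"
        using dil_derivs(1)[OF zygmund_hol[OF f'(1)] r(1) _ that] r(4) by (simp add: DERIV_imp_deriv)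
      finally show ?thesis by (simp add: osc1_def)
    qed
    have near: "osc1 r f w \<le> (1 + 2 * G) * (1 - r)" "osc0 r f w \<le> (1 + 2 * G) * (1 - r)"
      if w: "cmod w \<le> s" for w
    proof -
      have rw: "cmod (of_real r * w) \<le> s"
        using w r s by (auto simp: norm_mult intro: order_trans[OF mult_left_le_one_le])
      have "cmod (w - of_real r * w) = cmod ((1 - of_real r) * w)" by (simp add: algebra_simps)
      also have "\<dots> = (1 - r) * cmod w" using r norm_of_real[of "1 - r", where 'a = complex] by (simp add: norm_mult)
      also have "\<dots> \<le> 1 - r" using w s r by (intro mult_right_le_one_le) auto
      finally have d: "cmod (w - of_real r * w) \<le> 1 - r" .
      note lip = zyg_local_lipschitz[OF alpha_pos f s(1,2), folded G_def]
      have "osc1 r f w = cmod ((deriv f w - deriv f (of_real r * w)) + (1 - of_real r) * deriv f (of_real r * w))"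
        by (simp add: osc1_def algebra_simps)
      also have "\<dots> \<le> cmod (deriv f w - deriv f (of_real r * w)) + (1 - r) * cmod (deriv f (of_real r * w))"
        using norm_triangle_ineq norm_of_real[of "1 - r", where 'a = complex] r by (metis (no_types, opaque_lifting) abs_of_nonneg diff_ge_0_iff_ge less_imp_le norm_mult of_real_1 of_real_diff)
      also have "\<dots> \<le> G * (1 - r) + (1 - r) * (1 + G)"
        using lip(1)[OF w rw] lip(2)[OF rw rw] d G r
        by (intro add_mono mult_left_mono) (auto intro: order_trans mult_left_mono)
      finally show "osc1 r f w \<le> (1 + 2 * G) * (1 - r)" by (simp add: algebra_simps)
      have "osc0 r f w \<le> (1 + G) * (1 - r)"
        unfolding osc0_def using lip(3)[OF w rw] d G by (auto intro: order_trans mult_left_mono)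
      also have "\<dots> \<le> (1 + 2 * G) * (1 - r)" using G r by (intro mult_right_mono) auto
      finally show "osc0 r f w \<le> (1 + 2 * G) * (1 - r)" .
    qed
    have M_small: "M * ((1 + 2 * G) * (1 - r)) \<le> \<epsilon>" "cmod (deriv g 0) * ((1 + 2 * G) * (1 - r)) \<le> \<epsilon>"
    proof -
      have nn: "0 \<le> (1 + 2 * G) * (1 - r)" using G r by auto
      have "M * ((1 + 2 * G) * (1 - r)) \<le> (M + cmod (deriv g 0)) * ((1 + 2 * G) * (1 - r))"
        "cmod (deriv g 0) * ((1 + 2 * G) * (1 - r)) \<le> (M + cmod (deriv g 0)) * ((1 + 2 * G) * (1 - r))"
        using M(1) by (intro mult_right_mono nn; simp)+
      then show "M * ((1 + 2 * G) * (1 - r)) \<le> \<epsilon>" "cmod (deriv g 0) * ((1 + 2 * G) * (1 - r)) \<le> \<epsilon>"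
        using small by (auto simp: B_def mult.assoc)
    qed
    have "(\<lambda>z. T f z + ?K f z) = T h"
      using T_diff[OF f'(1) dilf] by (simp add: h_def)
    moreover have "zyg_norm \<beta> (T h) \<le> cmod (h (\<phi> 0)) * cmod (deriv g 0) + (E1 + E0 + 2 * \<epsilon>)"
    proof (rule T_norm_le[OF h])
      fix z :: complex assume z: "z \<in> unit_disc"
      have w: "0 < std_weight \<beta> z" using z by (rule std_weight_pos)
      have p: "\<phi> z \<in> unit_disc" using phi_in z by simp
      have "std_weight \<beta> z * cmod (deriv h (\<phi> z) * u z + h (\<phi> z) * v z)
        \<le> std_weight \<beta> z * (osc1 r f (\<phi> z) * cmod (u z) + osc0 r f (\<phi> z) * cmod (v z))"
        using w by (intro mult_left_mono norm_triangle_le) (auto simp: norm_mult h0[OF p] h1[OF p])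
      also have "\<dots> = wu z * osc1 r f (\<phi> z) + wv z * osc0 r f (\<phi> z)"
        by (simp add: algebra_simps)
      also have "\<dots> \<le> (E1 + \<epsilon>) + (E0 + \<epsilon>)"
      proof (cases "cmod (\<phi> z) \<le> s")
        case True
        have "wu z * osc1 r f (\<phi> z) \<le> M * ((1 + 2 * G) * (1 - r))"
          "wv z * osc0 r f (\<phi> z) \<le> M * ((1 + 2 * G) * (1 - r))"
          using M(2,3)[OF z] near[OF True] M(1) w by (intro mult_mono; simp add: osc0_def osc1_def)+
        then show ?thesis using M_small E by linarith
      next
        case False
        then show ?thesis using 1(3)[OF r(1,3,4) f z] 0(3)[OF r(1,2,4) f z] s by (intro add_mono) auto
      qed
      finally show "std_weight \<beta> z * cmod (deriv h (\<phi> z) * u z + h (\<phi> z) * v z) \<le> E1 + E0 + 2 * \<epsilon>" by simp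
    qed
    moreover have "cmod (h (\<phi> 0)) * cmod (deriv g 0) \<le> \<epsilon>"
    proof -
      have "cmod (h (\<phi> 0)) \<le> (1 + 2 * G) * (1 - r)" using near(2)[OF s(5)] h0[of "\<phi> 0"] phi_in[of 0] by simp
      then have "cmod (deriv g 0) * cmod (h (\<phi> 0)) \<le> cmod (deriv g 0) * ((1 + 2 * G) * (1 - r))"
        by (intro mult_left_mono) auto
      then show ?thesis using M_small(2) by (simp add: mult.commute)
    qed
    ultimately show ?thesis using \<epsilon> by simp
  qed
  have "ess_norm \<alpha> \<beta> T \<le> op_norm \<alpha> \<beta> (\<lambda>f z. T f z + ?K f z)"
    unfolding ess_norm_def using compact_T_dil[OF r(1,4)] by (intro INF_lower) simp
  also have "\<dots> \<le> ereal (E1 + E0 + e)"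
    unfolding op_norm_def using bound by (intro SUP_least) simp
  finally show "ess_norm \<alpha> \<beta> T \<le> ereal (E1 + E0) + ereal e" by simp
qed

end

section \<open>The critical weights\<close>

text \<open>The growth rate of functions with derivative of size \<open>(1 - |z|) powr (- \<gamma> - 1)\<close>. The exponents in
  use are \<open>\<gamma> = \<alpha> - 1\<close> for derivatives and \<open>\<gamma> = \<alpha> - 2\<close> for values.\<close>

definition crit_weight :: "real \<Rightarrow> real \<Rightarrow> real" where
  "crit_weight \<gamma> x = (if \<gamma> = 0 then ln (1 / (1 - x)) else (1 - x) powr (- \<gamma>))"

definition crit_seq :: "real \<Rightarrow> nat \<Rightarrow> real" where
  "crit_seq \<gamma> n = (if \<gamma> = 0 then ln (real n) else (real n + 1) powr \<gamma>)"

lemma weight_pair_crit: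
  assumes "0 \<le> \<gamma>"
  shows "\<exists>C. weight_pair (crit_seq \<gamma>) (crit_weight \<gamma>) C"
proof (cases "\<gamma> = 0")
  case True
  then have "crit_seq \<gamma> = (\<lambda>n. ln (real n))" "crit_weight \<gamma> = (\<lambda>x. ln (1 / (1 - x)))"
    by (auto simp: crit_seq_def crit_weight_def)
  then show ?thesis using weight_pair_log by auto
next
  case False
  then have "crit_seq \<gamma> = (\<lambda>n. (real n + 1) powr \<gamma>)" "crit_weight \<gamma> = (\<lambda>x. (1 - x) powr (- \<gamma>))"
    by (auto simp: crit_seq_def crit_weight_def)
  then show ?thesis using weight_pair_power[of \<gamma>] assms False by auto
qed

lemma crit_weight_large:
  assumes "0 \<le> \<gamma>"
  shows "\<exists>s<1. \<forall>x. s < x \<and> x < 1 \<longrightarrow> A \<le> crit_weight \<gamma> x"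
proof (cases "\<gamma> = 0")
  case True
  have "A \<le> ln (1 / (1 - x))" if "1 - exp (- A) < x" "x < 1" for x
  proof -
    have "ln (1 - x) \<le> ln (exp (- A))" using that by (subst ln_le_cancel_iff) auto
    then show ?thesis using that by (simp add: ln_div)
  qed
  then show ?thesis using True by (intro exI[of _ "1 - exp (- A)"]) (auto simp: crit_weight_def)
next
  case False
  then have g: "0 < \<gamma>" using assms by simp
  define A' where "A' = max A 1"
  have "A \<le> (1 - x) powr (- \<gamma>)" if "1 - A' powr (- 1 / \<gamma>) < x" "x < 1" for x
  proof -
    have "A' = (A' powr (- 1 / \<gamma>)) powr (- \<gamma>)" using g by (simp add: powr_powr A'_def)
    also have "\<dots> \<le> (1 - x) powr (- \<gamma>)" using that g by (intro powr_mono2') auto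
    finally show ?thesis by (simp add: A'_def)
  qed
  moreover have "1 - A' powr (- 1 / \<gamma>) < 1" by (simp add: A'_def)
  ultimately show ?thesis using False
    by (intro exI[of _ "1 - A' powr (- 1 / \<gamma>)"]) (auto simp: crit_weight_def)
qed

text \<open>The critical weight is unbounded, so a bound with it forces decay without it.\<close>

lemma bdry_le_small:
  assumes \<gamma>: "0 \<le> \<gamma>" and b: "bdry_le h \<phi> (crit_weight \<gamma>) \<beta> P" and \<epsilon>: "0 < \<epsilon>"
    and phi: "\<phi> ` unit_disc \<subseteq> unit_disc"
  shows "bdry_le h \<phi> (\<lambda>_. 1) \<beta> \<epsilon>"
proof -
  define A where "A = (\<bar>P\<bar> + 1) / \<epsilon>"
  have A: "0 < A" using \<epsilon> by (auto simp: A_def)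
  obtain s where s: "s < 1" "\<And>x. s < x \<Longrightarrow> x < 1 \<Longrightarrow> A \<le> crit_weight \<gamma> x"
    using crit_weight_large[OF \<gamma>, of A] by blast
  obtain s' where s': "s' < 1" "\<And>z. z \<in> unit_disc \<Longrightarrow> s' < cmod (\<phi> z) \<Longrightarrow>
    std_weight \<beta> z * cmod (h z) * crit_weight \<gamma> (cmod (\<phi> z)) \<le> P" using b by (auto simp: bdry_le_def)
  have "std_weight \<beta> z * cmod (h z) \<le> \<epsilon>" if z: "z \<in> unit_disc" "max s s' < cmod (\<phi> z)" for z
  proof -
    have "cmod (\<phi> z) < 1" using phi z by (auto simp: image_subset_iff)
    then have "std_weight \<beta> z * cmod (h z) * A \<le> std_weight \<beta> z * cmod (h z) * crit_weight \<gamma> (cmod (\<phi> z))"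
      using s(2) z less_imp_le[OF std_weight_pos[OF z(1), of \<beta>]] by (intro mult_left_mono) auto
    also have "\<dots> \<le> P" using s'(2) z by auto
    finally have "std_weight \<beta> z * cmod (h z) \<le> P / A" using A by (simp add: field_simps)
    also have "\<dots> \<le> \<epsilon>" using A \<epsilon> by (simp add: A_def field_simps) (simp add: abs_if mult_left_mono split: if_splits)
    finally show ?thesis .
  qed
  then show ?thesis unfolding bdry_le_def using s(1) s'(1) by (intro exI[of _ "max s s'"]) auto
qed

lemma crit_weight_log_ge:
  assumes "1/2 \<le> x" "x < 1"
  shows "1/2 \<le> crit_weight 0 x"
proof -
  have "ln 2 \<le> ln (1 / (1 - x))" using assms by (subst ln_le_cancel_iff) (auto simp: field_simps)
  then show ?thesis using ln2_ge_two_thirds by (simp add: crit_weight_def)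
qed

text \<open>Stated for all \<open>w\<close> with \<open>|w| \<le> x\<close>, so that it covers a point and its dilates at once; the range
  \<open>x \<ge> 1/2\<close> lets the logarithm absorb the additive constant \<open>|h(0)|\<close>.\<close>

lemma growth_crit:
  assumes h: "h holomorphic_on unit_disc" and \<gamma>: "0 \<le> \<gamma>" and C: "0 \<le> C"
    and m: "\<And>z. z \<in> unit_disc \<Longrightarrow> cmod (deriv h z) \<le> C * (1 - cmod z) powr (- (\<gamma> + 1))"
    and h0: "cmod (h 0) \<le> 1" and x: "cmod w \<le> x" "1/2 \<le> x" "x < 1"
  shows "cmod (h w) \<le> (2 + C + C / \<gamma>) * crit_weight \<gamma> x"
proof (cases "\<gamma> = 0")
  case True
  have "cmod (h w) \<le> cmod (h 0) + C * ln (1 / (1 - cmod w))"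
    using m True x by (intro growth_log[OF h]) auto
  also have "ln (1 / (1 - cmod w)) \<le> crit_weight 0 x"
    unfolding crit_weight_def using x by (simp only: if_True refl, subst ln_le_cancel_iff) (auto simp: frac_le)
  finally have "cmod (h w) \<le> 1 + C * crit_weight 0 x" using h0 C by (simp add: mult_left_mono)
  then show ?thesis using crit_weight_log_ge[OF x(2,3)] True by (simp add: distrib_right)
next
  case False
  then have g: "0 < \<gamma>" using \<gamma> by simp
  have "cmod (h w) \<le> (cmod (h 0) + C / (\<gamma> + 1 - 1)) * (1 - cmod w) powr (1 - (\<gamma> + 1))"
    using m x g C by (intro growth_power[OF h]) auto
  also have "\<dots> \<le> (2 + C + C / \<gamma>) * (1 - x) powr (- \<gamma>)"
  proof (rule mult_mono)
    show "(1 - cmod w) powr (1 - (\<gamma> + 1)) \<le> (1 - x) powr (- \<gamma>)"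
      using powr_mono2'[of "- \<gamma>" "1 - x" "1 - cmod w"] x g by simp
  qed (use h0 g C in auto)
  finally show ?thesis using g by (simp add: crit_weight_def)
qed

lemma zyg_deriv_crit:
  assumes "1 \<le> \<alpha>"
  shows "\<exists>c>0. \<forall>f\<in>zyg_unit_ball \<alpha>. \<forall>w x. cmod w \<le> x \<longrightarrow> 1/2 \<le> x \<longrightarrow> x < 1 \<longrightarrow>
    cmod (deriv f w) \<le> c * crit_weight (\<alpha> - 1) x"
proof -
  have "cmod (deriv f w) \<le> (2 + 1 + 1 / (\<alpha> - 1)) * crit_weight (\<alpha> - 1) x"
    if f: "f \<in> zyg_unit_ball \<alpha>" and x: "cmod w \<le> x" "1/2 \<le> x" "x < 1" for f w x
  proof (rule growth_crit[OF _ _ _ _ _ x])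
    have f': "f \<in> zygmund \<alpha>" "zyg_norm \<alpha> f \<le> 1" using f by (auto simp: zyg_unit_ball_def)
    show "deriv f holomorphic_on unit_disc" using holomorphic_deriv[OF zygmund_hol[OF f'(1)] open_ball] .
    show "cmod (deriv f 0) \<le> 1" using zyg_norm_bounds(2)[OF f'(1)] f'(2) by simp
    show "cmod (deriv (deriv f) z) \<le> 1 * (1 - cmod z) powr (- (\<alpha> - 1 + 1))" if "z \<in> unit_disc" for z
      using zyg_deriv2_le[OF _ f that] assms by simp
  qed (use assms in auto)
  moreover have "0 < 2 + 1 + 1 / (\<alpha> - 1)" using assms by (intro add_pos_nonneg) auto
  ultimately show ?thesis by blast
qed

lemma zyg_value_crit:
  assumes "2 \<le> \<alpha>"
  shows "\<exists>c>0. \<forall>f\<in>zyg_unit_ball \<alpha>. \<forall>w x. cmod w \<le> x \<longrightarrow> 1/2 \<le> x \<longrightarrow> x < 1 \<longrightarrow>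
    cmod (f w) \<le> c * crit_weight (\<alpha> - 2) x"
proof -
  define C where "C = 1 + 1 / (\<alpha> - 1)"
  have C: "0 \<le> C" using assms by (simp add: C_def)
  have "cmod (f w) \<le> (2 + C + C / (\<alpha> - 2)) * crit_weight (\<alpha> - 2) x"
    if f: "f \<in> zyg_unit_ball \<alpha>" and x: "cmod w \<le> x" "1/2 \<le> x" "x < 1" for f w x
  proof (rule growth_crit[OF _ _ C _ _ x])
    have f': "f \<in> zygmund \<alpha>" "zyg_norm \<alpha> f \<le> 1" using f by (auto simp: zyg_unit_ball_def)
    show "f holomorphic_on unit_disc" using zygmund_hol[OF f'(1)] .
    show "cmod (f 0) \<le> 1" using zyg_norm_bounds(1)[OF f'(1)] f'(2) by simp
    show "cmod (deriv f z) \<le> C * (1 - cmod z) powr (- (\<alpha> - 2 + 1))" if "z \<in> unit_disc" for z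
      using zyg_deriv_le[OF _ f that] assms unfolding C_def by (simp add: algebra_simps)
  qed (use assms in auto)
  moreover have "0 < 2 + C + C / (\<alpha> - 2)" using assms C by (intro add_pos_nonneg) auto
  ultimately show ?thesis by blast
qed

context bounded_UC begin

lemma tail_le_of_bdry_le:
  assumes D: "\<And>r f w. 0 \<le> r \<Longrightarrow> r < 1 \<Longrightarrow> f \<in> zyg_unit_ball \<alpha> \<Longrightarrow> 1/2 \<le> cmod w \<Longrightarrow> cmod w < 1 \<Longrightarrow>
      D r f w \<le> c * wt (cmod w)"
    and c: "0 \<le> c" and b: "bdry_le h \<phi> wt \<beta> P"
  shows "tail_le h D (c * P)"
proof -
  obtain s where s: "s < 1" "\<And>z. z \<in> unit_disc \<Longrightarrow> s < cmod (\<phi> z) \<Longrightarrow>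
    std_weight \<beta> z * cmod (h z) * wt (cmod (\<phi> z)) \<le> P" using b by (auto simp: bdry_le_def)
  have "std_weight \<beta> z * cmod (h z) * D r f (\<phi> z) \<le> c * P"
    if r: "0 \<le> r" "r < 1" and f: "f \<in> zyg_unit_ball \<alpha>" and z: "z \<in> unit_disc" "max s (1/2) < cmod (\<phi> z)" for r f z
  proof -
    have "std_weight \<beta> z * cmod (h z) * D r f (\<phi> z) \<le> std_weight \<beta> z * cmod (h z) * (c * wt (cmod (\<phi> z)))"
      using less_imp_le[OF std_weight_pos[OF z(1), of \<beta>]] z phi_in by (intro mult_left_mono D r f) auto
    also have "\<dots> = c * (std_weight \<beta> z * cmod (h z) * wt (cmod (\<phi> z)))" by simp
    also have "\<dots> \<le> c * P" using s(2) z c by (intro mult_left_mono) auto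
    finally show ?thesis .
  qed
  note * = this
  show ?thesis unfolding tail_le_def
  proof (intro allI impI)
    fix \<epsilon> :: real assume "0 < \<epsilon>"
    show "\<exists>sa<1. \<exists>r0<1. \<forall>r f z. 0 \<le> r \<and> r0 < r \<and> r < 1 \<and> f \<in> zyg_unit_ball \<alpha> \<and>
     z \<in> unit_disc \<and> sa < cmod (\<phi> z) \<longrightarrow> std_weight \<beta> z * cmod (h z) * D r f (\<phi> z) \<le> c * P + \<epsilon>"
    proof (rule exI[of _ "max s (1/2)"], rule conjI[OF _ exI[of _ "0::real"]], use s(1) in simp,
      rule conjI, simp, intro allI impI)
      fix r :: real and f z assume "0 \<le> r \<and> 0 < r \<and> r < 1 \<and> f \<in> zyg_unit_ball \<alpha> \<and> z \<in> unit_disc \<and> max s (1/2) < cmod (\<phi> z)"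
      then show "std_weight \<beta> z * cmod (h z) * D r f (\<phi> z) \<le> c * P + \<epsilon>"
        using *[of r f z] \<open>0 < \<epsilon>\<close> by linarith
    qed
  qed
qed

text \<open>Hoelder continuity up to the circle makes the oscillation small everywhere, so no boundary term
  remains.\<close>

lemma tail_le_of_uniform:
  assumes D: "\<And>r f w. 0 \<le> r \<Longrightarrow> r < 1 \<Longrightarrow> f \<in> zyg_unit_ball \<alpha> \<Longrightarrow> cmod w < 1 \<Longrightarrow>
      D r f w \<le> C * (1 - r) powr q"
    and q: "0 < q" and M: "\<And>z. z \<in> unit_disc \<Longrightarrow> std_weight \<beta> z * cmod (h z) \<le> M"
  shows "tail_le h D 0"
  unfolding tail_le_def
proof (intro allI impI)
  fix \<epsilon> :: real assume \<epsilon>: "0 < \<epsilon>"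
  define N where "N = max C 1 * max M 1"
  have N: "0 < N" by (simp add: N_def)
  let ?r0 = "1 - (\<epsilon> / N) powr (1 / q)"
  have "std_weight \<beta> z * cmod (h z) * D r f (\<phi> z) \<le> 0 + \<epsilon>"
    if a: "0 \<le> r" "?r0 < r" "r < 1" "f \<in> zyg_unit_ball \<alpha>" "z \<in> unit_disc" for r f z
  proof -
    have "(1 - r) powr q \<le> ((\<epsilon> / N) powr (1 / q)) powr q"
      using a q by (intro powr_mono2) auto
    also have "\<dots> = \<epsilon> / N" using q \<epsilon> N by (simp add: powr_powr)
    finally have e: "N * (1 - r) powr q \<le> \<epsilon>" using N by (simp add: field_simps)
    have w: "0 \<le> std_weight \<beta> z * cmod (h z)" using less_imp_le[OF std_weight_pos[OF a(5), of \<beta>]] by simp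
    have "D r f (\<phi> z) \<le> C * (1 - r) powr q" using a phi_in by (intro D) auto
    also have "\<dots> \<le> max C 1 * (1 - r) powr q" by (intro mult_right_mono) auto
    finally have "std_weight \<beta> z * cmod (h z) * D r f (\<phi> z) \<le> std_weight \<beta> z * cmod (h z) * (max C 1 * (1 - r) powr q)"
      using w by (intro mult_left_mono) auto
    also have "\<dots> \<le> max M 1 * (max C 1 * (1 - r) powr q)"
      using M[OF a(5)] by (intro mult_right_mono) auto
    also have "\<dots> = N * (1 - r) powr q" by (simp add: N_def)
    finally show ?thesis using e by simp
  qed
  moreover have "?r0 < 1" using \<epsilon> N by simp
  ultimately show "\<exists>s<1. \<exists>r0<1. \<forall>r f z. 0 \<le> r \<and> r0 < r \<and> r < 1 \<and> f \<in> zyg_unit_ball \<alpha> \<and>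
     z \<in> unit_disc \<and> s < cmod (\<phi> z) \<longrightarrow> std_weight \<beta> z * cmod (h z) * D r f (\<phi> z) \<le> 0 + \<epsilon>"
    by (intro exI[of _ "0::real"] conjI exI[of _ ?r0]) auto
qed

lemma dilate_le:
  assumes "0 \<le> r" "r < 1"
  shows "cmod (of_real r * w) \<le> cmod w"
  using assms by (auto simp: norm_mult intro: mult_left_le_one_le)

lemma tail_deriv:
  assumes c: "0 < c" "\<forall>f\<in>zyg_unit_ball \<alpha>. \<forall>w x. cmod w \<le> x \<longrightarrow> 1/2 \<le> x \<longrightarrow> x < 1 \<longrightarrow>
    cmod (deriv f w) \<le> c * crit_weight (\<alpha> - 1) x"
    and b: "bdry_le u \<phi> (crit_weight (\<alpha> - 1)) \<beta> P"
  shows "tail_le u osc1 (2 * c * P)"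
proof (rule tail_le_of_bdry_le[OF _ _ b])
  fix r :: real and f w assume a: "0 \<le> r" "r < 1" "f \<in> zyg_unit_ball \<alpha>" "1/2 \<le> cmod w" "cmod w < 1"
  have "osc1 r f w \<le> cmod (deriv f w) + r * cmod (deriv f (of_real r * w))"
    unfolding osc1_def using norm_triangle_ineq4[of "deriv f w" "of_real r * deriv f (of_real r * w)"] a(1)
    by (simp add: norm_mult)
  also have "\<dots> \<le> cmod (deriv f w) + cmod (deriv f (of_real r * w))"
    using a by (intro add_left_mono mult_left_le_one_le) auto
  also have "\<dots> \<le> c * crit_weight (\<alpha> - 1) (cmod w) + c * crit_weight (\<alpha> - 1) (cmod w)"
    using dilate_le[OF a(1,2)] by (intro add_mono c(2)[rule_format] a) auto
  finally show "osc1 r f w \<le> 2 * c * crit_weight (\<alpha> - 1) (cmod w)" by simp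
qed (use c in auto)

lemma tail_value:
  assumes c: "0 < c" "\<forall>f\<in>zyg_unit_ball \<alpha>. \<forall>w x. cmod w \<le> x \<longrightarrow> 1/2 \<le> x \<longrightarrow> x < 1 \<longrightarrow>
    cmod (f w) \<le> c * crit_weight (\<alpha> - 2) x"
    and b: "bdry_le v \<phi> (crit_weight (\<alpha> - 2)) \<beta> P"
  shows "tail_le v osc0 (2 * c * P)"
proof (rule tail_le_of_bdry_le[OF _ _ b])
  fix r :: real and f w assume a: "0 \<le> r" "r < 1" "f \<in> zyg_unit_ball \<alpha>" "1/2 \<le> cmod w" "cmod w < 1"
  have "osc0 r f w \<le> cmod (f w) + cmod (f (of_real r * w))"
    unfolding osc0_def by (rule norm_triangle_ineq4)
  also have "\<dots> \<le> c * crit_weight (\<alpha> - 2) (cmod w) + c * crit_weight (\<alpha> - 2) (cmod w)"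
    using dilate_le[OF a(1,2)] by (intro add_mono c(2)[rule_format] a) auto
  finally show "osc0 r f w \<le> 2 * c * crit_weight (\<alpha> - 2) (cmod w)" by simp
qed (use c in auto)

lemma tail_value_small:
  assumes "\<alpha> < 2"
  shows "tail_le v osc0 0"
proof (rule coeff_bounded, rule zyg_value_holder[OF alpha_pos assms])
  fix M C q :: real
  assume M: "\<And>z. z \<in> unit_disc \<Longrightarrow> wv z \<le> M" and q: "0 < q"
    and C: "\<And>f r w. f \<in> zyg_unit_ball \<alpha> \<Longrightarrow> 0 \<le> r \<Longrightarrow> r \<le> 1 \<Longrightarrow> w \<in> unit_disc \<Longrightarrow>
      cmod (f w - f (of_real r * w)) \<le> C * (1 - r) powr q"
  show ?thesis
    by (rule tail_le_of_uniform[OF _ q M, of _ C]) (auto simp: osc0_def intro!: C)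
qed

lemma tail_deriv_small:
  assumes \<alpha>: "\<alpha> < 1"
  shows "tail_le u osc1 0"
proof (rule coeff_bounded)
  fix M assume M: "\<And>z. z \<in> unit_disc \<Longrightarrow> wu z \<le> M"
  let ?H = "1 / (1 - \<alpha>)"
  show ?thesis
  proof (rule tail_le_of_uniform[OF _ _ M])
    fix r :: real and f w assume a: "0 \<le> r" "r < 1" "f \<in> zyg_unit_ball \<alpha>" "cmod w < 1"
    have f': "f \<in> zygmund \<alpha>" "zyg_norm \<alpha> f \<le> 1" using a(3) by (auto simp: zyg_unit_ball_def)
    have rw: "of_real r * w \<in> unit_disc" using dilate_le[OF a(1,2), of w] a(4) by simp
    have "cmod (deriv f (of_real r * w)) \<le> cmod (deriv f 0) + cmod (deriv f (of_real r * w) - deriv f 0)"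
      using norm_triangle_ineq[of "deriv f 0" "deriv f (of_real r * w) - deriv f 0"] by simp
    also have "\<dots> \<le> 1 + ?H"
      using zyg_deriv_holder[OF alpha_pos \<alpha> a(3), of 0, OF _ _ rw] zyg_norm_bounds(2)[OF f'(1)] f'(2) by simp
    finally have 1: "cmod (deriv f (of_real r * w)) \<le> 1 + ?H" .
    have "1 - r = (1 - r) powr 1" using a by simp
    also have "\<dots> \<le> (1 - r) powr (1 - \<alpha>)" using a alpha_pos by (intro powr_mono') auto
    finally have 2: "1 - r \<le> (1 - r) powr (1 - \<alpha>)" .
    have "osc1 r f w = cmod ((deriv f w - deriv f (of_real r * w)) + of_real (1 - r) * deriv f (of_real r * w))"
      by (simp add: osc1_def algebra_simps)
    also have "\<dots> \<le> cmod (deriv f w - deriv f (of_real r * w)) + (1 - r) * cmod (deriv f (of_real r * w))"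
      using norm_triangle_ineq[of "deriv f w - deriv f (of_real r * w)" "of_real (1 - r) * deriv f (of_real r * w)"]
        a(2) by (simp only: norm_mult norm_of_real abs_of_pos diff_gt_0_iff_gt)
    also have "\<dots> \<le> ?H * (1 - r) powr (1 - \<alpha>) + (1 - r) powr (1 - \<alpha>) * (1 + ?H)"
      using zyg_deriv_holder[OF alpha_pos \<alpha> a(3), of r w] a 1 2 by (intro add_mono mult_mono) auto
    finally show "osc1 r f w \<le> (1 + 2 * ?H) * (1 - r) powr (1 - \<alpha>)" by (simp add: algebra_simps)
  qed (use \<alpha> in auto)
qed

lemma ess_norm_nonneg: "0 \<le> ess_norm \<alpha> \<beta> T"
  unfolding ess_norm_def
proof (rule INF_greatest)
  fix K assume "K \<in> {K. compact_op \<alpha> \<beta> K}"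
  then have K: "K f \<in> zygmund \<beta>" if "f \<in> zygmund \<alpha>" for f
    using that by (auto simp: compact_op_def linear_op_def)
  have z: "(\<lambda>z. 0) \<in> zyg_unit_ball \<alpha>"
    using zygmund_zero[of \<alpha>] by (auto simp: zyg_unit_ball_def)
  have "0 \<le> zyg_norm \<beta> (\<lambda>z. T (\<lambda>z. 0) z + K (\<lambda>z. 0) z)"
    using zygmund_zero(1)[of \<alpha>] by (intro zyg_norm_bounds(3) zygmund_add T_in K)
  moreover have "ereal (zyg_norm \<beta> (\<lambda>z. T (\<lambda>z. 0) z + K (\<lambda>z. 0) z)) \<le> op_norm \<alpha> \<beta> (\<lambda>f z. T f z + K f z)"
    unfolding op_norm_def by (rule SUP_upper[OF z])
  ultimately show "0 \<le> op_norm \<alpha> \<beta> (\<lambda>f z. T f z + K f z)"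
    by (intro order_trans[OF _ \<open>ereal _ \<le> _\<close>]) simp
qed

section \<open>Eliminating the compact perturbation\<close>

text \<open>If the bound failed, there would be points \<open>z n\<close> with \<open>|\<phi>(z n)| \<rightarrow> 1\<close> violating it. By compactness of
  \<open>K\<close> a subsequence of \<open>K (F (\<phi> (z n)))\<close> is Cauchy, hence \<open>T\<close> maps differences of two late members to
  functions of norm at most \<open>2 B E\<close> plus a small error. Fixing the earlier member and letting the later
  one run, the earlier one no longer contributes at the later point, by the assumption \<open>small\<close>. The
  factor \<open>2\<close> comes from taking differences.\<close>

lemma test_family_bound:
  assumes K: "compact_op \<alpha> \<beta> K" and E: "op_norm \<alpha> \<beta> (\<lambda>f z. T f z + K f z) \<le> ereal E"
    and s0: "s0 < 1" and B: "0 < B"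
    and F: "\<And>a. s0 < cmod a \<Longrightarrow> cmod a < 1 \<Longrightarrow> F a \<in> zygmund \<alpha> \<and> zyg_norm \<alpha> (F a) \<le> B"
    and small: "\<And>\<epsilon>. 0 < \<epsilon> \<Longrightarrow> \<exists>s<1. \<forall>a. s < cmod a \<and> cmod a < 1 \<longrightarrow> (\<exists>s'<1. \<forall>z\<in>unit_disc. s' < cmod (\<phi> z) \<longrightarrow>
      std_weight \<beta> z * cmod (deriv (F a) (\<phi> z) * u z + F a (\<phi> z) * v z) \<le> \<epsilon>)"
    and \<delta>: "0 < \<delta>"
  shows "\<exists>s<1. \<forall>z\<in>unit_disc. s < cmod (\<phi> z) \<longrightarrow>
    std_weight \<beta> z * cmod (deriv (F (\<phi> z)) (\<phi> z) * u z + F (\<phi> z) (\<phi> z) * v z) \<le> 2 * B * E + \<delta>"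
proof (rule ccontr)
  assume neg: "\<not> ?thesis"
  define val where "val a z = std_weight \<beta> z * cmod (deriv (F a) (\<phi> z) * u z + F a (\<phi> z) * v z)" for a z
  have ex: "\<exists>z\<in>unit_disc. s < cmod (\<phi> z) \<and> 2 * B * E + \<delta> < val (\<phi> z) z" if "s < 1" for s
    using neg that unfolding val_def by (auto simp: not_le)
  define sn where "sn n = max s0 (1 - 1 / (real n + 1))" for n :: nat
  have "\<forall>n. \<exists>z. z \<in> unit_disc \<and> sn n < cmod (\<phi> z) \<and> 2 * B * E + \<delta> < val (\<phi> z) z"
    using ex[of "sn _"] s0 by (auto simp: sn_def Bex_def)
  then obtain z where z: "\<And>n. z n \<in> unit_disc" "\<And>n. sn n < cmod (\<phi> (z n))"
    "\<And>n. 2 * B * E + \<delta> < val (\<phi> (z n)) (z n)" by metis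
  define a where "a n = \<phi> (z n)" for n
  have a: "cmod (a n) < 1" "s0 < cmod (a n)" "1 - 1 / (real n + 1) < cmod (a n)" for n
    using z(1,2)[of n] phi_in[of "z n"] by (auto simp: a_def sn_def)
  have a_lim: "\<exists>N. \<forall>n\<ge>N. s < cmod (a n)" if "s < 1" for s
  proof -
    obtain N where N: "1 / (1 - s) < real N" using reals_Archimedean2 by blast
    have "s < cmod (a n)" if "N \<le> n" for n
    proof -
      have "1 / (1 - s) < real n + 1" using N that by linarith
      then have "1 / (real n + 1) < 1 - s" using \<open>s < 1\<close> by (simp add: field_simps)
      then show ?thesis using a(3)[of n] by linarith
    qed
    then show ?thesis by blast
  qed
  have FZ: "F (a n) \<in> zygmund \<alpha>" "zyg_norm \<alpha> (F (a n)) \<le> B" for n using F[OF a(2,1)] by auto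
  (* scaled into the unit ball, where K is compact and T + K is bounded by E *)
  define p where "p n = (\<lambda>w. of_real (1 / B) * F (a n) w)" for n
  have p: "p n \<in> zyg_unit_ball \<alpha>" for n
  proof -
    have "zyg_norm \<alpha> (p n) \<le> (1 / B) * zyg_norm \<alpha> (F (a n))"
      unfolding p_def using zyg_norm_scale[OF FZ(1), of "of_real (1 / B)" n] B by (simp add: norm_divide)
    also have "\<dots> \<le> 1" using FZ(2)[of n] B by (simp add: field_simps)
    finally show ?thesis using zygmund_scale[OF FZ(1)] unfolding zyg_unit_ball_def p_def by blast
  qed
  then have pz: "p n \<in> zygmund \<alpha>" for n by (auto simp: zyg_unit_ball_def)
  have K_in: "K f \<in> zygmund \<beta>" if "f \<in> zygmund \<alpha>" for f
    using K that by (auto simp: compact_op_def linear_op_def)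
  have TK: "zyg_norm \<beta> (\<lambda>z. T (p n) z + K (p n) z) \<le> E" for n
  proof -
    have "ereal (zyg_norm \<beta> (\<lambda>z. T (p n) z + K (p n) z)) \<le> op_norm \<alpha> \<beta> (\<lambda>f z. T f z + K f z)"
      unfolding op_norm_def by (rule SUP_upper[OF p])
    also note E
    finally show ?thesis by simp
  qed
  interpret Z: Metric_space "zygmund \<beta>" "zyg_dist \<beta>" by (rule Metric_space_zygmund)
  define \<eta> where "\<eta> = \<delta> / (8 * B)"
  have \<eta>: "0 < \<eta>" "B * (2 * \<eta>) = \<delta> / 4" using \<delta> B by (auto simp: \<eta>_def)
  let ?CL = "zyg_topology \<beta> closure_of (K ` zyg_unit_ball \<alpha>)"
  have "range (\<lambda>n. K (p n)) \<subseteq> K ` zyg_unit_ball \<alpha>" using p by auto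
  also have "\<dots> \<subseteq> ?CL" using K_in by (intro closure_of_subset) (auto simp: zyg_unit_ball_def)
  finally have rng: "range (\<lambda>n. K (p n)) \<subseteq> ?CL" .
  have "compactin (zyg_topology \<beta>) ?CL" using K by (simp add: compact_op_def)
  then obtain l k where k: "strict_mono (k :: nat \<Rightarrow> nat)"
    "limitin (zyg_topology \<beta>) ((\<lambda>n. K (p n)) \<circ> k) l sequentially"
    unfolding Z.compactin_sequentially using rng by metis
  then obtain N where l: "l \<in> zygmund \<beta>" and N: "\<And>n. N \<le> n \<Longrightarrow> zyg_dist \<beta> (K (p (k n))) l < \<eta>"
    unfolding Z.limit_metric_sequentially using \<eta>(1) by (auto simp: o_def) metis
  have K_near: "zyg_norm \<beta> (\<lambda>z. K (p (k n)) z - K (p (k m)) z) \<le> 2 * \<eta>" if "N \<le> n" "N \<le> m" for n m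
  proof -
    have "zyg_dist \<beta> (K (p (k n))) (K (p (k m))) \<le> zyg_dist \<beta> (K (p (k n))) l + zyg_dist \<beta> l (K (p (k m)))"
      using Z.triangle K_in pz l by blast
    also have "\<dots> \<le> 2 * \<eta>" using N[OF that(1)] N[OF that(2)] Z.commute[of l] by simp
    finally show ?thesis using K_in pz by (simp add: zyg_dist_def)
  qed
  have T_near: "zyg_norm \<beta> (T (\<lambda>z. p (k n) z - p (k m) z)) \<le> 2 * E + 2 * \<eta>" if "N \<le> n" "N \<le> m" for n m
  proof -
    let ?TK = "\<lambda>n z. T (p (k n)) z + K (p (k n)) z"
    have in1: "?TK n \<in> zygmund \<beta>" for n by (intro zygmund_add T_in K_in pz)
    have "T (\<lambda>z. p (k n) z - p (k m) z) = (\<lambda>z. (?TK n z - ?TK m z) - (K (p (k n)) z - K (p (k m)) z))"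
      unfolding T_diff[OF pz pz] by (simp add: algebra_simps)
    then have "zyg_norm \<beta> (T (\<lambda>z. p (k n) z - p (k m) z)) \<le>
      zyg_norm \<beta> (\<lambda>z. ?TK n z - ?TK m z) + zyg_norm \<beta> (\<lambda>z. K (p (k n)) z - K (p (k m)) z)"
      by (simp only:) (intro zyg_norm_diff zygmund_diff in1 K_in pz)
    also have "\<dots> \<le> (zyg_norm \<beta> (?TK n) + zyg_norm \<beta> (?TK m)) + 2 * \<eta>"
      by (intro add_mono zyg_norm_diff in1 K_near that)
    also have "\<dots> \<le> 2 * E + 2 * \<eta>" using TK[of "k n"] TK[of "k m"] by simp
    finally show ?thesis .
  qed
  obtain s where s: "s < 1" "\<And>a. s < cmod a \<Longrightarrow> cmod a < 1 \<Longrightarrow> (\<exists>s'<1. \<forall>z\<in>unit_disc. s' < cmod (\<phi> z) \<longrightarrow> val a z \<le> \<delta> / 4)"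
    using small[of "\<delta> / 4"] \<delta> unfolding val_def by (auto simp: mult_ac)
  obtain N1 where N1: "\<And>n. N1 \<le> n \<Longrightarrow> s < cmod (a n)" using a_lim[OF s(1)] by blast
  (* first fix the index m of the early function, then choose n so late that it is negligible at z (k n) *)
  define m where "m = max N N1"
  have km: "n \<le> k n" for n using k(1) by (rule seq_suble)
  have m: "N \<le> m" "s < cmod (a (k m))" using N1[of "k m"] km[of m] by (auto simp: m_def)
  obtain s' where s': "s' < 1" "\<And>z. z \<in> unit_disc \<Longrightarrow> s' < cmod (\<phi> z) \<Longrightarrow> val (a (k m)) z \<le> \<delta> / 4"
    using s(2)[OF m(2) a(1)] by blast
  obtain N2 where N2: "\<And>n. N2 \<le> n \<Longrightarrow> s' < cmod (a n)" using a_lim[OF s'(1)] by blast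
  define n where "n = max N N2"
  have n: "N \<le> n" "s' < cmod (\<phi> (z (k n)))" using N2[of "k n"] km[of n] by (auto simp: n_def a_def)
  let ?z = "z (k n)" and ?an = "a (k n)" and ?am = "a (k m)"
  let ?w = "\<phi> ?z"
  have w: "?w \<in> unit_disc" using phi_in z(1)[of "k n"] by simp
  have W: "0 < std_weight \<beta> ?z" using z(1) by (rule std_weight_pos)
  define h where "h = (\<lambda>z. p (k n) z - p (k m) z)"
  have h: "h \<in> zygmund \<alpha>" unfolding h_def by (intro zygmund_diff pz)
  have H: "deriv h ?w = (deriv (F ?an) ?w - deriv (F ?am) ?w) / of_real B"
  proof -
    have "(F ?an has_field_derivative deriv (F ?an) ?w) (at ?w)" "(F ?am has_field_derivative deriv (F ?am) ?w) (at ?w)"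
      using H_disc_derivs(1)[OF zygmund_hol[OF FZ(1)] w] by auto
    then have "(h has_field_derivative (deriv (F ?an) ?w - deriv (F ?am) ?w) / of_real B) (at ?w)"
      unfolding h_def p_def using B by (auto intro!: derivative_eq_intros simp: diff_divide_distrib)
    then show ?thesis by (rule DERIV_imp_deriv)
  qed
  have h_val: "h ?w = (F ?an ?w - F ?am ?w) / of_real B" by (simp add: h_def p_def diff_divide_distrib)
  let ?Q = "\<lambda>a. deriv (F a) ?w * u ?z + F a ?w * v ?z"
  have "deriv h ?w * u ?z + h ?w * v ?z = (?Q ?an - ?Q ?am) / of_real B"
    unfolding H h_val by (simp add: field_simps diff_divide_distrib add_divide_distrib)
  then have eq: "cmod (?Q ?an - ?Q ?am) = B * cmod (deriv h ?w * u ?z + h ?w * v ?z)"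
    using B by (simp add: norm_divide)
  have "std_weight \<beta> ?z * cmod (deriv h ?w * u ?z + h ?w * v ?z) \<le> 2 * E + 2 * \<eta>"
    using T_norm_ge[OF h z(1)] T_near[OF n(1) m(1)] unfolding h_def by (rule order_trans)
  then have "B * (std_weight \<beta> ?z * cmod (deriv h ?w * u ?z + h ?w * v ?z)) \<le> B * (2 * E + 2 * \<eta>)"
    using B by (intro mult_left_mono) auto
  then have d: "std_weight \<beta> ?z * cmod (?Q ?an - ?Q ?am) \<le> 2 * B * E + \<delta> / 4"
    using \<eta>(2) unfolding eq by (simp add: algebra_simps)
  have "cmod (?Q ?an) \<le> cmod (?Q ?an - ?Q ?am) + cmod (?Q ?am)"
    using norm_triangle_ineq[of "?Q ?an - ?Q ?am" "?Q ?am"] by simp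
  then have "val ?an ?z \<le> std_weight \<beta> ?z * (cmod (?Q ?an - ?Q ?am) + cmod (?Q ?am))"
    unfolding val_def using W by (intro mult_left_mono) auto
  also have "\<dots> = std_weight \<beta> ?z * cmod (?Q ?an - ?Q ?am) + val ?am ?z"
    by (simp add: val_def distrib_left)
  also have "\<dots> \<le> 2 * B * E + \<delta> / 4 + \<delta> / 4" using d s'(2)[OF z(1) n(2)] by linarith
  finally show False using z(3)[of "k n"] \<delta> by (simp add: a_def)
qed

end

section \<open>Test functions\<close>

definition on_disc :: "(complex \<Rightarrow> complex) \<Rightarrow> complex \<Rightarrow> complex" where
  "on_disc f z = (if z \<in> unit_disc then f z else 0)"

text \<open>The factor \<open>2 powr \<alpha>\<close> is the price for replacing \<open>1 - |z|\<^sup>2\<close> by \<open>1 - |z|\<close>.\<close>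

lemma on_disc_zygmund:
  assumes "0 < \<alpha>" and d: "\<And>z. z \<in> unit_disc \<Longrightarrow> (f has_field_derivative f1 z) (at z)"
    "\<And>z. z \<in> unit_disc \<Longrightarrow> (f1 has_field_derivative f2 z) (at z)"
    and B: "\<And>z. z \<in> unit_disc \<Longrightarrow> cmod (f2 z) \<le> B * (1 - cmod z) powr (- \<alpha>)"
  shows "on_disc f \<in> zygmund \<alpha>" "zyg_norm \<alpha> (on_disc f) \<le> cmod (f 0) + cmod (f1 0) + 2 powr \<alpha> * B"
    "z \<in> unit_disc \<Longrightarrow> deriv (on_disc f) z = f1 z"
proof -
  have d': "(on_disc f has_field_derivative f1 z) (at z)" if z: "z \<in> unit_disc" for z
    by (rule has_field_derivative_transform_within_open[OF d(1)[OF z] open_ball z]) (simp add: on_disc_def)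
  have off: "on_disc f z = 0" if "z \<notin> unit_disc" for z using that by (simp add: on_disc_def)
  have b: "std_weight \<alpha> z * cmod (f2 z) \<le> 2 powr \<alpha> * B" if z: "z \<in> unit_disc" for z
  proof -
    have z1: "cmod z < 1" using z by simp
    have "1 - (cmod z)^2 = (1 + cmod z) * (1 - cmod z)" by (simp add: power2_eq_square algebra_simps)
    also have "\<dots> \<le> 2 * (1 - cmod z)" using z1 by (intro mult_right_mono) auto
    finally have "std_weight \<alpha> z \<le> (2 * (1 - cmod z)) powr \<alpha>"
      unfolding std_weight_def using z1 assms(1) by (intro powr_mono2) (auto simp: power_le_one)
    also have "\<dots> = 2 powr \<alpha> * (1 - cmod z) powr \<alpha>" by (rule powr_mult)
    finally have "std_weight \<alpha> z \<le> 2 powr \<alpha> * (1 - cmod z) powr \<alpha>" .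
    then have "std_weight \<alpha> z * cmod (f2 z) \<le> (2 powr \<alpha> * (1 - cmod z) powr \<alpha>) * (B * (1 - cmod z) powr (- \<alpha>))"
      using B[OF z] by (intro mult_mono) auto
    also have "\<dots> = 2 powr \<alpha> * B" using z1 by (simp add: powr_minus field_simps)
    finally show ?thesis .
  qed
  show "on_disc f \<in> zygmund \<alpha>" by (rule zygmundI(1)[OF d' d(2) off b])
  show "zyg_norm \<alpha> (on_disc f) \<le> cmod (f 0) + cmod (f1 0) + 2 powr \<alpha> * B"
  proof -
    have "on_disc f 0 = f 0" by (simp add: on_disc_def)
    then show ?thesis using zygmundI(2)[OF d' d(2) off b] by simp
  qed
  show "z \<in> unit_disc \<Longrightarrow> deriv (on_disc f) z = f1 z" by (rule DERIV_imp_deriv[OF d'])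
qed

text \<open>The reproducing kernel of the Hardy space is \<open>1 / ker a z\<close>. The values \<open>ker a z\<close> stay in
  the right half-plane, where powers and logarithm are analytic, and both \<open>1 - |a|\<close> and \<open>1 - |z|\<close> are
  lower bounds for their moduli.\<close>

definition ker :: "complex \<Rightarrow> complex \<Rightarrow> complex" where
  "ker a z = 1 - cnj a * z"

lemma ker_bounds:
  assumes "cmod a < 1" "cmod z < 1"
  shows "1 - cmod a \<le> cmod (ker a z)" "1 - cmod z \<le> cmod (ker a z)" "cmod (ker a z) \<le> 2"
    "ker a z \<noteq> 0" "ker a z \<notin> \<real>\<^sub>\<le>\<^sub>0"
proof -
  have m: "cmod (cnj a * z) \<le> cmod a" "cmod (cnj a * z) \<le> cmod z"
    using assms by (auto simp: norm_mult intro: mult_left_le_one_le mult_right_le_one_le)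
  have t: "1 - cmod (cnj a * z) \<le> cmod (ker a z)" "cmod (ker a z) \<le> 1 + cmod (cnj a * z)"
    unfolding ker_def using norm_triangle_ineq2[of 1 "cnj a * z"] norm_triangle_ineq4[of 1 "cnj a * z"] by auto
  show "1 - cmod a \<le> cmod (ker a z)" "1 - cmod z \<le> cmod (ker a z)" "cmod (ker a z) \<le> 2"
    using m t assms by auto
  have "Re (cnj a * z) \<le> cmod (cnj a * z)" by (rule complex_Re_le_cmod)
  then have "0 < Re (ker a z)" using m assms by (simp add: ker_def)
  then show "ker a z \<notin> \<real>\<^sub>\<le>\<^sub>0" "ker a z \<noteq> 0" by (auto simp: complex_nonpos_Reals_iff)
qed

lemma ker_at_point: "ker a a = of_real (1 - (cmod a)^2)"
  using complex_norm_square[of a] by (simp add: ker_def mult.commute)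

lemma one_minus_square_bounds:
  fixes x :: real
  assumes "0 \<le> x" "x < 1"
  shows "1 - x \<le> 1 - x^2" "1 - x^2 \<le> 2 * (1 - x)" "0 < 1 - x^2" "1 - x^2 \<le> 1"
proof -
  have "x^2 \<le> x" using assms by (simp add: power2_eq_square mult_left_le_one_le)
  then show "1 - x \<le> 1 - x^2" "0 < 1 - x^2" using assms by auto
  have "0 \<le> (1 - x)^2" by simp
  then show "1 - x^2 \<le> 2 * (1 - x)" by (simp add: power2_eq_square algebra_simps)
qed simp

definition kpow :: "complex \<Rightarrow> real \<Rightarrow> complex \<Rightarrow> complex" where
  "kpow a s z = ker a z powr of_real s"

lemma kpow_deriv:
  assumes "cmod a < 1" "cmod z < 1"
  shows "(kpow a s has_field_derivative - of_real s * cnj a * kpow a (s - 1) z) (at z)"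
proof -
  have "(ker a has_field_derivative - cnj a) (at z)"
    unfolding ker_def[abs_def] by (auto intro!: derivative_eq_intros)
  from DERIV_chain2[OF has_field_derivative_powr[OF ker_bounds(5)[OF assms], of "of_real s"] this]
  show ?thesis unfolding kpow_def[abs_def] by (simp add: mult_ac)
qed

lemma norm_kpow: "cmod (kpow a s z) = cmod (ker a z) powr s"
  unfolding kpow_def by (simp add: norm_powr_real_powr')

lemma kpow_at_point: "cmod a < 1 \<Longrightarrow> kpow a s a = of_real ((1 - (cmod a)^2) powr s)"
  unfolding kpow_def ker_at_point using one_minus_square_bounds(3)[of "cmod a"]
  by (subst powr_of_real) auto

text \<open>The factor \<open>1 - |a|\<^sup>2\<close> is at most \<open>2 |ker a z|\<close> and at most \<open>2 (1 - |a|)\<close>. The first gives a bound that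
  is uniform in \<open>a\<close>, the second one that is uniform in \<open>z\<close>.\<close>

lemma scaled_kpow_le:
  fixes j :: nat
  assumes a: "cmod a < 1" and z: "cmod z < 1"
  shows "real j \<le> s \<Longrightarrow> (1 - (cmod a)^2) ^ j * cmod (kpow a (- s) z) \<le> 2 ^ j * (1 - cmod z) powr (real j - s)"
    "0 \<le> s \<Longrightarrow> (1 - (cmod a)^2) ^ j * cmod (kpow a (- s) z) \<le> 2 ^ j * (1 - cmod a) powr (real j - s)"
proof -
  let ?t = "cmod (ker a z)"
  note k = ker_bounds[OF a z]
  have t: "0 < ?t" using k(4) by simp
  note d = one_minus_square_bounds[of "cmod a"]
  have d_le: "1 - (cmod a)^2 \<le> 2 * (1 - cmod a)" "1 - (cmod a)^2 \<le> 2 * ?t" using d(2) a k(1) by simp_all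
  show "(1 - (cmod a)^2) ^ j * cmod (kpow a (- s) z) \<le> 2 ^ j * (1 - cmod z) powr (real j - s)" if s: "real j \<le> s"
  proof -
    have "(1 - (cmod a)^2) ^ j \<le> (2 * ?t) ^ j" using d(3) d_le a by (intro power_mono) auto
    then have "(1 - (cmod a)^2) ^ j * cmod (kpow a (- s) z) \<le> (2 * ?t) ^ j * ?t powr (- s)"
      unfolding norm_kpow by (intro mult_right_mono) auto
    also have "\<dots> = 2 ^ j * ?t powr (real j - s)"
      using t by (simp add: power_mult_distrib powr_realpow[symmetric] powr_add[symmetric])
    also have "\<dots> \<le> 2 ^ j * (1 - cmod z) powr (real j - s)"
      using k(2) z s by (intro mult_left_mono powr_mono2') auto
    finally show ?thesis .
  qed
  show "(1 - (cmod a)^2) ^ j * cmod (kpow a (- s) z) \<le> 2 ^ j * (1 - cmod a) powr (real j - s)" if s: "0 \<le> s"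
  proof -
    have "(1 - (cmod a)^2) ^ j * cmod (kpow a (- s) z) \<le> (2 * (1 - cmod a)) ^ j * (1 - cmod a) powr (- s)"
      unfolding norm_kpow using d(3) d_le a k(1) s
      by (intro mult_mono power_mono powr_mono2') auto
    also have "\<dots> = 2 ^ j * (1 - cmod a) powr (real j - s)"
    proof -
      have "(1 - cmod a) ^ j = (1 - cmod a) powr real j" using a by (simp add: powr_realpow)
      then have "(1 - cmod a) ^ j * (1 - cmod a) powr (- s) = (1 - cmod a) powr (real j - s)"
        by (simp add: powr_add[symmetric])
      then show ?thesis by (simp only: power_mult_distrib mult.assoc)
    qed
    finally show ?thesis .
  qed
qed

text \<open>The norms are bounded uniformly in \<open>a\<close>, whereas the sup norms of \<open>F a\<close> and its derivative need only
  be finite for each \<open>a\<close>.\<close>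

definition test_family :: "real \<Rightarrow> real \<Rightarrow> real \<Rightarrow> (complex \<Rightarrow> complex \<Rightarrow> complex) \<Rightarrow> bool" where
  "test_family \<alpha> s0 B F \<longleftrightarrow> s0 < 1 \<and> 0 < B \<and> (\<forall>a. s0 < cmod a \<and> cmod a < 1 \<longrightarrow>
     F a \<in> zygmund \<alpha> \<and> zyg_norm \<alpha> (F a) \<le> B \<and>
     (\<exists>C. \<forall>z\<in>unit_disc. cmod (F a z) \<le> C \<and> cmod (deriv (F a) z) \<le> C))"

text \<open>The relation between \<open>j\<close> and \<open>s\<close> is the one that makes the second derivative at most of order
  \<open>(1 - |z|) powr (- \<alpha>)\<close>, uniformly in \<open>a\<close>. Value and derivative at \<open>a\<close> then have the orders
  \<open>(1 - |a|) powr (2 - \<alpha>)\<close> and, for \<open>s > 0\<close>, \<open>(1 - |a|) powr (1 - \<alpha>)\<close>.\<close>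

lemma kernel_family:
  fixes \<alpha> :: real and j :: nat and s :: real
  assumes \<alpha>: "0 < \<alpha>" and s: "s = real j + \<alpha> - 2" "0 \<le> s"
  defines "P \<equiv> \<lambda>a. on_disc (\<lambda>z. of_real ((1 - (cmod a)^2) ^ j) * kpow a (- s) z)"
  assumes a: "cmod a < 1"
  shows "P a \<in> zygmund \<alpha>" "zyg_norm \<alpha> (P a) \<le> 1 + \<bar>s\<bar> + 2 powr \<alpha> * (\<bar>s\<bar> * \<bar>s + 1\<bar> * 2 ^ j)"
    "z \<in> unit_disc \<Longrightarrow> deriv (P a) z = of_real (s * (1 - (cmod a)^2) ^ j) * cnj a * kpow a (- s - 1) z"
    "z \<in> unit_disc \<Longrightarrow> cmod (deriv (P a) z) \<le> \<bar>s\<bar> * 2 ^ j * (1 - cmod a) powr (1 - \<alpha>)"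
    "z \<in> unit_disc \<Longrightarrow> cmod (P a z) \<le> 2 ^ j * (1 - cmod a) powr (2 - \<alpha>)"
    "P a a = of_real ((1 - (cmod a)^2) powr (2 - \<alpha>))"
    "deriv (P a) a = of_real (s * (1 - (cmod a)^2) powr (1 - \<alpha>)) * cnj a"
proof -
  define d where "d = 1 - (cmod a)^2"
  have d: "0 < d" "d \<le> 1" using one_minus_square_bounds[of "cmod a"] a by (auto simp: d_def)
  let ?f = "\<lambda>z. of_real (d ^ j) * kpow a (- s) z"
  let ?f1 = "\<lambda>z. of_real (s * d ^ j) * cnj a * kpow a (- s - 1) z"
  let ?f2 = "\<lambda>z. of_real (s * (s + 1) * d ^ j) * (cnj a)^2 * kpow a (- s - 2) z"
  have d1: "(?f has_field_derivative ?f1 z) (at z)" if "z \<in> unit_disc" for z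
    using DERIV_cmult[OF kpow_deriv[of a z "- s"], of "of_real (d ^ j)"] a that by (simp add: mult_ac)
  have d2: "(?f1 has_field_derivative ?f2 z) (at z)" if "z \<in> unit_disc" for z
    using DERIV_cmult[OF kpow_deriv[of a z "- s - 1"], of "of_real (s * d ^ j) * cnj a"] a that
    by (simp add: power2_eq_square algebra_simps)
  have b: "cmod (?f2 z) \<le> (\<bar>s\<bar> * \<bar>s + 1\<bar> * 2 ^ j) * (1 - cmod z) powr (- \<alpha>)" if z: "z \<in> unit_disc" for z
  proof -
    have "d ^ j * cmod (kpow a (- (s + 2)) z) \<le> 2 ^ j * (1 - cmod z) powr (real j - (s + 2))"
      unfolding d_def using scaled_kpow_le(1)[OF a, of z j "s + 2"] z s \<alpha> by simp
    moreover have "- (s + 2) = - s - 2" "real j - (s + 2) = - \<alpha>" using s(1) by auto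
    ultimately have 1: "d ^ j * cmod (kpow a (- s - 2) z) \<le> 2 ^ j * (1 - cmod z) powr (- \<alpha>)" by (simp only:)
    have "cmod (?f2 z) = (\<bar>s\<bar> * \<bar>s + 1\<bar> * (cmod a)^2) * (d ^ j * cmod (kpow a (- s - 2) z))"
      using d by (simp add: norm_mult norm_power abs_mult del: of_real_mult)
    also have "\<dots> \<le> (\<bar>s\<bar> * \<bar>s + 1\<bar> * 1) * (2 ^ j * (1 - cmod z) powr (- \<alpha>))"
      using a d by (intro mult_mono[OF mult_left_mono 1]) (auto simp: power_le_one)
    finally show ?thesis by (simp add: mult_ac)
  qed
  have P: "P a = on_disc ?f" by (simp add: P_def d_def)
  note Z = on_disc_zygmund[OF \<alpha> d1 d2 b]
  show "P a \<in> zygmund \<alpha>" unfolding P by (rule Z(1))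
  have "cmod (?f 0) \<le> 1" using d by (simp add: norm_mult norm_kpow ker_def power_le_one norm_power)
  moreover have "cmod (?f1 0) \<le> \<bar>s\<bar>"
  proof -
    have "cmod (?f1 0) = \<bar>s\<bar> * (d ^ j * cmod a)"
      using d by (simp add: norm_mult norm_kpow ker_def norm_power abs_mult del: of_real_mult)
    also have "\<dots> \<le> \<bar>s\<bar> * (1 * 1)" using d a by (intro mult_mono) (auto simp: power_le_one)
    finally show ?thesis by simp
  qed
  ultimately show "zyg_norm \<alpha> (P a) \<le> 1 + \<bar>s\<bar> + 2 powr \<alpha> * (\<bar>s\<bar> * \<bar>s + 1\<bar> * 2 ^ j)"
    using Z(2) unfolding P by linarith
  show D: "deriv (P a) z = of_real (s * (1 - (cmod a)^2) ^ j) * cnj a * kpow a (- s - 1) z" if "z \<in> unit_disc" for z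
    unfolding P using Z(3)[of z] that by (simp add: d_def)
  show "cmod (deriv (P a) z) \<le> \<bar>s\<bar> * 2 ^ j * (1 - cmod a) powr (1 - \<alpha>)" if z: "z \<in> unit_disc"
  proof -
    have "d ^ j * cmod (kpow a (- (s + 1)) z) \<le> 2 ^ j * (1 - cmod a) powr (real j - (s + 1))"
      unfolding d_def using scaled_kpow_le(2)[OF a, of z "s + 1" j] z s by simp
    moreover have "- (s + 1) = - s - 1" "real j - (s + 1) = 1 - \<alpha>" using s(1) by auto
    ultimately have 1: "d ^ j * cmod (kpow a (- s - 1) z) \<le> 2 ^ j * (1 - cmod a) powr (1 - \<alpha>)" by (simp only:)
    have "cmod (deriv (P a) z) = (\<bar>s\<bar> * cmod a) * (d ^ j * cmod (kpow a (- s - 1) z))"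
      using d unfolding D[OF z] d_def[symmetric] by (simp add: norm_mult norm_power abs_mult del: of_real_mult)
    also have "\<dots> \<le> (\<bar>s\<bar> * 1) * (2 ^ j * (1 - cmod a) powr (1 - \<alpha>))"
      using a d by (intro mult_mono[OF mult_left_mono 1]) auto
    finally show ?thesis by (simp add: mult_ac)
  qed
  show "cmod (P a z) \<le> 2 ^ j * (1 - cmod a) powr (2 - \<alpha>)" if z: "z \<in> unit_disc"
  proof -
    have "cmod (P a z) = d ^ j * cmod (kpow a (- s) z)"
      using d z by (simp add: P on_disc_def norm_mult norm_power)
    also have "\<dots> \<le> 2 ^ j * (1 - cmod a) powr (real j - s)"
      unfolding d_def using scaled_kpow_le(2)[OF a, of z s j] z s by simp
    finally show ?thesis using s(1) by simp
  qed
  have pw: "d ^ j * d powr (- s) = d powr (2 - \<alpha>)" "d ^ j * d powr (- s - 1) = d powr (1 - \<alpha>)"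
    using d s(1) by (simp_all add: powr_realpow[symmetric] powr_add[symmetric])
  show "P a a = of_real ((1 - (cmod a)^2) powr (2 - \<alpha>))"
    using a pw(1) by (simp add: P on_disc_def kpow_at_point flip: d_def of_real_mult of_real_power)
  show "deriv (P a) a = of_real (s * (1 - (cmod a)^2) powr (1 - \<alpha>)) * cnj a"
    using a pw(2) D[of a] by (simp add: kpow_at_point mult_ac flip: d_def of_real_mult of_real_power)
qed

lemma test_familyI:
  assumes "s0 < 1" "0 < B"
    "\<And>a. s0 < cmod a \<Longrightarrow> cmod a < 1 \<Longrightarrow> F a \<in> zygmund \<alpha>"
    "\<And>a. s0 < cmod a \<Longrightarrow> cmod a < 1 \<Longrightarrow> zyg_norm \<alpha> (F a) \<le> B"
    "\<And>a z. s0 < cmod a \<Longrightarrow> cmod a < 1 \<Longrightarrow> z \<in> unit_disc \<Longrightarrow> cmod (F a z) \<le> C0 a"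
    "\<And>a z. s0 < cmod a \<Longrightarrow> cmod a < 1 \<Longrightarrow> z \<in> unit_disc \<Longrightarrow> cmod (deriv (F a) z) \<le> C1 a"
  shows "test_family \<alpha> s0 B F"
  unfolding test_family_def
proof (intro conjI allI impI)
  fix a assume a: "s0 < cmod a \<and> cmod a < 1"
  show "\<exists>C. \<forall>z\<in>unit_disc. cmod (F a z) \<le> C \<and> cmod (deriv (F a) z) \<le> C"
    using assms(5,6)[of a] a by (intro exI[of _ "max (C0 a) (C1 a)"]) (auto simp: le_max_iff_disj)
qed (use assms in auto)

text \<open>The modulus of the kernel lies between \<open>1 - |a|\<close> and \<open>2\<close> and its argument is bounded, so its
  logarithm is at most of the order of \<open>L = ln (1 / (1 - |a|))\<close>.\<close>

lemma Ln_ker_bounds: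
  assumes a: "1/2 \<le> cmod a" "cmod a < 1" and z: "cmod z < 1"
  defines "L \<equiv> crit_weight 0 (cmod a)"
  shows "cmod (Ln (ker a z)) \<le> 9 * L" "cmod (Ln (ker a z)) \<le> \<bar>ln (cmod (ker a z))\<bar> + 4"
proof -
  note k = ker_bounds[OF a(2) z]
  let ?t = "cmod (ker a z)"
  have t: "0 < ?t" using k(4) by simp
  have L: "1/2 \<le> L" unfolding L_def by (rule crit_weight_log_ge[OF a])
  have im: "\<bar>Im (Ln (ker a z))\<bar> \<le> 4"
    using mpi_less_Im_Ln[OF k(4)] Im_Ln_le_pi[OF k(4)] pi_less_4 by linarith
  have "cmod (Ln (ker a z)) \<le> \<bar>Re (Ln (ker a z))\<bar> + \<bar>Im (Ln (ker a z))\<bar>" by (rule cmod_le)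
  also have "Re (Ln (ker a z)) = ln ?t" using k(4) by (rule Re_Ln)
  finally show *: "cmod (Ln (ker a z)) \<le> \<bar>ln ?t\<bar> + 4" using im by linarith
  have "ln (1 - cmod a) \<le> ln ?t" using k(1) a by (subst ln_le_cancel_iff) (use t in auto)
  moreover have "ln ?t \<le> ln 2" using k(3) t by (subst ln_le_cancel_iff) auto
  moreover have "ln 2 \<le> L"
  proof -
    have "ln (1 - cmod a) \<le> ln (1/2)" using a by (subst ln_le_cancel_iff) auto
    then show ?thesis using a by (simp add: L_def crit_weight_def ln_div)
  qed
  moreover have "ln (1 - cmod a) = - L" using a by (simp add: L_def crit_weight_def ln_div)
  ultimately have "\<bar>ln ?t\<bar> \<le> L" by linarith
  then show "cmod (Ln (ker a z)) \<le> 9 * L" using * L by linarith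
qed

lemma Ln_ker_at_point:
  assumes a: "3/4 \<le> cmod a" "cmod a < 1"
  shows "crit_weight 0 (cmod a) / 2 \<le> cmod (Ln (ker a a))"
    "Ln (ker a a) = of_real (ln (1 - (cmod a)^2))"
proof -
  define L where "L = crit_weight 0 (cmod a)"
  note d = one_minus_square_bounds[of "cmod a"]
  show eq: "Ln (ker a a) = of_real (ln (1 - (cmod a)^2))"
    unfolding ker_at_point using d(3) a by (intro Ln_of_real) auto
  have "ln (1 - (cmod a)^2) \<le> ln (2 * (1 - cmod a))" using d a by (subst ln_le_cancel_iff) auto
  also have "\<dots> = ln 2 + ln (1 - cmod a)" using a by (intro ln_mult_pos) auto
  also have "\<dots> = ln 2 - L" using a by (simp add: L_def crit_weight_def ln_div)
  finally have 1: "ln (1 - (cmod a)^2) \<le> ln 2 - L" .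
  have "ln 4 \<le> ln (1 / (1 - cmod a))" using a by (subst ln_le_cancel_iff) (auto simp: field_simps)
  then have "ln 4 \<le> L" by (simp only: L_def crit_weight_def if_True refl)
  moreover have "ln (4::real) = 2 * ln 2" using ln_realpow[of "2::real" 2] by simp
  ultimately have "ln 2 \<le> L / 2" by simp
  then have "ln (1 - (cmod a)^2) \<le> - L / 2" using 1 by linarith
  then show "crit_weight 0 (cmod a) / 2 \<le> cmod (Ln (ker a a))"
    unfolding eq L_def[symmetric] by simp
qed

lemma ker_deriv: "(ker a has_field_derivative - cnj a) (at z)"
  unfolding ker_def[abs_def] by (auto intro!: derivative_eq_intros)

lemma Ln_ker_deriv:
  assumes "cmod a < 1" "cmod z < 1"
  shows "((\<lambda>z. Ln (ker a z)) has_field_derivative - cnj a / ker a z) (at z)"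
  using DERIV_chain2[OF has_field_derivative_Ln[OF ker_bounds(5)[OF assms]] ker_deriv[of a z]]
  by (simp add: divide_inverse mult_ac)

text \<open>The square root of \<open>t\<close> already beats the logarithm.\<close>

lemma log_square_bounded:
  fixes t :: real
  assumes "0 < t" "t \<le> 2"
  shows "t * (\<bar>ln t\<bar> + 6)^2 \<le> 144"
proof -
  have "sqrt t \<le> sqrt ((3/2)^2)" using assms by (intro real_sqrt_le_mono) (auto simp: power2_eq_square)
  then have s: "0 < sqrt t" "sqrt t \<le> 3/2" using assms by auto
  have "sqrt t * \<bar>ln t\<bar> \<le> 3"
  proof (cases "t \<le> 1")
    case True
    have "ln (1 / sqrt t) \<le> 1 / sqrt t - 1" using s by (intro ln_le_minus_one) auto
    then have "- ln t / 2 \<le> 1 / sqrt t" using s assms by (simp add: ln_div ln_sqrt)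
    then have "sqrt t * (- ln t) \<le> 2" using s by (simp add: field_simps)
    then show ?thesis using True assms by (simp add: abs_of_nonpos)
  next
    case False
    then have "\<bar>ln t\<bar> \<le> 1" using ln_le_minus_one[of t] assms by auto
    then have "sqrt t * \<bar>ln t\<bar> \<le> 3/2 * 1" using s by (intro mult_mono) auto
    then show ?thesis by simp
  qed
  then have "sqrt t * (\<bar>ln t\<bar> + 6) \<le> 12" using s by (simp add: distrib_left)
  then have "(sqrt t * (\<bar>ln t\<bar> + 6))^2 \<le> 12^2" using s by (intro power_mono) auto
  then show ?thesis using assms by (simp add: power_mult_distrib)
qed

lemma crit_weight_square_le:
  fixes x :: real
  assumes "0 \<le> \<gamma>" "0 \<le> x" "x < 1"
  shows "2 powr (- \<gamma>) * (1 - x) powr (- \<gamma>) \<le> (1 - x^2) powr (- \<gamma>)"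
    "(1 - x^2) powr (- \<gamma>) \<le> (1 - x) powr (- \<gamma>)"
proof -
  note d = one_minus_square_bounds[OF assms(2,3)]
  have "2 powr (- \<gamma>) * (1 - x) powr (- \<gamma>) = (2 * (1 - x)) powr (- \<gamma>)" by (rule powr_mult[symmetric])
  also have "\<dots> \<le> (1 - x^2) powr (- \<gamma>)" using d assms by (intro powr_mono2') auto
  finally show "2 powr (- \<gamma>) * (1 - x) powr (- \<gamma>) \<le> (1 - x^2) powr (- \<gamma>)" .
  show "(1 - x^2) powr (- \<gamma>) \<le> (1 - x) powr (- \<gamma>)" using d assms by (intro powr_mono2') auto
qed

text \<open>Uniform convergence to \<open>0\<close> as \<open>|a| \<rightarrow> 1\<close>. It replaces the decay of the weighted \<open>v\<close>, which
  boundedness of \<open>T\<close> forces only for \<open>\<alpha> \<ge> 2\<close>.\<close>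

definition vanishing_family :: "(complex \<Rightarrow> complex \<Rightarrow> complex) \<Rightarrow> bool" where
  "vanishing_family F \<longleftrightarrow> (\<forall>\<epsilon>>0. \<exists>s<1. \<forall>a. s < cmod a \<and> cmod a < 1 \<longrightarrow> (\<forall>z\<in>unit_disc. cmod (F a z) \<le> \<epsilon>))"

text \<open>The difference of the kernels with \<open>j = 2\<close> and \<open>j = 1\<close>: the values at \<open>a\<close> cancel, while the
  derivatives have the factors \<open>\<alpha>\<close> and \<open>\<alpha> - 1\<close> and leave exactly \<open>cnj a * (1 - |a|\<^sup>2) powr (1 - \<alpha>)\<close>.
  This isolates the coefficient \<open>u\<close>.\<close>

lemma deriv_test_family_power:
  assumes \<alpha>: "1 < \<alpha>"
  shows "\<exists>F B c. test_family \<alpha> (1/2) B F \<and> 0 < c \<and>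
    (\<forall>a. 1/2 < cmod a \<and> cmod a < 1 \<longrightarrow> c * crit_weight (\<alpha> - 1) (cmod a) \<le> cmod (deriv (F a) a) \<and> F a a = 0) \<and>
    (\<alpha> < 2 \<longrightarrow> vanishing_family F)"
proof -
  define P where "P j s a = on_disc (\<lambda>z. of_real ((1 - (cmod a)^2) ^ j) * kpow a (- s) z)" for j s a
  let ?P2 = "P 2 \<alpha>" and ?P1 = "P 1 (\<alpha> - 1)"
  define F where "F a z = ?P2 a z - ?P1 a z" for a z
  have s2: "\<alpha> = real 2 + \<alpha> - 2" "0 \<le> \<alpha>" "0 < \<alpha>" and s1: "\<alpha> - 1 = real 1 + \<alpha> - 2" "0 \<le> \<alpha> - 1" using \<alpha> by auto
  note K2 = kernel_family[OF s2(3,1,2), folded P_def] and K1 = kernel_family[OF s2(3) s1, folded P_def]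
  define B2 where "B2 = 1 + \<bar>\<alpha>\<bar> + 2 powr \<alpha> * (\<bar>\<alpha>\<bar> * \<bar>\<alpha> + 1\<bar> * 2 ^ 2)"
  define B1 where "B1 = 1 + \<bar>\<alpha> - 1\<bar> + 2 powr \<alpha> * (\<bar>\<alpha> - 1\<bar> * \<bar>\<alpha> - 1 + 1\<bar> * 2 ^ 1)"
  have Bpos: "0 < B1" "0 < B2" unfolding B1_def B2_def by (intro add_pos_nonneg; simp)+
  have deriv: "deriv (F a) z = deriv (?P2 a) z - deriv (?P1 a) z" if "cmod a < 1" "z \<in> unit_disc" for a z
    unfolding F_def[abs_def] using deriv2_diff(1)[of "?P2 a" "?P1 a" z] K2(1)[OF that(1)] K1(1)[OF that(1)] that(2)
    by (auto simp: zygmund_def)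
  have val: "cmod (F a z) \<le> 6 * (1 - cmod a) powr (2 - \<alpha>)" if "cmod a < 1" "z \<in> unit_disc" for a z
  proof -
    have "cmod (F a z) \<le> cmod (?P2 a z) + cmod (?P1 a z)" unfolding F_def by (rule norm_triangle_ineq4)
    also have "\<dots> \<le> 2 ^ 2 * (1 - cmod a) powr (2 - \<alpha>) + 2 ^ 1 * (1 - cmod a) powr (2 - \<alpha>)"
      by (intro add_mono K2(5) K1(5) that)
    finally show ?thesis by simp
  qed
  have "test_family \<alpha> (1/2) (B2 + B1) F"
  proof (rule test_familyI)
    fix a :: complex assume a: "cmod a < 1"
    show "F a \<in> zygmund \<alpha>" unfolding F_def[abs_def] by (intro zygmund_diff K2(1) K1(1) a)
    have "zyg_norm \<alpha> (F a) \<le> zyg_norm \<alpha> (?P2 a) + zyg_norm \<alpha> (?P1 a)"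
      unfolding F_def[abs_def] by (intro zyg_norm_diff K2(1) K1(1) a)
    also have "\<dots> \<le> B2 + B1" unfolding B1_def B2_def by (intro add_mono K2(2) K1(2) a)
    finally show "zyg_norm \<alpha> (F a) \<le> B2 + B1" .
    fix z :: complex assume z: "z \<in> unit_disc"
    show "cmod (F a z) \<le> 6 * (1 - cmod a) powr (2 - \<alpha>)" using val[OF a z] .
    have "cmod (deriv (F a) z) \<le> cmod (deriv (?P2 a) z) + cmod (deriv (?P1 a) z)"
      unfolding deriv[OF a z] by (rule norm_triangle_ineq4)
    also have "\<dots> \<le> \<bar>\<alpha>\<bar> * 2 ^ 2 * (1 - cmod a) powr (1 - \<alpha>) + \<bar>\<alpha> - 1\<bar> * 2 ^ 1 * (1 - cmod a) powr (1 - \<alpha>)"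
      by (intro add_mono K2(4) K1(4) a z)
    finally show "cmod (deriv (F a) z) \<le> \<bar>\<alpha>\<bar> * 2 ^ 2 * (1 - cmod a) powr (1 - \<alpha>) + \<bar>\<alpha> - 1\<bar> * 2 ^ 1 * (1 - cmod a) powr (1 - \<alpha>)" .
  qed (use Bpos in auto)
  moreover have "1/2 * 2 powr (- (\<alpha> - 1)) * crit_weight (\<alpha> - 1) (cmod a) \<le> cmod (deriv (F a) a) \<and> F a a = 0"
    if a: "1/2 < cmod a" "cmod a < 1" for a
  proof
    define D where "D = (1 - (cmod a)^2) powr (1 - \<alpha>)"
    have "deriv (F a) a = of_real (\<alpha> * D) * cnj a - of_real ((\<alpha> - 1) * D) * cnj a"
      using deriv[OF a(2), of a] K2(7)[OF a(2)] K1(7)[OF a(2)] a(2) by (simp add: D_def)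
    also have "\<dots> = of_real D * cnj a" by (simp add: algebra_simps)
    finally have "cmod (deriv (F a) a) = cmod a * D" by (simp add: norm_mult D_def)
    moreover have "1/2 * (2 powr (- (\<alpha> - 1)) * (1 - cmod a) powr (- (\<alpha> - 1))) \<le> cmod a * D"
      using crit_weight_square_le(1)[of "\<alpha> - 1" "cmod a"] \<alpha> a by (intro mult_mono) (auto simp: D_def)
    ultimately show "1/2 * 2 powr (- (\<alpha> - 1)) * crit_weight (\<alpha> - 1) (cmod a) \<le> cmod (deriv (F a) a)"
      using \<alpha> by (simp add: crit_weight_def mult.assoc)
    show "F a a = 0" using K2(6)[OF a(2)] K1(6)[OF a(2)] by (simp add: F_def)
  qed
  moreover have "vanishing_family F" if "\<alpha> < 2"
    unfolding vanishing_family_def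
  proof (intro allI impI)
    fix \<epsilon> :: real assume \<epsilon>: "0 < \<epsilon>"
    let ?s = "1 - (\<epsilon> / 6) powr (1 / (2 - \<alpha>))"
    have "cmod (F a z) \<le> \<epsilon>" if a: "?s < cmod a" "cmod a < 1" and z: "z \<in> unit_disc" for a z
    proof -
      have "(1 - cmod a) powr (2 - \<alpha>) \<le> ((\<epsilon> / 6) powr (1 / (2 - \<alpha>))) powr (2 - \<alpha>)"
        using a \<open>\<alpha> < 2\<close> by (intro powr_mono2) auto
      also have "\<dots> = \<epsilon> / 6" using \<epsilon> \<open>\<alpha> < 2\<close> by (simp add: powr_powr)
      finally show ?thesis using val[OF a(2) z] by linarith
    qed
    then show "\<exists>s<1. \<forall>a. s < cmod a \<and> cmod a < 1 \<longrightarrow> (\<forall>z\<in>unit_disc. cmod (F a z) \<le> \<epsilon>)"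
      using \<epsilon> by (intro exI[of _ ?s]) auto
  qed
  moreover have "0 < 1/2 * 2 powr (- (\<alpha> - 1))" by simp
  ultimately show ?thesis by blast
qed

text \<open>For \<open>\<alpha> = 1\<close> the derivative should be logarithmic at \<open>a\<close>, but \<open>f\<close> should tend to \<open>0\<close> uniformly as
  \<open>|a| \<rightarrow> 1\<close>. Dividing a square of the logarithm by its typical size \<open>L\<close> achieves both: the derivative is
  \<open>- cnj a (ln (1 - cnj a z))\<^sup>2 / L\<close>, of size \<open>L\<close> at \<open>a\<close>, and its primitive is bounded before the
  division by \<open>L\<close>.\<close>

lemma deriv_test_family_log:
  "\<exists>F B c. test_family 1 (3/4) B F \<and> 0 < c \<and>
    (\<forall>a. 3/4 < cmod a \<and> cmod a < 1 \<longrightarrow> c * crit_weight 0 (cmod a) \<le> cmod (deriv (F a) a)) \<and>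
    vanishing_family F"
proof -
  define L where "L a = crit_weight 0 (cmod a)" for a
  define f where "f a z = ker a z * ((Ln (ker a z))^2 - 2 * Ln (ker a z) + 2) / of_real (L a)" for a z
  define f1 where "f1 a z = - cnj a * (Ln (ker a z))^2 / of_real (L a)" for a z
  define f2 where "f2 a z = 2 * (cnj a)^2 * Ln (ker a z) / (ker a z * of_real (L a))" for a z
  define F where "F a = on_disc (f a)" for a
  have L: "1/2 \<le> L a" if "3/4 < cmod a" "cmod a < 1" for a
    unfolding L_def using that by (intro crit_weight_log_ge) auto
  have d1: "(f a has_field_derivative f1 a z) (at z)" if a: "3/4 < cmod a" "cmod a < 1" and z: "z \<in> unit_disc" for a z
  proof -
    have k: "ker a z \<noteq> 0" using ker_bounds(4)[OF a(2)] z by simp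
    have "L a \<noteq> 0" using L[OF a] by auto
    have "((\<lambda>z. ker a z * ((Ln (ker a z))^2 - 2 * Ln (ker a z) + 2)) has_field_derivative
      - cnj a * (Ln (ker a z))^2) (at z)"
      using Ln_ker_deriv[OF a(2), of z] ker_deriv[of a z] ker_bounds(5)[OF a(2), of z] z k
      by (auto intro!: derivative_eq_intros simp: algebra_simps)
    from DERIV_cdivide[OF this, of "of_real (L a)"] show ?thesis by (simp add: f_def[abs_def] f1_def)
  qed
  have d2: "(f1 a has_field_derivative f2 a z) (at z)" if a: "3/4 < cmod a" "cmod a < 1" and z: "z \<in> unit_disc" for a z
  proof -
    have k: "ker a z \<noteq> 0" using ker_bounds(4)[OF a(2)] z by simp
    have "L a \<noteq> 0" using L[OF a] by auto
    have "((\<lambda>z. - cnj a * (Ln (ker a z))\<^sup>2 / of_real (L a)) has_field_derivative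
      - cnj a * (2 * Ln (ker a z) * (- cnj a / ker a z)) / of_real (L a)) (at z)"
      using Ln_ker_deriv[OF a(2), of z] ker_bounds(5)[OF a(2), of z] ker_deriv[of a z] z \<open>L a \<noteq> 0\<close>
      by (auto intro!: derivative_eq_intros simp: divide_inverse mult_ac)
    then show ?thesis using k by (simp add: f1_def[abs_def] f2_def power2_eq_square mult_ac)
  qed
  have b: "cmod (f2 a z) \<le> 18 * (1 - cmod z) powr (- 1)" if a: "3/4 < cmod a" "cmod a < 1" and z: "z \<in> unit_disc" for a z
  proof -
    have z1: "cmod z < 1" using z by simp
    have La: "0 < L a" using L[OF a] by simp
    have ln: "cmod (Ln (ker a z)) \<le> 9 * L a" unfolding L_def using a z by (intro Ln_ker_bounds(1)) auto
    have "cmod (f2 a z) = 2 * (cmod a)^2 * (cmod (Ln (ker a z)) / L a) * (1 / cmod (ker a z))"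
      using La by (simp add: f2_def norm_mult norm_divide norm_power)
    also have "\<dots> \<le> 2 * 1 * 9 * (1 / (1 - cmod z))"
      using a z1 ln La ker_bounds(2)[OF a(2) z1] 
      by (intro mult_mono frac_le) (auto simp: power_le_one field_simps)
    finally show ?thesis using z1 by (simp add: powr_minus divide_inverse)
  qed
  have val: "cmod (F a z) \<le> 144 / L a" if a: "3/4 < cmod a" "cmod a < 1" and z: "z \<in> unit_disc" for a z
  proof -
    have z1: "cmod z < 1" using z by simp
    have La: "0 < L a" using L[OF a] by simp
    let ?t = "cmod (ker a z)" and ?l = "cmod (Ln (ker a z))"
    have t: "0 < ?t" "?t \<le> 2" using ker_bounds(3,4)[OF a(2) z1] by auto
    have "cmod ((Ln (ker a z))^2 - 2 * Ln (ker a z) + 2) \<le> cmod ((Ln (ker a z))^2) + cmod (2 * Ln (ker a z)) + cmod 2"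
      by (intro norm_triangle_le norm_triangle_le_diff add_mono order_refl)
    also have "\<dots> \<le> (?l + 2)^2" by (simp add: norm_mult norm_power power2_eq_square algebra_simps)
    also have "\<dots> \<le> (\<bar>ln ?t\<bar> + 6)^2"
      using Ln_ker_bounds(2)[of a z] a z1 by (intro power_mono) auto
    finally have "?t * cmod ((Ln (ker a z))^2 - 2 * Ln (ker a z) + 2) \<le> ?t * (\<bar>ln ?t\<bar> + 6)^2"
      by (intro mult_left_mono) auto
    also have "\<dots> \<le> 144" using t by (rule log_square_bounded)
    finally show ?thesis using z La by (simp add: F_def on_disc_def f_def norm_mult norm_divide divide_right_mono)
  qed
  note Z = on_disc_zygmund[of 1, OF _ d1 d2 b]
  have der: "deriv (F a) z = f1 a z" if a: "3/4 < cmod a" "cmod a < 1" and z: "z \<in> unit_disc" for a z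
    unfolding F_def using Z(3)[of a z] a z by simp
  (* 4 bounds the value at 0 and 36 = 2 * 18 the second derivative *)
  have "test_family 1 (3/4) 40 F"
  proof (rule test_familyI)
    fix a :: complex assume a: "3/4 < cmod a" "cmod a < 1"
    show "F a \<in> zygmund 1" unfolding F_def using Z(1)[of a] a by simp
    have "cmod (f a 0) \<le> 4" using L[OF a] by (simp add: f_def ker_def norm_divide field_simps)
    moreover have "f1 a 0 = 0" by (simp add: f1_def ker_def)
    ultimately show "zyg_norm 1 (F a) \<le> 40" unfolding F_def using Z(2)[of a] a by simp
    fix z :: complex assume z: "z \<in> unit_disc"
    show "cmod (F a z) \<le> 144 / L a" by (rule val[OF a z])
    have La: "0 < L a" using L[OF a] by simp
    have ln: "cmod (Ln (ker a z)) \<le> 9 * L a" unfolding L_def using a z by (intro Ln_ker_bounds(1)) auto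
    have "cmod (deriv (F a) z) = cmod a * (cmod (Ln (ker a z)))^2 / L a"
      using La unfolding der[OF a z] by (simp add: f1_def norm_mult norm_divide norm_power)
    also have "\<dots> \<le> 1 * (9 * L a)^2 / L a"
      using La a ln by (intro divide_right_mono mult_mono power_mono) auto
    finally show "cmod (deriv (F a) z) \<le> 1 * (9 * L a)^2 / L a" .
  qed auto
  moreover have "3/16 * crit_weight 0 (cmod a) \<le> cmod (deriv (F a) a)" if a: "3/4 < cmod a" "cmod a < 1" for a
  proof -
    have La: "0 < L a" using L[OF a] by simp
    have "3/16 * L a = 3/4 * (L a / 2)^2 / L a" using La by (simp add: power2_eq_square)
    also have "\<dots> \<le> cmod a * (cmod (Ln (ker a a)))^2 / L a"
      using La a Ln_ker_at_point(1)[of a] by (intro divide_right_mono mult_mono power_mono) (auto simp: L_def)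
    also have "\<dots> = cmod (deriv (F a) a)"
      using La a der[OF a, of a] by (simp add: f1_def norm_mult norm_divide norm_power)
    finally show ?thesis by (simp add: L_def)
  qed
  moreover have "vanishing_family F"
    unfolding vanishing_family_def
  proof (intro allI impI)
    fix \<epsilon> :: real assume \<epsilon>: "0 < \<epsilon>"
    obtain s where s: "s < 1" "\<And>x. s < x \<Longrightarrow> x < 1 \<Longrightarrow> 144 / \<epsilon> \<le> crit_weight 0 x"
      using crit_weight_large[of 0 "144 / \<epsilon>"] by auto
    have "cmod (F a z) \<le> \<epsilon>" if a: "max s (3/4) < cmod a" "cmod a < 1" and z: "z \<in> unit_disc" for a z
    proof -
      have a': "3/4 < cmod a" using a by simp
      have "144 / \<epsilon> \<le> L a" unfolding L_def using s(2) a by simp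
      then have "144 / L a \<le> \<epsilon>" using \<epsilon> L[OF a' a(2)] by (simp add: field_simps)
      then show ?thesis using val[OF a' a(2) z] by linarith
    qed
    then show "\<exists>s<1. \<forall>a. s < cmod a \<and> cmod a < 1 \<longrightarrow> (\<forall>z\<in>unit_disc. cmod (F a z) \<le> \<epsilon>)"
      using s(1) by (intro exI[of _ "max s (3/4)"]) auto
  qed
  ultimately show ?thesis by (intro exI[of _ F] exI[of _ 40] exI[of _ "3/16"]) auto
qed

text \<open>The derivative at \<open>a\<close> need not vanish here: it is of the critical order, and its contribution is
  absorbed by the bound on \<open>u\<close>. For \<open>\<alpha> = 2\<close> the logarithm of the kernel serves, for \<open>\<alpha> > 2\<close> the kernel
  with \<open>j = 2\<close>.\<close>

lemma value_test_family:
  assumes \<alpha>: "2 \<le> \<alpha>"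
  shows "\<exists>F B c C. test_family \<alpha> (3/4) B F \<and> 0 < c \<and> 0 \<le> C \<and>
    (\<forall>a. 3/4 < cmod a \<and> cmod a < 1 \<longrightarrow> c * crit_weight (\<alpha> - 2) (cmod a) \<le> cmod (F a a) \<and>
      cmod (deriv (F a) a) \<le> C * crit_weight (\<alpha> - 1) (cmod a))"
proof (cases "\<alpha> = 2")
  case True
  define F where "F a = on_disc (\<lambda>z. Ln (ker a z))" for a
  have d1: "((\<lambda>z. Ln (ker a z)) has_field_derivative - cnj a / ker a z) (at z)"
    if a: "cmod a < 1" and z: "z \<in> unit_disc" for a z using Ln_ker_deriv[OF a] z by simp
  have d2: "((\<lambda>z. - cnj a / ker a z) has_field_derivative - ((cnj a)^2) / (ker a z)^2) (at z)"
    if a: "cmod a < 1" and z: "z \<in> unit_disc" for a z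
    using ker_deriv[of a z] ker_bounds(4)[OF a, of z] z
    by (auto intro!: derivative_eq_intros simp: power2_eq_square)
  have b: "cmod (- ((cnj a)^2) / (ker a z)^2) \<le> 1 * (1 - cmod z) powr (- 2)"
    if a: "cmod a < 1" and z: "z \<in> unit_disc" for a z
  proof -
    have z1: "cmod z < 1" using z by simp
    have "cmod (- ((cnj a)^2) / (ker a z)^2) = (cmod a)^2 / (cmod (ker a z))^2"
      by (simp add: norm_divide norm_power)
    also have "\<dots> \<le> 1 / (1 - cmod z)^2"
      using a z1 ker_bounds(2)[OF a z1] by (intro frac_le power_mono) (auto simp: power_le_one)
    also have "\<dots> = 1 * (1 - cmod z) powr (- 2)" using z1 by (simp add: powr_minus divide_inverse powr_numeral)
    finally show ?thesis .
  qed
  note Z = on_disc_zygmund[of 2, OF _ d1 d2 b]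
  have der: "cmod (deriv (F a) z) \<le> 1 / (1 - cmod a)" if a: "cmod a < 1" and z: "z \<in> unit_disc" for a z
  proof -
    have "cmod (deriv (F a) z) = cmod a / cmod (ker a z)"
      unfolding F_def using Z(3)[of a z] a z by (simp add: norm_divide)
    also have "\<dots> \<le> 1 / (1 - cmod a)" using a z ker_bounds(1)[of a z] by (intro frac_le) auto
    finally show ?thesis .
  qed
  have "test_family \<alpha> (3/4) 5 F"
  proof (rule test_familyI)
    fix a :: complex assume a: "3/4 < cmod a" "cmod a < 1"
    show "F a \<in> zygmund \<alpha>" unfolding F_def True using Z(1)[of a] a by simp
    show "zyg_norm \<alpha> (F a) \<le> 5" unfolding F_def True using Z(2)[of a] a by (simp add: ker_def powr_numeral)
    fix z :: complex assume z: "z \<in> unit_disc"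
    show "cmod (F a z) \<le> 9 * crit_weight 0 (cmod a)"
      using Ln_ker_bounds(1)[of a z] a z by (simp add: F_def on_disc_def)
    show "cmod (deriv (F a) z) \<le> 1 / (1 - cmod a)" using der a z by simp
  qed auto
  moreover have "1/2 * crit_weight (\<alpha> - 2) (cmod a) \<le> cmod (F a a) \<and>
      cmod (deriv (F a) a) \<le> 1 * crit_weight (\<alpha> - 1) (cmod a)" if a: "3/4 < cmod a" "cmod a < 1" for a
  proof
    show "1/2 * crit_weight (\<alpha> - 2) (cmod a) \<le> cmod (F a a)"
      using Ln_ker_at_point(1)[of a] a True by (simp add: F_def on_disc_def)
    have "crit_weight (\<alpha> - 1) (cmod a) = 1 / (1 - cmod a)"
      using a True by (simp add: crit_weight_def powr_minus_divide)
    then show "cmod (deriv (F a) a) \<le> 1 * crit_weight (\<alpha> - 1) (cmod a)"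
      using der[of a a] a by simp
  qed
  ultimately show ?thesis by (intro exI[of _ F] exI[of _ 5] exI[of _ "1/2"] exI[of _ 1]) auto
next
  case False
  then have \<alpha>2: "2 < \<alpha>" using \<alpha> by simp
  define F where "F a = on_disc (\<lambda>z. of_real ((1 - (cmod a)^2) ^ 2) * kpow a (- \<alpha>) z)" for a
  have s2: "\<alpha> = real 2 + \<alpha> - 2" "0 \<le> \<alpha>" "0 < \<alpha>" using \<alpha> by auto
  note K = kernel_family[OF s2(3,1,2), folded F_def]
  have "test_family \<alpha> (3/4) (1 + \<bar>\<alpha>\<bar> + 2 powr \<alpha> * (\<bar>\<alpha>\<bar> * \<bar>\<alpha> + 1\<bar> * 2 ^ 2)) F"
    by (rule test_familyI[OF _ _ K(1) K(2) K(5) K(4)]) (auto intro!: add_pos_nonneg)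
  moreover have "2 powr (- (\<alpha> - 2)) * crit_weight (\<alpha> - 2) (cmod a) \<le> cmod (F a a) \<and>
      cmod (deriv (F a) a) \<le> \<alpha> * crit_weight (\<alpha> - 1) (cmod a)" if a: "3/4 < cmod a" "cmod a < 1" for a
  proof
    show "2 powr (- (\<alpha> - 2)) * crit_weight (\<alpha> - 2) (cmod a) \<le> cmod (F a a)"
      using K(6)[OF a(2)] crit_weight_square_le(1)[of "\<alpha> - 2" "cmod a"] \<alpha>2 a by (simp add: crit_weight_def)
    have "cmod (deriv (F a) a) = \<alpha> * ((1 - (cmod a)^2) powr (1 - \<alpha>)) * cmod a"
      using K(7)[OF a(2)] \<alpha>2 by (simp add: norm_mult)
    also have "\<dots> \<le> \<alpha> * (1 - cmod a) powr (1 - \<alpha>) * 1"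
      using crit_weight_square_le(2)[of "\<alpha> - 1" "cmod a"] \<alpha>2 a by (intro mult_mono) auto
    finally show "cmod (deriv (F a) a) \<le> \<alpha> * crit_weight (\<alpha> - 1) (cmod a)"
      using \<alpha>2 by (simp add: crit_weight_def)
  qed
  moreover have "0 < 2 powr (- (\<alpha> - 2))" by simp
  ultimately show ?thesis using s2(2) by blast
qed

section \<open>The lower estimate\<close>

context bounded_UC begin

text \<open>The weighted second derivative of \<open>T f\<close> at \<open>z\<close>.\<close>

abbreviation "ev f z \<equiv> std_weight \<beta> z * cmod (deriv f (\<phi> z) * u z + f (\<phi> z) * v z)"

text \<open>Boundedness of \<open>T\<close> already gives the lower estimate with some constant depending on \<open>T\<close>. This
  crude form is used only to see that the weighted coefficients decay at the boundary.\<close>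

lemma family_bounded:
  assumes "test_family \<alpha> s0 B F"
  shows "\<exists>P>0. \<exists>s<1. \<forall>z\<in>unit_disc. s < cmod (\<phi> z) \<longrightarrow> ev (F (\<phi> z)) z \<le> P"
proof -
  obtain C where C: "0 < C" "\<And>f. f \<in> zygmund \<alpha> \<Longrightarrow> zyg_norm \<beta> (T f) \<le> C * zyg_norm \<alpha> f"
    using T_bound by blast
  have B: "0 < B" "s0 < 1" using assms by (auto simp: test_family_def)
  have "ev (F (\<phi> z)) z \<le> C * B" if z: "z \<in> unit_disc" "s0 < cmod (\<phi> z)" for z
  proof -
    have F: "F (\<phi> z) \<in> zygmund \<alpha>" "zyg_norm \<alpha> (F (\<phi> z)) \<le> B"
      using assms z phi_in[of z] by (auto simp: test_family_def)
    have "ev (F (\<phi> z)) z \<le> zyg_norm \<beta> (T (F (\<phi> z)))" by (rule T_norm_ge[OF F(1) z(1)])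
    also have "\<dots> \<le> C * zyg_norm \<alpha> (F (\<phi> z))" by (rule C(2)[OF F(1)])
    also have "\<dots> \<le> C * B" using C(1) F(2) by (intro mult_left_mono) auto
    finally show ?thesis .
  qed
  moreover have "0 < C * B" using C(1) B(1) by simp
  ultimately show ?thesis using B(2) by blast
qed

lemma ev_le:
  assumes z: "z \<in> unit_disc"
  shows "ev f z \<le> cmod (deriv f (\<phi> z)) * wu z + cmod (f (\<phi> z)) * wv z"
proof -
  have "ev f z \<le> std_weight \<beta> z * (cmod (deriv f (\<phi> z)) * cmod (u z) + cmod (f (\<phi> z)) * cmod (v z))"
    using less_imp_le[OF std_weight_pos[OF z]] by (intro mult_left_mono norm_triangle_le) (auto simp: norm_mult)
  then show ?thesis by (simp add: algebra_simps)
qed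

lemma ev_ge_deriv:
  assumes z: "z \<in> unit_disc"
  shows "cmod (deriv f (\<phi> z)) * wu z \<le> ev f z + cmod (f (\<phi> z)) * wv z"
proof -
  have "cmod (deriv f (\<phi> z) * u z) \<le> cmod (deriv f (\<phi> z) * u z + f (\<phi> z) * v z) + cmod (f (\<phi> z) * v z)"
    using norm_triangle_ineq4[of "deriv f (\<phi> z) * u z + f (\<phi> z) * v z" "f (\<phi> z) * v z"] by simp
  then have "std_weight \<beta> z * cmod (deriv f (\<phi> z) * u z) \<le>
      std_weight \<beta> z * (cmod (deriv f (\<phi> z) * u z + f (\<phi> z) * v z) + cmod (f (\<phi> z) * v z))"
    using less_imp_le[OF std_weight_pos[OF z]] by (intro mult_left_mono) auto
  then show ?thesis by (simp add: norm_mult algebra_simps)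
qed

lemma ev_ge_value:
  assumes z: "z \<in> unit_disc"
  shows "cmod (f (\<phi> z)) * wv z \<le> ev f z + cmod (deriv f (\<phi> z)) * wu z"
proof -
  have "cmod (f (\<phi> z) * v z) \<le> cmod (deriv f (\<phi> z) * u z + f (\<phi> z) * v z) + cmod (deriv f (\<phi> z) * u z)"
    using norm_triangle_ineq4[of "deriv f (\<phi> z) * u z + f (\<phi> z) * v z" "deriv f (\<phi> z) * u z"] by simp
  then have "std_weight \<beta> z * cmod (f (\<phi> z) * v z) \<le>
      std_weight \<beta> z * (cmod (deriv f (\<phi> z) * u z + f (\<phi> z) * v z) + cmod (deriv f (\<phi> z) * u z))"
    using less_imp_le[OF std_weight_pos[OF z]] by (intro mult_left_mono) auto
  then show ?thesis by (simp add: norm_mult algebra_simps)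
qed

text \<open>A fixed \<open>F a\<close> is bounded together with its derivative, so its contribution dies out near the
  circle as soon as the weighted \<open>u\<close> and \<open>v\<close> do; if \<open>v\<close> does not, smallness of \<open>F a\<close> itself helps.
  This is what separates \<open>F (\<phi> (z i))\<close> from \<open>F (\<phi> (z j))\<close> for \<open>j\<close> much larger than \<open>i\<close>.\<close>

lemma fixed_function_small:
  assumes u0: "\<And>\<epsilon>. 0 < \<epsilon> \<Longrightarrow> bdry_le u \<phi> (\<lambda>_. 1) \<beta> \<epsilon>"
    and v0: "(\<forall>\<epsilon>>0. bdry_le v \<phi> (\<lambda>_. 1) \<beta> \<epsilon>) \<or> vanishing_family F"
    and F: "test_family \<alpha> s0 B F" and \<epsilon>: "0 < \<epsilon>"
  shows "\<exists>s<1. \<forall>a. s < cmod a \<and> cmod a < 1 \<longrightarrow> (\<exists>s'<1. \<forall>z\<in>unit_disc. s' < cmod (\<phi> z) \<longrightarrow> ev (F a) z \<le> \<epsilon>)"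
proof -
  have scaled: "\<exists>s'<1. \<forall>z\<in>unit_disc. s' < cmod (\<phi> z) \<longrightarrow> C * (std_weight \<beta> z * cmod (h z)) \<le> \<epsilon> / 2"
    if h: "\<And>\<epsilon>. 0 < \<epsilon> \<Longrightarrow> bdry_le h \<phi> (\<lambda>_. 1) \<beta> \<epsilon>" and C: "0 \<le> C" for C h
  proof -
    have "bdry_le h \<phi> (\<lambda>_. 1) \<beta> (\<epsilon> / (2 * (C + 1)))" using \<epsilon> C by (intro h) simp
    then obtain s' where "s' < 1" and s': "\<And>z. z \<in> unit_disc \<Longrightarrow> s' < cmod (\<phi> z) \<Longrightarrow>
      std_weight \<beta> z * cmod (h z) \<le> \<epsilon> / (2 * (C + 1))" by (auto simp: bdry_le_def)
    moreover have "C * (\<epsilon> / (2 * (C + 1))) \<le> \<epsilon> / 2" using \<epsilon> C by (simp add: field_simps)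
    ultimately show ?thesis using mult_left_mono[OF s' C] by (meson order_trans)
  qed
  have s0: "s0 < 1" using F by (simp add: test_family_def)
  have F_bound: "\<exists>C\<ge>0. \<forall>z\<in>unit_disc. cmod (F a z) \<le> C \<and> cmod (deriv (F a) z) \<le> C"
    if a: "s0 < cmod a" "cmod a < 1" for a
  proof -
    obtain C where C: "\<forall>z\<in>unit_disc. cmod (F a z) \<le> C \<and> cmod (deriv (F a) z) \<le> C"
      using F a unfolding test_family_def by blast
    have "cmod (F a 0) \<le> C" using C by simp
    then have "0 \<le> C" by (rule order_trans[OF norm_ge_zero])
    then show ?thesis using C by blast
  qed
  have w: "0 \<le> std_weight \<beta> z * cmod (h z)" if "z \<in> unit_disc" for h z
    using std_weight_pos[OF that, of \<beta>] by simp
  have v_part: "\<exists>s<1. \<forall>a. s < cmod a \<and> cmod a < 1 \<longrightarrow> (\<exists>s'<1. \<forall>z\<in>unit_disc. s' < cmod (\<phi> z) \<longrightarrow>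
    cmod (F a (\<phi> z)) * wv z \<le> \<epsilon> / 2)"
    using v0
  proof
    assume v0: "\<forall>\<epsilon>>0. bdry_le v \<phi> (\<lambda>_. 1) \<beta> \<epsilon>"
    have "\<exists>s'<1. \<forall>z\<in>unit_disc. s' < cmod (\<phi> z) \<longrightarrow> cmod (F a (\<phi> z)) * wv z \<le> \<epsilon> / 2"
      if a: "s0 < cmod a" "cmod a < 1" for a
    proof -
      obtain C where C: "0 \<le> C" "\<And>z. z \<in> unit_disc \<Longrightarrow> cmod (F a z) \<le> C" using F_bound[OF a] by blast
      obtain s' where s': "s' < 1" "\<And>z. z \<in> unit_disc \<Longrightarrow> s' < cmod (\<phi> z) \<Longrightarrow> C * wv z \<le> \<epsilon> / 2"
        using scaled[of v, OF _ C(1)] v0 by blast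
      have "cmod (F a (\<phi> z)) * wv z \<le> \<epsilon> / 2" if z: "z \<in> unit_disc" "s' < cmod (\<phi> z)" for z
        using mult_right_mono[OF C(2) w[OF z(1), of v], of "\<phi> z"] s'(2)[OF z] phi_in[of z] z(1) by simp
      then show ?thesis using s'(1) by blast
    qed
    then show ?thesis using s0 by blast
  next
    assume van: "vanishing_family F"
    obtain M where M: "0 < M" "\<And>z. z \<in> unit_disc \<Longrightarrow> wu z \<le> M" "\<And>z. z \<in> unit_disc \<Longrightarrow> wv z \<le> M" using coeff_bounded by blast
    have "0 < \<epsilon> / (2 * M)" using \<epsilon> M(1) by simp
    then obtain s where s: "s < 1" "\<And>a z. s < cmod a \<Longrightarrow> cmod a < 1 \<Longrightarrow> z \<in> unit_disc \<Longrightarrow> cmod (F a z) \<le> \<epsilon> / (2 * M)"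
      using van unfolding vanishing_family_def by blast
    have "cmod (F a (\<phi> z)) * wv z \<le> \<epsilon> / 2"
      if a: "s < cmod a" "cmod a < 1" and z: "z \<in> unit_disc" for a z
    proof -
      have p: "\<phi> z \<in> unit_disc" using z phi_in[of z] by simp
      have "cmod (F a (\<phi> z)) * wv z \<le> \<epsilon> / (2 * M) * M"
        using s(2)[OF a p] M(1,3) z w[OF z] \<epsilon> by (intro mult_mono) auto
      then show ?thesis using M(1) by simp
    qed
    then show ?thesis using s(1) by (meson zero_less_one)
  qed
  then obtain s1 where s1: "s1 < 1" "\<And>a. s1 < cmod a \<Longrightarrow> cmod a < 1 \<Longrightarrow> \<exists>s'<1. \<forall>z\<in>unit_disc.
    s' < cmod (\<phi> z) \<longrightarrow> cmod (F a (\<phi> z)) * wv z \<le> \<epsilon> / 2" by blast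
  have "\<exists>s'<1. \<forall>z\<in>unit_disc. s' < cmod (\<phi> z) \<longrightarrow> ev (F a) z \<le> \<epsilon>" if a: "max s0 s1 < cmod a" "cmod a < 1" for a
  proof -
    obtain C where C: "0 \<le> C" "\<And>z. z \<in> unit_disc \<Longrightarrow> cmod (deriv (F a) z) \<le> C" using F_bound[of a] a by auto
    obtain s2 where s2: "s2 < 1" "\<And>z. z \<in> unit_disc \<Longrightarrow> s2 < cmod (\<phi> z) \<Longrightarrow>
      C * wu z \<le> \<epsilon> / 2" using scaled[of u, OF u0 C(1)] by blast
    obtain s3 where s3: "s3 < 1" "\<And>z. z \<in> unit_disc \<Longrightarrow> s3 < cmod (\<phi> z) \<Longrightarrow>
      cmod (F a (\<phi> z)) * wv z \<le> \<epsilon> / 2" using s1(2)[of a] a by auto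
    have "ev (F a) z \<le> \<epsilon>" if z: "z \<in> unit_disc" "max s2 s3 < cmod (\<phi> z)" for z
    proof -
      have p: "\<phi> z \<in> unit_disc" using z phi_in[of z] by simp
      have "cmod (deriv (F a) (\<phi> z)) * wu z \<le> C * wu z"
        by (rule mult_right_mono[OF C(2)[OF p] w[OF z(1)]])
      then show ?thesis using ev_le[OF z(1), of "F a"] s2(2)[OF z(1)] s3(2)[OF z(1)] z(2) by simp
    qed
    then show ?thesis using s2(1) s3(1) by (intro exI[of _ "max s2 s3"]) auto
  qed
  then show ?thesis using s0 s1(1) by (intro exI[of _ "max s0 s1"]) auto
qed

lemma family_ess_bound:
  assumes u0: "\<And>\<epsilon>. 0 < \<epsilon> \<Longrightarrow> bdry_le u \<phi> (\<lambda>_. 1) \<beta> \<epsilon>"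
    and v0: "(\<forall>\<epsilon>>0. bdry_le v \<phi> (\<lambda>_. 1) \<beta> \<epsilon>) \<or> vanishing_family F"
    and F: "test_family \<alpha> s0 B F" and E: "ess_norm \<alpha> \<beta> T < ereal E"
  shows "\<exists>s<1. \<forall>z\<in>unit_disc. s < cmod (\<phi> z) \<longrightarrow> ev (F (\<phi> z)) z \<le> (2 * B + 1) * E"
proof -
  obtain K where K: "compact_op \<alpha> \<beta> K" "op_norm \<alpha> \<beta> (\<lambda>f z. T f z + K f z) < ereal E"
    using E unfolding ess_norm_def INF_less_iff by blast
  have "0 < E" using ess_norm_nonneg E order_le_less_trans[of 0 "ess_norm \<alpha> \<beta> T" "ereal E"] by simp
  then have "\<exists>s<1. \<forall>z\<in>unit_disc. s < cmod (\<phi> z) \<longrightarrow> ev (F (\<phi> z)) z \<le> 2 * B * E + E"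
    using F fixed_function_small[OF u0 v0 F] by (intro test_family_bound[OF K(1) less_imp_le[OF K(2)], of s0])
      (auto simp: test_family_def)
  then show ?thesis by (simp add: algebra_simps)
qed

text \<open>Near the circle \<open>F a a\<close> is small compared with the bounded weighted \<open>v\<close>; allowing an error \<open>P\<close> for it
  doubles the constant.\<close>

lemma deriv_coeff_bound:
  assumes c: "0 < c" and s0: "s0 < 1"
    and lower: "\<And>a. s0 < cmod a \<Longrightarrow> cmod a < 1 \<Longrightarrow> c * crit_weight (\<alpha> - 1) (cmod a) \<le> cmod (deriv (F a) a)"
    and diag: "vanishing_family F \<or> (\<forall>a. s0 < cmod a \<and> cmod a < 1 \<longrightarrow> F a a = 0)"
    and P: "0 < P" "\<exists>s<1. \<forall>z\<in>unit_disc. s < cmod (\<phi> z) \<longrightarrow> ev (F (\<phi> z)) z \<le> P"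
  shows "bdry_le u \<phi> (crit_weight (\<alpha> - 1)) \<beta> (2 * P / c)"
proof -
  obtain M where M: "0 < M" "\<And>z. z \<in> unit_disc \<Longrightarrow> wu z \<le> M"
    "\<And>z. z \<in> unit_disc \<Longrightarrow> wv z \<le> M" using coeff_bounded by blast
  have PM: "0 < P / M" using P(1) M(1) by simp
  obtain s1 where s1: "s1 < 1" "\<And>a. s1 < cmod a \<Longrightarrow> cmod a < 1 \<Longrightarrow> cmod (F a a) \<le> P / M"
    using diag
  proof
    assume "vanishing_family F"
    then obtain s where s: "s < 1" "\<forall>a. s < cmod a \<and> cmod a < 1 \<longrightarrow> (\<forall>z\<in>unit_disc. cmod (F a z) \<le> P / M)"
      using PM unfolding vanishing_family_def by blast
    show thesis by (rule that[OF s(1)]) (use s(2) in auto)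
  next
    assume "\<forall>a. s0 < cmod a \<and> cmod a < 1 \<longrightarrow> F a a = 0"
    then show thesis using that[OF s0] PM by auto
  qed
  obtain s2 where s2: "s2 < 1" "\<And>z. z \<in> unit_disc \<Longrightarrow> s2 < cmod (\<phi> z) \<Longrightarrow> ev (F (\<phi> z)) z \<le> P"
    using P(2) by blast
  define s where "s = Max {s0, s1, s2}"
  have "wu z * crit_weight (\<alpha> - 1) (cmod (\<phi> z)) \<le> 2 * P / c"
    if z: "z \<in> unit_disc" "s < cmod (\<phi> z)" for z
  proof -
    have s': "s0 < cmod (\<phi> z)" "s1 < cmod (\<phi> z)" "s2 < cmod (\<phi> z)" "cmod (\<phi> z) < 1"
      using z phi_in[of z] by (auto simp: s_def)
    have w: "0 \<le> wu z" "0 \<le> wv z"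
      using std_weight_pos[OF z(1), of \<beta>] by auto
    have "c * crit_weight (\<alpha> - 1) (cmod (\<phi> z)) * wu z
      \<le> cmod (deriv (F (\<phi> z)) (\<phi> z)) * wu z"
      using w lower s' by (intro mult_right_mono) auto
    also have "\<dots> \<le> ev (F (\<phi> z)) z + cmod (F (\<phi> z) (\<phi> z)) * wv z"
      by (rule ev_ge_deriv[OF z(1)])
    also have "\<dots> \<le> P + P / M * M"
      using s2(2)[OF z(1) s'(3)] s1(2)[OF s'(2,4)] M(1,3) z w PM by (intro add_mono mult_mono) auto
    also have "\<dots> = 2 * P" using M(1) by simp
    finally show ?thesis using c by (simp add: field_simps)
  qed
  moreover have "s < 1" using s0 s1 s2 by (simp add: s_def)
  ultimately show ?thesis unfolding bdry_le_def by blast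
qed

text \<open>The derivative term of \<open>G a\<close> has critical order, so the bound on \<open>u\<close> controls it.\<close>

lemma value_coeff_bound:
  assumes c: "0 < c" "0 \<le> C" and s0: "s0 < 1"
    and lower: "\<And>a. s0 < cmod a \<Longrightarrow> cmod a < 1 \<Longrightarrow> c * crit_weight (\<alpha> - 2) (cmod a) \<le> cmod (G a a)"
    and upper: "\<And>a. s0 < cmod a \<Longrightarrow> cmod a < 1 \<Longrightarrow> cmod (deriv (G a) a) \<le> C * crit_weight (\<alpha> - 1) (cmod a)"
    and u: "bdry_le u \<phi> (crit_weight (\<alpha> - 1)) \<beta> Q"
    and P: "\<exists>s<1. \<forall>z\<in>unit_disc. s < cmod (\<phi> z) \<longrightarrow> ev (G (\<phi> z)) z \<le> P"
  shows "bdry_le v \<phi> (crit_weight (\<alpha> - 2)) \<beta> ((P + C * Q) / c)"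
proof -
  obtain s1 where s1: "s1 < 1" "\<And>z. z \<in> unit_disc \<Longrightarrow> s1 < cmod (\<phi> z) \<Longrightarrow>
    wu z * crit_weight (\<alpha> - 1) (cmod (\<phi> z)) \<le> Q" using u by (auto simp: bdry_le_def)
  obtain s2 where s2: "s2 < 1" "\<And>z. z \<in> unit_disc \<Longrightarrow> s2 < cmod (\<phi> z) \<Longrightarrow> ev (G (\<phi> z)) z \<le> P"
    using P by blast
  define s where "s = Max {s0, s1, s2}"
  have "wv z * crit_weight (\<alpha> - 2) (cmod (\<phi> z)) \<le> (P + C * Q) / c"
    if z: "z \<in> unit_disc" "s < cmod (\<phi> z)" for z
  proof -
    have s': "s0 < cmod (\<phi> z)" "s1 < cmod (\<phi> z)" "s2 < cmod (\<phi> z)" "cmod (\<phi> z) < 1"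
      using z phi_in[of z] by (auto simp: s_def)
    have w: "0 \<le> wu z" "0 \<le> wv z"
      using std_weight_pos[OF z(1), of \<beta>] by auto
    have "c * crit_weight (\<alpha> - 2) (cmod (\<phi> z)) * wv z
      \<le> cmod (G (\<phi> z) (\<phi> z)) * wv z"
      using w lower s' by (intro mult_right_mono) auto
    also have "\<dots> \<le> ev (G (\<phi> z)) z + cmod (deriv (G (\<phi> z)) (\<phi> z)) * wu z"
      by (rule ev_ge_value[OF z(1)])
    also have "\<dots> \<le> P + C * crit_weight (\<alpha> - 1) (cmod (\<phi> z)) * wu z"
      using s2(2)[OF z(1) s'(3)] upper[OF s'(1,4)] w by (intro add_mono mult_right_mono) auto
    also have "\<dots> \<le> P + C * Q"
      using mult_left_mono[OF s1(2)[OF z(1) s'(2)] c(2)] by (simp add: mult_ac)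
    finally show ?thesis using c(1) by (simp add: field_simps)
  qed
  moreover have "s < 1" using s0 s1 s2 by (simp add: s_def)
  ultimately show ?thesis unfolding bdry_le_def by blast
qed

text \<open>The same argument runs twice: with the bound from boundedness of \<open>T\<close> it yields decay of the weighted
  \<open>u\<close>, which is what the comparison with the essential norm requires.\<close>

lemma lower_estimate_deriv:
  assumes \<alpha>: "1 \<le> \<alpha>" and c: "0 < c" and F: "test_family \<alpha> s0 B F"
    and lower: "\<And>a. s0 < cmod a \<Longrightarrow> cmod a < 1 \<Longrightarrow> c * crit_weight (\<alpha> - 1) (cmod a) \<le> cmod (deriv (F a) a)"
    and van: "vanishing_family F" and E: "ess_norm \<alpha> \<beta> T < ereal E"
  shows "bdry_le u \<phi> (crit_weight (\<alpha> - 1)) \<beta> (2 * ((2 * B + 1) * E) / c)"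
proof -
  have s0: "s0 < 1" and B: "0 < B" using F by (auto simp: test_family_def)
  have "0 < E" using ess_norm_nonneg E order_le_less_trans[of 0 "ess_norm \<alpha> \<beta> T" "ereal E"] by simp
  then have pos: "0 < (2 * B + 1) * E" using B by simp
  obtain P where P: "0 < P" "\<exists>s<1. \<forall>z\<in>unit_disc. s < cmod (\<phi> z) \<longrightarrow> ev (F (\<phi> z)) z \<le> P"
    using family_bounded[OF F] by blast
  have "bdry_le u \<phi> (crit_weight (\<alpha> - 1)) \<beta> (2 * P / c)"
    using deriv_coeff_bound[OF c s0 lower disjI1[OF van] P] .
  then have u0: "bdry_le u \<phi> (\<lambda>_. 1) \<beta> \<epsilon>" if "0 < \<epsilon>" for \<epsilon>
    using bdry_le_small[of "\<alpha> - 1" u \<phi> \<beta> _ \<epsilon>] \<alpha> that phi_self by auto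
  show ?thesis
    using deriv_coeff_bound[OF c s0 lower disjI1[OF van] pos family_ess_bound[OF u0 disjI2[OF van] F E]] .
qed

text \<open>Decay of \<open>u\<close> is needed before that of \<open>v\<close>, and both before either quantitative bound, because the
  argument with the compact perturbation uses decay of both coefficients.\<close>

lemma lower_estimate_both:
  assumes \<alpha>: "2 \<le> \<alpha>" and c: "0 < c" "0 < d" "0 \<le> C" and F: "test_family \<alpha> s0 B F" and G: "test_family \<alpha> s1 A G"
    and lower: "\<And>a. s0 < cmod a \<Longrightarrow> cmod a < 1 \<Longrightarrow> c * crit_weight (\<alpha> - 1) (cmod a) \<le> cmod (deriv (F a) a)"
    and diag: "\<And>a. s0 < cmod a \<Longrightarrow> cmod a < 1 \<Longrightarrow> F a a = 0"
    and lowerG: "\<And>a. s1 < cmod a \<Longrightarrow> cmod a < 1 \<Longrightarrow> d * crit_weight (\<alpha> - 2) (cmod a) \<le> cmod (G a a)"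
    and upperG: "\<And>a. s1 < cmod a \<Longrightarrow> cmod a < 1 \<Longrightarrow> cmod (deriv (G a) a) \<le> C * crit_weight (\<alpha> - 1) (cmod a)"
    and E: "ess_norm \<alpha> \<beta> T < ereal E"
  defines "Q \<equiv> 2 * ((2 * B + 1) * E) / c"
  shows "bdry_le u \<phi> (crit_weight (\<alpha> - 1)) \<beta> Q"
    "bdry_le v \<phi> (crit_weight (\<alpha> - 2)) \<beta> (((2 * A + 1) * E + C * Q) / d)"
proof -
  have s0: "s0 < 1" and B: "0 < B" and s1: "s1 < 1" using F G by (auto simp: test_family_def)
  have diag': "vanishing_family F \<or> (\<forall>a. s0 < cmod a \<and> cmod a < 1 \<longrightarrow> F a a = 0)" using diag by blast
  have "0 < E" using ess_norm_nonneg E order_le_less_trans[of 0 "ess_norm \<alpha> \<beta> T" "ereal E"] by simp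
  then have pos: "0 < (2 * B + 1) * E" using B by simp
  obtain P where P: "0 < P" "\<exists>s<1. \<forall>z\<in>unit_disc. s < cmod (\<phi> z) \<longrightarrow> ev (F (\<phi> z)) z \<le> P"
    using family_bounded[OF F] by blast
  note u1 = deriv_coeff_bound[OF c(1) s0 lower diag' P]
  then have u0: "bdry_le u \<phi> (\<lambda>_. 1) \<beta> \<epsilon>" if "0 < \<epsilon>" for \<epsilon>
    using bdry_le_small[of "\<alpha> - 1" u \<phi> \<beta> _ \<epsilon>] \<alpha> that phi_self by auto
  obtain R where R: "0 < R" "\<exists>s<1. \<forall>z\<in>unit_disc. s < cmod (\<phi> z) \<longrightarrow> ev (G (\<phi> z)) z \<le> R"
    using family_bounded[OF G] by blast
  have "bdry_le v \<phi> (\<lambda>_. 1) \<beta> \<epsilon>" if "0 < \<epsilon>" for \<epsilon>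
    using bdry_le_small[OF _ value_coeff_bound[OF c(2,3) s1 lowerG upperG u1 R(2)] that phi_self] \<alpha> by simp
  then have v0: "(\<forall>\<epsilon>>0. bdry_le v \<phi> (\<lambda>_. 1) \<beta> \<epsilon>) \<or> vanishing_family H" for H by blast
  show uQ: "bdry_le u \<phi> (crit_weight (\<alpha> - 1)) \<beta> Q"
    unfolding Q_def using deriv_coeff_bound[OF c(1) s0 lower diag' pos family_ess_bound[OF u0 v0 F E]] .
  show "bdry_le v \<phi> (crit_weight (\<alpha> - 2)) \<beta> (((2 * A + 1) * E + C * Q) / d)"
    using value_coeff_bound[OF c(2,3) s1 lowerG upperG uQ family_ess_bound[OF u0 v0 G E]] .
qed

end

section \<open>Comparison with the upper limits\<close>

text \<open>Both directions of the comparison are proved for real numbers strictly above the right-hand side.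
  This also covers an infinite right-hand side.\<close>

lemma ereal_le_mult_of_all_greater:
  fixes X Y :: ereal
  assumes C: "0 < C" and Y: "0 \<le> Y" and le: "\<And>L. Y < ereal L \<Longrightarrow> X \<le> ereal (C * L)"
  shows "X \<le> ereal C * Y"
proof (cases Y)
  case (real y)
  show ?thesis
  proof (rule ereal_le_epsilon2)
    fix e :: real assume e: "0 < e"
    then have "X \<le> ereal (C * (y + e / C))" using C real by (intro le) simp
    also have "C * (y + e / C) = C * y + e" using C by (simp add: field_simps)
    finally show "X \<le> ereal C * Y + ereal e" by (simp add: real)
  qed
qed (use C Y in auto)

lemma limsup_nonneg:
  assumes "\<And>n. 0 \<le> a n"
  shows "0 \<le> limsup (\<lambda>n. ereal (a n) * weighted_norm \<beta> (f n))"
proof -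
  have "0 \<le> liminf (\<lambda>n. ereal (a n) * weighted_norm \<beta> (f n))"
    using assms weighted_norm_nonneg by (intro Liminf_bounded) auto
  also have "\<dots> \<le> limsup (\<lambda>n. ereal (a n) * weighted_norm \<beta> (f n))" by (intro Liminf_le_Limsup) simp
  finally show ?thesis .
qed

lemma comparable_onI:
  assumes "0 < C" "0 < D" "\<And>x. x \<in> S \<Longrightarrow> A x \<le> ereal C * B x" "\<And>x. x \<in> S \<Longrightarrow> B x \<le> ereal D * A x"
  shows "comparable_on S A B"
proof -
  have "ereal (1 / C) * A x \<le> B x" if x: "x \<in> S" for x
  proof -
    have "ereal (1 / C) * A x \<le> ereal (1 / C) * (ereal C * B x)"
      using assms(1,3) x by (intro ereal_mult_left_mono) auto
    also have "\<dots> = B x" using assms(1) by (simp add: mult.assoc[symmetric])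
    finally show ?thesis .
  qed
  moreover have "0 < 1 / C" using assms(1) by simp
  ultimately show ?thesis unfolding comparable_on_def using assms(2,4) by blast
qed

definition deriv_limsup :: "real \<Rightarrow> real \<Rightarrow> (complex \<Rightarrow> complex) \<Rightarrow> (complex \<Rightarrow> complex) \<Rightarrow> ereal" where
  "deriv_limsup \<gamma> \<beta> g \<phi> = limsup (\<lambda>n. ereal (crit_seq \<gamma> n) *
     weighted_norm \<beta> (\<lambda>z. deriv g z * deriv \<phi> z * \<phi> z ^ n))"

definition value_limsup :: "real \<Rightarrow> real \<Rightarrow> (complex \<Rightarrow> complex) \<Rightarrow> (complex \<Rightarrow> complex) \<Rightarrow> ereal" where
  "value_limsup \<gamma> \<beta> g \<phi> = limsup (\<lambda>n. ereal (crit_seq \<gamma> n) *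
     weighted_norm \<beta> (\<lambda>z. deriv (deriv g) z * \<phi> z ^ n))"

lemma crit_seq_nonneg: "0 \<le> crit_seq \<gamma> n"
  by (cases "n = 0") (auto simp: crit_seq_def)

lemma ess_norm_zero:
  assumes "bounded_UC \<alpha> \<beta> g \<phi>" and \<alpha>: "\<alpha> < 1"
  shows "ess_norm \<alpha> \<beta> (UC g \<phi>) = 0"
proof -
  interpret bounded_UC \<alpha> \<beta> g \<phi> by fact
  have "ess_norm \<alpha> \<beta> T \<le> ereal (0 + 0)"
    using \<alpha> by (intro ess_norm_le tail_deriv_small tail_value_small) auto
  then show ?thesis using ess_norm_nonneg by (simp add: zero_ereal_def[symmetric])
qed

text \<open>All constants are obtained before \<open>g\<close> and \<open>\<phi>\<close> are fixed, as \<open>comparable_on\<close> demands.\<close>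

lemma comparable_below_two:
  assumes \<alpha>: "1 \<le> \<alpha>" "\<alpha> < 2" and S: "\<And>g \<phi>. (g, \<phi>) \<in> S \<Longrightarrow> bounded_UC \<alpha> \<beta> g \<phi>"
  shows "comparable_on S (\<lambda>(g, \<phi>). ess_norm \<alpha> \<beta> (UC g \<phi>)) (\<lambda>(g, \<phi>). deriv_limsup (\<alpha> - 1) \<beta> g \<phi>)"
proof -
  have "0 \<le> \<alpha> - 1" using \<alpha> by simp
  then obtain R where R: "weight_pair (crit_seq (\<alpha> - 1)) (crit_weight (\<alpha> - 1)) R" using weight_pair_crit by blast
  have R0: "0 < R" using R by (simp add: weight_pair_def)
  obtain k where k: "0 < k" "\<forall>f\<in>zyg_unit_ball \<alpha>. \<forall>w x. cmod w \<le> x \<longrightarrow> 1/2 \<le> x \<longrightarrow> x < 1 \<longrightarrow>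
    cmod (deriv f w) \<le> k * crit_weight (\<alpha> - 1) x" using zyg_deriv_crit[OF \<alpha>(1)] by blast
  have "\<exists>F B c s0. test_family \<alpha> s0 B F \<and> 0 < c \<and>
    (\<forall>a. s0 < cmod a \<and> cmod a < 1 \<longrightarrow> c * crit_weight (\<alpha> - 1) (cmod a) \<le> cmod (deriv (F a) a)) \<and> vanishing_family F"
  proof (cases "\<alpha> = 1")
    case True
    obtain F B c where "test_family 1 (3/4) B F" "0 < c" "vanishing_family F"
      "\<And>a. 3/4 < cmod a \<Longrightarrow> cmod a < 1 \<Longrightarrow> c * crit_weight 0 (cmod a) \<le> cmod (deriv (F a) a)"
      using deriv_test_family_log by blast
    then show ?thesis
      using True by (intro exI[of _ F] exI[of _ B] exI[of _ c] exI[of _ "3/4"]) auto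
  next
    case False
    then show ?thesis using deriv_test_family_power[of \<alpha>] \<alpha> by fastforce
  qed
  then obtain F B c s0 where F: "test_family \<alpha> s0 B F" "0 < c" "vanishing_family F"
    "\<And>a. s0 < cmod a \<Longrightarrow> cmod a < 1 \<Longrightarrow> c * crit_weight (\<alpha> - 1) (cmod a) \<le> cmod (deriv (F a) a)" by blast
  have B: "0 < B" using F(1) by (simp add: test_family_def)
  define D where "D = R * (2 * (2 * B + 1) / c)"
  have main: "ess_norm \<alpha> \<beta> (UC g \<phi>) \<le> ereal (2 * k * R) * deriv_limsup (\<alpha> - 1) \<beta> g \<phi>"
    "deriv_limsup (\<alpha> - 1) \<beta> g \<phi> \<le> ereal D * ess_norm \<alpha> \<beta> (UC g \<phi>)" if g: "(g, \<phi>) \<in> S" for g \<phi>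
  proof -
    interpret bounded_UC \<alpha> \<beta> g \<phi> by (rule S[OF g])
    have lu: "deriv_limsup (\<alpha> - 1) \<beta> g \<phi> = limsup (\<lambda>n. ereal (crit_seq (\<alpha> - 1) n) * weighted_norm \<beta> (\<lambda>z. u z * \<phi> z ^ n))"
      by (simp add: deriv_limsup_def u_def)
    have nn: "0 \<le> deriv_limsup (\<alpha> - 1) \<beta> g \<phi>" unfolding lu by (rule limsup_nonneg[OF crit_seq_nonneg])
    obtain M where M: "0 < M" "\<And>z. z \<in> unit_disc \<Longrightarrow> wu z \<le> M" "\<And>z. z \<in> unit_disc \<Longrightarrow> wv z \<le> M" using coeff_bounded by blast
    show "ess_norm \<alpha> \<beta> T \<le> ereal (2 * k * R) * deriv_limsup (\<alpha> - 1) \<beta> g \<phi>"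
    proof (rule ereal_le_mult_of_all_greater[OF _ nn])
      show "0 < 2 * k * R" using k(1) R0 by simp
      fix L assume L: "deriv_limsup (\<alpha> - 1) \<beta> g \<phi> < ereal L"
      have "0 < L" using order_le_less_trans[OF nn L] by simp
      have "ess_norm \<alpha> \<beta> T \<le> ereal (2 * k * (R * L) + 0)"
      proof (rule ess_norm_le)
        show "tail_le u osc1 (2 * k * (R * L))"
          by (rule tail_deriv[OF k bdry_le_of_limsup[OF R phi_self L[unfolded lu]]])
        show "tail_le v osc0 0" by (rule tail_value_small[OF \<alpha>(2)])
      qed (use k(1) R0 \<open>0 < L\<close> in auto)
      then show "ess_norm \<alpha> \<beta> T \<le> ereal (2 * k * R * L)" by (simp add: mult.assoc)
    qed
    show "deriv_limsup (\<alpha> - 1) \<beta> g \<phi> \<le> ereal D * ess_norm \<alpha> \<beta> T"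
    proof (rule ereal_le_mult_of_all_greater[OF _ ess_norm_nonneg])
      show "0 < D" using R0 B F(2) by (simp add: D_def)
      fix E assume E: "ess_norm \<alpha> \<beta> T < ereal E"
      have "0 < E" using order_le_less_trans[OF ess_norm_nonneg E] by simp
      have "deriv_limsup (\<alpha> - 1) \<beta> g \<phi> \<le> ereal (R * (2 * ((2 * B + 1) * E) / c))"
        unfolding lu
      proof (rule limsup_le_of_bdry_le[OF R phi_self M(2)])
        show "0 < 2 * ((2 * B + 1) * E) / c" using B F(2) \<open>0 < E\<close> by simp
        show "bdry_le u \<phi> (crit_weight (\<alpha> - 1)) \<beta> (2 * ((2 * B + 1) * E) / c)"
          by (rule lower_estimate_deriv[OF \<alpha>(1) F(2,1,4,3) E])
      qed
      also have "R * (2 * ((2 * B + 1) * E) / c) = D * E" by (simp add: D_def)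
      finally show "deriv_limsup (\<alpha> - 1) \<beta> g \<phi> \<le> ereal (D * E)" .
    qed
  qed
  show ?thesis
  proof (rule comparable_onI)
    show "0 < 2 * k * R" "0 < D" using k(1) R0 R0 B F(2) by (auto simp: D_def)
  qed (use main in auto)
qed

lemma comparable_from_two:
  assumes \<alpha>: "2 \<le> \<alpha>" and S: "\<And>g \<phi>. (g, \<phi>) \<in> S \<Longrightarrow> bounded_UC \<alpha> \<beta> g \<phi>"
  shows "comparable_on S (\<lambda>(g, \<phi>). ess_norm \<alpha> \<beta> (UC g \<phi>))
    (\<lambda>(g, \<phi>). max (deriv_limsup (\<alpha> - 1) \<beta> g \<phi>) (value_limsup (\<alpha> - 2) \<beta> g \<phi>))"
proof -
  have "0 \<le> \<alpha> - 1" "0 \<le> \<alpha> - 2" using \<alpha> by auto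
  then obtain R V where R: "weight_pair (crit_seq (\<alpha> - 1)) (crit_weight (\<alpha> - 1)) R"
    and V: "weight_pair (crit_seq (\<alpha> - 2)) (crit_weight (\<alpha> - 2)) V" using weight_pair_crit by blast
  have R0: "0 < R" and V0: "0 < V" using R V by (auto simp: weight_pair_def)
  have "1 \<le> \<alpha>" using \<alpha> by simp
  then obtain k where k: "0 < k" "\<forall>f\<in>zyg_unit_ball \<alpha>. \<forall>w x. cmod w \<le> x \<longrightarrow> 1/2 \<le> x \<longrightarrow> x < 1 \<longrightarrow>
    cmod (deriv f w) \<le> k * crit_weight (\<alpha> - 1) x" using zyg_deriv_crit by blast
  obtain l where l: "0 < l" "\<forall>f\<in>zyg_unit_ball \<alpha>. \<forall>w x. cmod w \<le> x \<longrightarrow> 1/2 \<le> x \<longrightarrow> x < 1 \<longrightarrow>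
    cmod (f w) \<le> l * crit_weight (\<alpha> - 2) x" using zyg_value_crit[OF \<alpha>] by blast
  have "1 < \<alpha>" using \<alpha> by simp
  from deriv_test_family_power[OF this] obtain F B c where F: "test_family \<alpha> (1/2) B F" "0 < c"
    "\<And>a. 1/2 < cmod a \<Longrightarrow> cmod a < 1 \<Longrightarrow> c * crit_weight (\<alpha> - 1) (cmod a) \<le> cmod (deriv (F a) a)"
    "\<And>a. 1/2 < cmod a \<Longrightarrow> cmod a < 1 \<Longrightarrow> F a a = 0" by blast
  from value_test_family[OF \<alpha>] obtain G A d C where G: "test_family \<alpha> (3/4) A G" "0 < d" "0 \<le> C"
    "\<And>a. 3/4 < cmod a \<Longrightarrow> cmod a < 1 \<Longrightarrow> d * crit_weight (\<alpha> - 2) (cmod a) \<le> cmod (G a a)"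
    "\<And>a. 3/4 < cmod a \<Longrightarrow> cmod a < 1 \<Longrightarrow> cmod (deriv (G a) a) \<le> C * crit_weight (\<alpha> - 1) (cmod a)" by blast
  have BA: "0 < B" "0 < A" using F(1) G(1) by (auto simp: test_family_def)
  define q where "q = 2 * (2 * B + 1) / c"
  define q' where "q' = (2 * A + 1 + C * q) / d"
  have q: "0 < q" using BA F(2) by (simp add: q_def)
  then have q': "0 < q'" unfolding q'_def using BA G(2,3) by (intro divide_pos_pos add_pos_nonneg) auto
  define D where "D = max (R * q) (V * q')"
  define U where "U = 2 * k * R + 2 * l * V"
  let ?max = "\<lambda>g \<phi>. max (deriv_limsup (\<alpha> - 1) \<beta> g \<phi>) (value_limsup (\<alpha> - 2) \<beta> g \<phi>)"
  have D: "0 < D" using R0 q by (simp add: D_def less_max_iff_disj)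
  have U: "0 < U" using k(1) R0 l(1) V0 by (simp add: U_def add_pos_pos)
  have main: "ess_norm \<alpha> \<beta> (UC g \<phi>) \<le> ereal U * ?max g \<phi>"
    "?max g \<phi> \<le> ereal D * ess_norm \<alpha> \<beta> (UC g \<phi>)" if g: "(g, \<phi>) \<in> S" for g \<phi>
  proof -
    interpret bounded_UC \<alpha> \<beta> g \<phi> by (rule S[OF g])
    have lu: "deriv_limsup (\<alpha> - 1) \<beta> g \<phi> = limsup (\<lambda>n. ereal (crit_seq (\<alpha> - 1) n) * weighted_norm \<beta> (\<lambda>z. u z * \<phi> z ^ n))"
      by (simp add: deriv_limsup_def u_def)
    have lv: "value_limsup (\<alpha> - 2) \<beta> g \<phi> = limsup (\<lambda>n. ereal (crit_seq (\<alpha> - 2) n) * weighted_norm \<beta> (\<lambda>z. v z * \<phi> z ^ n))"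
      by (simp add: value_limsup_def v_def)
    have "0 \<le> deriv_limsup (\<alpha> - 1) \<beta> g \<phi>" unfolding lu by (rule limsup_nonneg[OF crit_seq_nonneg])
    then have nn: "0 \<le> ?max g \<phi>" by (simp add: le_max_iff_disj)
    obtain M where M: "0 < M" "\<And>z. z \<in> unit_disc \<Longrightarrow> wu z \<le> M" "\<And>z. z \<in> unit_disc \<Longrightarrow> wv z \<le> M" using coeff_bounded by blast
    show "ess_norm \<alpha> \<beta> T \<le> ereal U * ?max g \<phi>"
    proof (rule ereal_le_mult_of_all_greater[OF U nn])
      fix L assume L: "?max g \<phi> < ereal L"
      have "0 < L" using order_le_less_trans[OF nn L] by simp
      have L1: "deriv_limsup (\<alpha> - 1) \<beta> g \<phi> < ereal L" and L0: "value_limsup (\<alpha> - 2) \<beta> g \<phi> < ereal L"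
        using L by auto
      have "ess_norm \<alpha> \<beta> T \<le> ereal (2 * k * (R * L) + 2 * l * (V * L))"
      proof (rule ess_norm_le)
        show "tail_le u osc1 (2 * k * (R * L))"
          by (rule tail_deriv[OF k bdry_le_of_limsup[OF R phi_self L1[unfolded lu]]])
        show "tail_le v osc0 (2 * l * (V * L))"
          by (rule tail_value[OF l bdry_le_of_limsup[OF V phi_self L0[unfolded lv]]])
      qed (use k(1) R0 l(1) V0 \<open>0 < L\<close> in auto)
      then show "ess_norm \<alpha> \<beta> T \<le> ereal (U * L)" by (simp add: U_def distrib_right mult.assoc)
    qed
    show "?max g \<phi> \<le> ereal D * ess_norm \<alpha> \<beta> T"
    proof (rule ereal_le_mult_of_all_greater[OF D ess_norm_nonneg])
      fix E assume E: "ess_norm \<alpha> \<beta> T < ereal E"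
      have E0: "0 < E" using order_le_less_trans[OF ess_norm_nonneg E] by simp
      note low = lower_estimate_both[OF \<alpha> F(2) G(2,3) F(1) G(1) F(3,4) G(4,5) E]
      have eq: "2 * ((2 * B + 1) * E) / c = q * E" "((2 * A + 1) * E + C * (q * E)) / d = q' * E"
        by (simp_all add: q_def q'_def algebra_simps add_divide_distrib)
      have "deriv_limsup (\<alpha> - 1) \<beta> g \<phi> \<le> ereal (R * (q * E))"
        unfolding lu using E0 q low(1)[unfolded eq] by (intro limsup_le_of_bdry_le[OF R phi_self M(2)]) auto
      also have "R * (q * E) \<le> D * E" using E0 by (simp add: D_def mult.assoc[symmetric] mult_right_mono)
      finally have 1: "deriv_limsup (\<alpha> - 1) \<beta> g \<phi> \<le> ereal (D * E)" by simp
      have "value_limsup (\<alpha> - 2) \<beta> g \<phi> \<le> ereal (V * (q' * E))"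
        unfolding lv using E0 q' low(2)[unfolded eq] by (intro limsup_le_of_bdry_le[OF V phi_self M(3)]) auto
      also have "V * (q' * E) \<le> D * E" using E0 by (simp add: D_def mult.assoc[symmetric] mult_right_mono)
      finally have 2: "value_limsup (\<alpha> - 2) \<beta> g \<phi> \<le> ereal (D * E)" by simp
      show "?max g \<phi> \<le> ereal (D * E)" using 1 2 by simp
    qed
  qed
  show ?thesis by (rule comparable_onI[OF U D]) (use main in auto)
qed

theorem theorem3p4:
  fixes \<alpha> \<beta> :: real
    and S :: "((complex \<Rightarrow> complex) \<times> (complex \<Rightarrow> complex)) set"
  assumes "0 < \<alpha>" and "0 < \<beta>"
    and S: "S = {(g, \<phi>). g holomorphic_on unit_disc \<and>
                 \<phi> holomorphic_on unit_disc \<and> \<phi> ` unit_disc \<subseteq> unit_disc \<and>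
                 bounded_op \<alpha> \<beta> (UC g \<phi>)}"
  shows "(\<alpha> < 1 \<longrightarrow> (\<forall>(g, \<phi>)\<in>S. ess_norm \<alpha> \<beta> (UC g \<phi>) = 0)) \<and>
    (\<alpha> = 1 \<longrightarrow> comparable_on S
      (\<lambda>(g, \<phi>). ess_norm \<alpha> \<beta> (UC g \<phi>))
      (\<lambda>(g, \<phi>). limsup (\<lambda>n. ereal (ln (real n)) *
          weighted_norm \<beta> (\<lambda>z. deriv g z * deriv \<phi> z * \<phi> z ^ n)))) \<and>
    (1 < \<alpha> \<and> \<alpha> < 2 \<longrightarrow> comparable_on S
      (\<lambda>(g, \<phi>). ess_norm \<alpha> \<beta> (UC g \<phi>))
      (\<lambda>(g, \<phi>). limsup (\<lambda>n. ereal ((real n + 1) powr (\<alpha> - 1)) *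
          weighted_norm \<beta> (\<lambda>z. deriv g z * deriv \<phi> z * \<phi> z ^ n)))) \<and>
    (\<alpha> = 2 \<longrightarrow> comparable_on S
      (\<lambda>(g, \<phi>). ess_norm \<alpha> \<beta> (UC g \<phi>))
      (\<lambda>(g, \<phi>). max
        (limsup (\<lambda>n. ereal (real n + 1) *
          weighted_norm \<beta> (\<lambda>z. deriv g z * deriv \<phi> z * \<phi> z ^ n)))
        (limsup (\<lambda>n. ereal (ln (real n)) *
          weighted_norm \<beta> (\<lambda>z. deriv (deriv g) z * \<phi> z ^ n))))) \<and>
    (2 < \<alpha> \<longrightarrow> comparable_on S
      (\<lambda>(g, \<phi>). ess_norm \<alpha> \<beta> (UC g \<phi>))
      (\<lambda>(g, \<phi>). max
        (limsup (\<lambda>n. ereal ((real n + 1) powr (\<alpha> - 1)) *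
          weighted_norm \<beta> (\<lambda>z. deriv g z * deriv \<phi> z * \<phi> z ^ n)))
        (limsup (\<lambda>n. ereal ((real n + 1) powr (\<alpha> - 2)) *
          weighted_norm \<beta> (\<lambda>z. deriv (deriv g) z * \<phi> z ^ n)))))"
proof -
  have loc: "bounded_UC \<alpha> \<beta> g \<phi>" if "(g, \<phi>) \<in> S" for g \<phi>
    using that assms by (auto simp: bounded_UC_def)
  note below = comparable_below_two[of \<alpha> S \<beta>, OF _ _ loc, unfolded deriv_limsup_def crit_seq_def]
  note from_two = comparable_from_two[of \<alpha> S \<beta>, OF _ loc, unfolded deriv_limsup_def value_limsup_def crit_seq_def]
  show ?thesis
  proof (intro conjI impI, goal_cases)
    case 1
    then show ?case using ess_norm_zero[OF loc] by auto
  next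
    case 2
    then show ?case using below by simp
  next
    case 3
    then show ?case using below by simp
  next
    case 4
    then show ?case using from_two by simp
  next
    case 5
    then show ?case using from_two by simp
  qed
qed

end
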